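(* Let $m,s,t,l\in\mathbb{N}$ with $l\ge m\ge s$ and $l\ge t+m$. Let $\mathbf{G}$ be the set of all simple finite undirected graphs (not necessarily connected). Then the following hold. (i) If $m=1$, or $m=s+1$, or $l=t+1$, then for every $G\in\mathbf{G}$ the independence polynomial of the graph $E_{\mathcal{G}_4(l,m,t,s)}(G)$ is log-concave. (ii) If $l\ge 1$ and $t=0$, then for every $G\in\mathbf{G}$ the independence polynomial of the graph $E_{\mathcal{G}_4(l,m,t,s)}(G)$ is log-concave.
   Context: $\mathbb{N}=\{0,1,2,\dots\}$. $K_r$ is the complete graph on $r$ vertices ($K_0$ is the empty graph). The independence polynomial of a graph $G$ is $I(G;x)=\sum_{k=0}^{\alpha(G)} i_k(G)x^k$, where $i_k(G)$ is the number of independent sets of size $k$ in $G$ ($i_0(G)=1$) and $\alpha(G)$ is the maximum size of an independent set. It is log-concave if $i_{k-1}(G)\,i_{k+1}(G)\le i_k(G)^2$ for all $1\le k\le \alpha(G)-1$. The graph $\mathcal{F}(l,m,t,s)$ (for $l\ge m\ge s$, $l\ge t+m$): take a vertex $c$ (the center), a vertex $x_i$, and vertex-disjoint complete graphs $K_m$, $K_l$, $K_{m-s}$, $K_{l-t}$. Join $c$ to $x_i$ by an edge; join $c$ to $s$ vertices of $K_m$, to $t$ vertices of $K_l$, to all $m-s$ vertices of $K_{m-s}$, and to $l-t-m$ vertices of $K_{l-t}$; join $x_i$ to all $m$ vertices of $K_m$ and to $l-m$ vertices of $K_l$. There are no other edges. The vertices of the complete graphs to which $c$ and $x_i$ are joined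 may be chosen arbitrarily; the result holds for every such choice. The graph $\mathcal{G}_4(l,m,t,s)$: take two disjoint copies of $\mathcal{F}(l,m,t,s)$, with their vertices $x_i$ named $x_1$ and $x_2$ respectively, and add an edge joining $x_1$ and $x_2$. The two vertices $c$ (one in each copy) are called its endpoints. The operator $E_{\mathcal{G}_4(l,m,t,s)}$ sends a simple finite undirected graph $G$ to the graph obtained by replacing every edge $e=uv$ of $G$ by a new copy of $\mathcal{G}_4(l,m,t,s)$, whose two endpoints are identified with $u$ and $v$ (the edge $e$ itself being removed; different edges use otherwise disjoint copies; isolated vertices are unchanged). *)

theory Defs
  imports "HOL-Library.Ramsey" "HOL-Computational_Algebra.Polynomial"
begin

section \<open>Independence polynomials of finite simple graphs\<close>

text \<open>A graph is a pair of a vertex set and a set of two-element vertex sets.\<close>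

type_synonym 'a graph = "'a set \<times> 'a set set"

abbreviation verts :: "'a graph \<Rightarrow> 'a set" where
  "verts \<equiv> fst"

abbreviation edges :: "'a graph \<Rightarrow> 'a set set" where
  "edges \<equiv> snd"

definition simple_graph :: "'a graph \<Rightarrow> bool" where
  "simple_graph G \<longleftrightarrow> finite (verts G) \<and> edges G \<subseteq> [verts G]\<^bsup>2\<^esup>"

definition indep_sets :: "'a graph \<Rightarrow> 'a set set" where
  "indep_sets G = {S. S \<subseteq> verts G \<and> indep S (edges G)}"

definition indep_num :: "'a graph \<Rightarrow> nat" where
  "indep_num G = Max (card ` indep_sets G)"

definition indep_count :: "'a graph \<Rightarrow> nat \<Rightarrow> nat" where
  "indep_count G k = card {S \<in> indep_sets G. card S = k}"

definition indep_poly :: "'a graph \<Rightarrow> int poly" where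
  "indep_poly G = (\<Sum>k\<le>indep_num G. monom (int (indep_count G k)) k)"

definition log_concave :: "int poly \<Rightarrow> bool" where
  "log_concave p \<longleftrightarrow>
     (\<forall>k. 1 \<le> k \<and> k \<le> degree p - 1 \<longrightarrow> coeff p (k - 1) * coeff p (k + 1) \<le> (coeff p k)\<^sup>2)"

text \<open>By the next lemma, \<open>log_concave (indep_poly G)\<close> ranges over exactly the indices \<open>k\<close>
  with \<open>1 \<le> k \<le> indep_num G - 1\<close>.\<close>

lemma degree_indep_poly:
  assumes "simple_graph G"
  shows "degree (indep_poly G) = indep_num G"
proof -
  let ?a = "indep_num G"
  have fin: "finite (indep_sets G)"
    using assms by (auto simp: simple_graph_def indep_sets_def intro: finite_subset[of _ "Pow (verts G)"])
  have "{} \<in> indep_sets G"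
    by (auto simp: indep_sets_def)
  with fin have "?a \<in> card ` indep_sets G"
    unfolding indep_num_def by (intro Max_in) auto
  then have "{S \<in> indep_sets G. card S = ?a} \<noteq> {}"
    by auto
  with fin have nz: "indep_count G ?a \<noteq> 0"
    by (simp add: indep_count_def)
  have co: "coeff (indep_poly G) k = (if k \<le> ?a then int (indep_count G k) else 0)" for k
    by (simp add: indep_poly_def coeff_sum)
  show ?thesis
  proof (rule antisym)
    show "degree (indep_poly G) \<le> ?a"
      by (rule degree_le) (simp add: co)
    show "?a \<le> degree (indep_poly G)"
      by (rule le_degree) (simp add: co nz)
  qed
qed

section \<open>The graph F(l,m,t,s)\<close>

text \<open>\<open>Km i\<close>, \<open>Kl i\<close>, \<open>Kms i\<close>, \<open>Klt i\<close> are the vertices of the complete graphs on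
  \<open>m\<close>, \<open>l\<close>, \<open>m - s\<close> and \<open>l - t\<close> vertices; \<open>X\<close> is the vertex that becomes
  \<open>x\<^sub>1\<close> or \<open>x\<^sub>2\<close> below.\<close>

datatype fvert = Center | X | Km nat | Kl nat | Kms nat | Klt nat

text \<open>The four free choices of attaching vertices, as sets of indices: the neighbours of the
  centre in \<open>K\<^sub>m\<close>, \<open>K\<^sub>l\<close>, \<open>K\<^sub>l\<^sub>-\<^sub>t\<close>, and the neighbours of \<open>X\<close> in \<open>K\<^sub>l\<close>.\<close>

record attachment =
  center_Km :: "nat set"
  center_Kl :: "nat set"
  center_Klt :: "nat set"
  X_Kl :: "nat set"

definition valid_attachment :: "nat \<Rightarrow> nat \<Rightarrow> nat \<Rightarrow> nat \<Rightarrow> attachment \<Rightarrow> bool" where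
  "valid_attachment l m t s a \<longleftrightarrow>
     center_Km a \<in> [{..<m}]\<^bsup>s\<^esup> \<and>
     center_Kl a \<in> [{..<l}]\<^bsup>t\<^esup> \<and>
     center_Klt a \<in> [{..<l - t}]\<^bsup>(l - t - m)\<^esup> \<and>
     X_Kl a \<in> [{..<l}]\<^bsup>(l - m)\<^esup>"

definition join_edges :: "'a \<Rightarrow> 'a set \<Rightarrow> 'a set set" where
  "join_edges v A = {{v, w} |w. w \<in> A}"

definition F_graph :: "nat \<Rightarrow> nat \<Rightarrow> nat \<Rightarrow> nat \<Rightarrow> attachment \<Rightarrow> fvert graph" where
  "F_graph l m t s a =
    ({Center, X} \<union> Km ` {..<m} \<union> Kl ` {..<l} \<union> Kms ` {..<m - s} \<union> Klt ` {..<l - t},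
     [Km ` {..<m}]\<^bsup>2\<^esup> \<union> [Kl ` {..<l}]\<^bsup>2\<^esup> \<union> [Kms ` {..<m - s}]\<^bsup>2\<^esup> \<union> [Klt ` {..<l - t}]\<^bsup>2\<^esup> \<union>
     {{Center, X}} \<union>
     join_edges Center (Km ` center_Km a) \<union>
     join_edges Center (Kl ` center_Kl a) \<union>
     join_edges Center (Kms ` {..<m - s}) \<union>
     join_edges Center (Klt ` center_Klt a) \<union>
     join_edges X (Km ` {..<m}) \<union>
     join_edges X (Kl ` X_Kl a))"

section \<open>The graph G4(l,m,t,s)\<close>

text \<open>The tags \<open>False\<close> and \<open>True\<close> distinguish the two copies of F(l,m,t,s). Each copy has its
  own choice of attaching vertices.\<close>

definition G4_graph ::
    "nat \<Rightarrow> nat \<Rightarrow> nat \<Rightarrow> nat \<Rightarrow> attachment \<Rightarrow> attachment \<Rightarrow> (bool \<times> fvert) graph" where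
  "G4_graph l m t s a b =
    (Pair False ` verts (F_graph l m t s a) \<union> Pair True ` verts (F_graph l m t s b),
     image (Pair False) ` edges (F_graph l m t s a) \<union>
     image (Pair True) ` edges (F_graph l m t s b) \<union>
     {{(False, X), (True, X)}})"

section \<open>Replacing edges by copies of a graph with two endpoints\<close>

text \<open>\<open>orient e = (u, v)\<close> lists the two ends of the edge \<open>e\<close>; it says which endpoint of the
  inserted graph is identified with which end of \<open>e\<close>.\<close>

definition orientation :: "'a graph \<Rightarrow> ('a set \<Rightarrow> 'a \<times> 'a) \<Rightarrow> bool" where
  "orientation G orient \<longleftrightarrow> (\<forall>e\<in>edges G. e = {fst (orient e), snd (orient e)})"

text \<open>The vertex of the new graph that corresponds to the vertex \<open>h\<close> of the copy inserted for
  \<open>e\<close>: the endpoints \<open>p\<close> and \<open>q\<close> become the ends of \<open>e\<close>; all other vertices are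
  private to \<open>e\<close>.\<close>

definition place ::
    "'h \<Rightarrow> 'h \<Rightarrow> ('a set \<Rightarrow> 'a \<times> 'a) \<Rightarrow> 'a set \<Rightarrow> 'h \<Rightarrow> 'a + 'a set \<times> 'h" where
  "place p q orient e h =
     (if h = p then Inl (fst (orient e)) else if h = q then Inl (snd (orient e)) else Inr (e, h))"

definition replace_edges ::
    "('a set \<Rightarrow> 'h graph) \<Rightarrow> 'h \<Rightarrow> 'h \<Rightarrow> ('a set \<Rightarrow> 'a \<times> 'a) \<Rightarrow> 'a graph \<Rightarrow>
     ('a + 'a set \<times> 'h) graph" where
  "replace_edges H p q orient G =
    (Inl ` verts G \<union> (\<Union>e\<in>edges G. place p q orient e ` verts (H e)),
     (\<Union>e\<in>edges G. image (place p q orient e) ` edges (H e)))"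

text \<open>The attaching vertices \<open>a e\<close>, \<open>b e\<close> may differ from one edge \<open>e\<close> to the next.\<close>

definition E_G4 ::
    "nat \<Rightarrow> nat \<Rightarrow> nat \<Rightarrow> nat \<Rightarrow> ('a set \<Rightarrow> attachment) \<Rightarrow> ('a set \<Rightarrow> attachment) \<Rightarrow>
     ('a set \<Rightarrow> 'a \<times> 'a) \<Rightarrow> 'a graph \<Rightarrow> ('a + 'a set \<times> bool \<times> fvert) graph" where
  "E_G4 l m t s a b orient G =
     replace_edges (\<lambda>e. G4_graph l m t s (a e) (b e)) (False, Center) (True, Center) orient G"

text \<open>All graphs that the construction can produce from \<open>G\<close>, for the various choices of
  attaching vertices (and of the labelling of the ends of each edge).\<close>

definition E_G4_graphs ::
    "nat \<Rightarrow> nat \<Rightarrow> nat \<Rightarrow> nat \<Rightarrow> 'a graph \<Rightarrow> ('a + 'a set \<times> bool \<times> fvert) graph set" where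
  "E_G4_graphs l m t s G =
     {E_G4 l m t s a b orient G |a b orient.
        orientation G orient \<and>
        (\<forall>e\<in>edges G. valid_attachment l m t s (a e) \<and> valid_attachment l m t s (b e))}"

end

theory Submission
  imports Defs "HOL-Library.Disjoint_Sets"
begin

text \<open>
  Each of the conditions in (i) and in (ii) gives \<open>l \<ge> 1\<close>. Put \<open>y = 1 + (l + 1) x\<close> and
  \<open>P = (1 + m x) (1 + (m - s) x) (1 + (l - t) x)\<close>. For prescribed states of the two endpoints, the independent sets of the rest of a copy of G4 are counted by \<open>P\<^sup>2\<close> times
  \<open>y\<^sup>2 - x\<^sup>2\<close>, \<open>y\<close> or \<open>1\<close>, according to whether none, one or both endpoints are chosen; the attaching
  vertices do not matter (\<open>G4_gf_eq\<close>). Therefore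
  \<open>I(E(G); x) = P\<^bsup>2|E|\<^esup> (1 + x)\<^bsup>i\<^esup> Z(x)\<close>, where \<open>i\<close> is the number of isolated vertices of \<open>G\<close> and \<open>Z\<close> is
  the sum, over the sets \<open>S\<close> of non-isolated vertices, of \<open>x\<^bsup>|S|\<^esup>\<close> times one factor \<open>y\<^sup>2 - x\<^sup>2\<close>, \<open>y\<close> or \<open>1\<close>
  for each edge of \<open>G\<close>. Multiplying by \<open>1 + c x\<close> with \<open>c \<ge> 0\<close> preserves strong log-concavity, so it is
  enough to treat \<open>Z\<close>.

  Now polarise \<open>Z\<close>. With \<open>a = l + 1\<close>, cut each edge of \<open>G\<close> into two half-edges, each with a
  variable of its own: an unchosen vertex contributes \<open>1 + a x\<^sub>h\<close> for each half-edge \<open>h\<close> at it, and a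
  chosen vertex contributes the average of the variables of the half-edges at it; an edge with halves
  \<open>h\<close>, \<open>k\<close> and unchosen ends contributes \<open>(1 + a x\<^sub>h) (1 + a x\<^sub>k) - x\<^sub>h x\<^sub>k\<close>. In this form
  \<open>Z\<close> is the sum of \<open>a\<^bsup>|\<alpha>|\<^esup> F(\<alpha>) x\<^bsup>|\<alpha>|\<^esup>\<close> over all sets \<open>\<alpha>\<close> of half-edges (\<open>polarisation\<close>).
  A chosen vertex meets \<open>\<alpha>\<close> in exactly one half-edge, so the sum over \<open>S\<close> hidden in \<open>F(\<alpha>)\<close> concerns
  only vertices with exactly one half-edge in \<open>\<alpha>\<close>; such a vertex interacts with one edge only, and
  \<open>F(\<alpha>)\<close> is a product over the edges of \<open>G\<close>.

  For a positive function \<open>F\<close> on the subsets of a finite set, ultra-log-concavity of the sums over the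
  subsets of size \<open>k\<close> follows from a condition on the values \<open>F(\<alpha>)\<close>, \<open>F(\<alpha> \<union> {h})\<close>,
  \<open>F(\<alpha> \<union> {h, k})\<close> for each fixed \<open>\<alpha>\<close>: the Hessian at \<open>0\<close> of the logarithm of the generating
  polynomial of \<open>\<gamma> \<mapsto> F(\<alpha> \<union> \<gamma>)\<close> is negative semidefinite (\<open>ultra_log_concave_level_sums\<close>). This is the
  local-to-global principle for Lorentzian (completely log-concave) polynomials of Braenden and Huh, and of
  Anari, Liu, Oveis Gharan and Vinzant; its heart is the linear algebra of \<open>one_positive_eigenvalue\<close>.

  It remains to check the local condition (\<open>half_edge_local_condition\<close>). Two half-edges outside \<open>\<alpha>\<close>
  are correlated only if they lie at the same vertex or at adjacent ones, and the correlations are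
  small because \<open>a \<ge> 2\<close>: a vertex of degree \<open>d\<close> has weight \<open>1/(a d) \<le> 1/(2 d)\<close>, and the interaction
  along an edge is \<open>1/a\<^sup>2 \<le> 1/4\<close>. Adding up the correlations with a given half-edge leaves the Hessian
  diagonally dominant, once a negative semidefinite part has been split off at each vertex that lies on
  no half-edge of \<open>\<alpha>\<close>.
\<close>

section \<open>Strongly log-concave polynomials\<close>

text \<open>Unlike plain log-concavity, this form, which excludes internal zeros, is inherited by products.\<close>

definition strongly_log_concave :: "real poly \<Rightarrow> bool" where
  "strongly_log_concave p \<longleftrightarrow> (\<forall>k. 0 \<le> coeff p k) \<and>
     (\<forall>i j. i \<le> j \<longrightarrow> coeff p i * coeff p (Suc j) \<le> coeff p (Suc i) * coeff p j)"

text \<open>The new coefficients are \<open>u k + c * u (k - 1)\<close>. Comparing powers of \<open>c\<close>, the terms of degree 0 and 2 are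
instances of the hypothesis; in degree 1, two of the four terms cancel and the remaining inequality is a
composition of two instances.\<close>

lemma strongly_log_concave_linear_factor:
  assumes "strongly_log_concave p" "0 \<le> c"
  shows "strongly_log_concave ([:1, c:] * p)"
proof -
  define u where "u k = coeff p k" for k
  have pos: "0 \<le> u k" for k using assms(1) by (simp add: strongly_log_concave_def u_def)
  have lc: "u i * u (Suc j) \<le> u (Suc i) * u j" if "i \<le> j" for i j
    using assms(1) that by (simp add: strongly_log_concave_def u_def)
  have co: "coeff ([:1, c:] * p) 0 = u 0" "coeff ([:1, c:] * p) (Suc k) = u (Suc k) + c * u k" for k
    by (simp_all add: u_def)
  have "coeff ([:1, c:] * p) i * coeff ([:1, c:] * p) (Suc j)
      \<le> coeff ([:1, c:] * p) (Suc i) * coeff ([:1, c:] * p) j" if ij: "i \<le> j" for i j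
  proof (cases i)
    case 0
    show ?thesis
    proof (cases j)
      case (Suc j')
      have "u 0 * u (Suc j) + c * (u 0 * u j) \<le> u (Suc 0) * u j + c * (u 0 * u j) + c * (u (Suc 0) * u j') + c * (c * (u 0 * u j'))"
      proof -
        have "0 \<le> c * (u (Suc 0) * u j')" "0 \<le> c * (c * (u 0 * u j'))"
          using pos assms(2) by simp_all
        then show ?thesis using lc[of 0 j] by simp
      qed
      then show ?thesis unfolding 0 Suc co by (simp add: algebra_simps Suc)
    qed (simp add: 0)
  next
    case (Suc i')
    then obtain j' where j: "j = Suc j'" "i' \<le> j'" using ij by (cases j) auto
    have 1: "u i' * u (Suc (Suc j')) \<le> u (Suc (Suc i')) * u j'"
    proof (cases "i' = j'")
      case False
      have "u i' * u (Suc (Suc j')) \<le> u (Suc i') * u (Suc j')" using j by (intro lc) auto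
      also have "\<dots> \<le> u (Suc (Suc i')) * u j'" using j False by (intro lc) auto
      finally show ?thesis .
    qed (simp add: mult.commute)
    have "u (Suc i') * u (Suc (Suc j')) + c * (u i' * u (Suc (Suc j'))) + c * (u (Suc i') * u (Suc j'))
          + c * (c * (u i' * u (Suc j')))
        \<le> u (Suc (Suc i')) * u (Suc j') + c * (u (Suc (Suc i')) * u j') + c * (u (Suc i') * u (Suc j'))
          + c * (c * (u (Suc i') * u j'))"
    proof -
      have "u (Suc i') * u (Suc (Suc j')) \<le> u (Suc (Suc i')) * u (Suc j')"
        using j by (intro lc) simp
      moreover have "c * (u i' * u (Suc (Suc j'))) \<le> c * (u (Suc (Suc i')) * u j')"
        using 1 assms(2) by (rule mult_left_mono)
      moreover have "c * (c * (u i' * u (Suc j'))) \<le> c * (c * (u (Suc i') * u j'))"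
        using lc[OF j(2)] assms(2) by (simp only: mult_left_mono)
      ultimately show ?thesis by linarith
    qed
    then show ?thesis unfolding Suc j co by (simp add: algebra_simps)
  qed
  moreover have "0 \<le> coeff ([:1, c:] * p) k" for k
  proof (cases k)
    case 0
    show ?thesis unfolding 0 co by (rule pos)
  next
    case (Suc k')
    show ?thesis unfolding Suc co using pos assms(2) by (intro add_nonneg_nonneg mult_nonneg_nonneg)
  qed
  ultimately show ?thesis by (simp add: strongly_log_concave_def)
qed

lemma strongly_log_concave_linear_power:
  "strongly_log_concave p \<Longrightarrow> 0 \<le> c \<Longrightarrow> strongly_log_concave ([:1, c:] ^ n * p)"
proof (induction n)
  case (Suc n)
  then show ?case
    using strongly_log_concave_linear_factor[of "[:1, c:] ^ n * p" c] by (simp only: power_Suc mult.assoc)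
qed simp

text \<open>With positive coefficients, log-concavity says that the ratio of consecutive coefficients decreases, and
monotonicity of the ratio is the strong form.\<close>

lemma strongly_log_concaveI:
  assumes pos: "\<And>k. k \<le> n \<Longrightarrow> 0 < coeff p k" and zero: "\<And>k. n < k \<Longrightarrow> coeff p k = 0"
    and lc: "\<And>k. coeff p k * coeff p (Suc (Suc k)) \<le> (coeff p (Suc k))\<^sup>2"
  shows "strongly_log_concave p"
proof -
  have nn: "0 \<le> coeff p k" for k using pos[of k] zero[of k] by (cases "k \<le> n") auto
  have "coeff p i * coeff p (Suc (i + d)) \<le> coeff p (Suc i) * coeff p (i + d)" for i d
  proof (induction d)
    case (Suc d)
    let ?j = "i + d"
    show ?case
    proof (cases "Suc (Suc ?j) \<le> n")
      case True
      then have p: "0 < coeff p ?j * coeff p (Suc ?j)" by (intro mult_pos_pos pos) auto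
      have "coeff p i * coeff p (Suc (Suc ?j)) * (coeff p ?j * coeff p (Suc ?j))
          = (coeff p i * coeff p (Suc ?j)) * (coeff p ?j * coeff p (Suc (Suc ?j)))" by (simp add: mult_ac)
      also have "\<dots> \<le> (coeff p (Suc i) * coeff p ?j) * (coeff p (Suc ?j))\<^sup>2"
        by (intro mult_mono Suc.IH lc mult_nonneg_nonneg nn)
      also have "\<dots> = coeff p (Suc i) * coeff p (Suc ?j) * (coeff p ?j * coeff p (Suc ?j))"
        by (simp add: power2_eq_square mult_ac)
      finally show ?thesis using p by (simp add: mult_le_cancel_right_pos)
    next
      case False
      then show ?thesis using zero[of "Suc (Suc ?j)"] nn by simp
    qed
  qed (simp add: mult.commute)
  then show ?thesis
    using nn unfolding strongly_log_concave_def by (metis le_Suc_ex)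
qed

section \<open>Matrices with one positive eigenvalue\<close>

text \<open>Let \<open>d\<close> be the row sums of \<open>M\<close> and \<open>A = d^(-1) M\<close>, which is self-adjoint for the inner product with weights \<open>d\<close>
and fixes the constant vector. The hypothesis \<open>bochner\<close> reads \<open>\<langle>x, A x\<rangle> \<le> \<langle>A x, A x\<rangle>\<close>, so no eigenvalue
of \<open>A\<close> lies strictly between 0 and 1. Since \<open>M\<close> has nonnegative entries and contains a positive star, 1 is a
simple eigenvalue and all others are smaller (Perron-Frobenius); hence they are nonpositive on the complement
of the constants, which is equivalent to the conclusion. In place of the spectral theorem, the supremum
\<open>\<beta>\<close> of the Rayleigh quotient on this complement is used: if \<open>0 < \<beta> < 1\<close>, replacing a nearly
optimal \<open>x\<close> by \<open>x + s A x\<close> for a small \<open>s\<close> would exceed it.\<close>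

lemma one_positive_eigenvalue:
  fixes M :: "'i \<Rightarrow> 'i \<Rightarrow> real"
  assumes fin: "finite I"
    and sym: "\<And>i j. i \<in> I \<Longrightarrow> j \<in> I \<Longrightarrow> M i j = M j i"
    and nonneg: "\<And>i j. i \<in> I \<Longrightarrow> j \<in> I \<Longrightarrow> 0 \<le> M i j"
    and c: "c \<in> I" and star: "\<And>i. i \<in> I \<Longrightarrow> 0 < M c i"
    and bochner: "\<And>x. (\<Sum>i\<in>I. \<Sum>j\<in>I. M i j * x i * x j)
                     \<le> (\<Sum>i\<in>I. (\<Sum>j\<in>I. M i j * x j)\<^sup>2 / (\<Sum>j\<in>I. M i j))"
  shows "(\<Sum>i\<in>I. \<Sum>j\<in>I. M i j * x i * x j) * (\<Sum>i\<in>I. \<Sum>j\<in>I. M i j)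
           \<le> (\<Sum>i\<in>I. \<Sum>j\<in>I. M i j * x j)\<^sup>2"
proof -
  define d where "d i = (\<Sum>j\<in>I. M i j)" for i
  define q where "q x = (\<Sum>i\<in>I. \<Sum>j\<in>I. M i j * x i * x j)" for x
  define N where "N x = (\<Sum>i\<in>I. d i * (x i)\<^sup>2)" for x
  define A where "A x i = (\<Sum>j\<in>I. M i j * x j) / d i" for x i
  have dpos: "0 < d i" if "i \<in> I" for i
  proof -
    have "0 < M i c" using star[OF that] sym[OF that c] by simp
    also have "\<dots> \<le> d i" unfolding d_def
      by (rule member_le_sum) (use that c fin nonneg in auto)
    finally show ?thesis .
  qed
  have Ad: "d i * A x i = (\<Sum>j\<in>I. M i j * x j)" if "i \<in> I" for i x
    using dpos[OF that] by (simp add: A_def)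
  have Nnn: "0 \<le> N x" for x
    unfolding N_def by (intro sum_nonneg mult_nonneg_nonneg) (auto intro: less_imp_le dpos)
  have sq1: "(\<Sum>i\<in>I. \<Sum>j\<in>I. M i j * (x i)\<^sup>2) = N x" for x
    by (simp add: N_def d_def sum_distrib_right)
  have sq2: "(\<Sum>i\<in>I. \<Sum>j\<in>I. M i j * (x j)\<^sup>2) = N x" for x
  proof -
    have "(\<Sum>i\<in>I. \<Sum>j\<in>I. M i j * (x j)\<^sup>2) = (\<Sum>j\<in>I. \<Sum>i\<in>I. M i j * (x j)\<^sup>2)"
      by (rule sum.swap)
    also have "\<dots> = (\<Sum>j\<in>I. \<Sum>i\<in>I. M j i * (x j)\<^sup>2)"
      by (intro sum.cong refl) (simp add: sym)
    finally show ?thesis using sq1 by simp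
  qed
  have q_diff: "(\<Sum>i\<in>I. \<Sum>j\<in>I. M i j * (x i - x j)\<^sup>2) = 2 * N x - 2 * q x" for x
  proof -
    have "(\<Sum>i\<in>I. \<Sum>j\<in>I. M i j * (x i - x j)\<^sup>2)
        = (\<Sum>i\<in>I. \<Sum>j\<in>I. M i j * (x i)\<^sup>2 + M i j * (x j)\<^sup>2 - 2 * (M i j * x i * x j))"
      by (intro sum.cong refl) (simp add: power2_eq_square algebra_simps)
    also have "\<dots> = 2 * N x - 2 * q x"
      by (simp add: sum.distrib sum_subtractf sq1 sq2 q_def flip: sum_distrib_left)
    finally show ?thesis .
  qed
  have q_lower: "- N x \<le> q x" for x
  proof -
    have "0 \<le> (\<Sum>i\<in>I. \<Sum>j\<in>I. M i j * (x i + x j)\<^sup>2)"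
      by (intro sum_nonneg mult_nonneg_nonneg nonneg) auto
    also have "\<dots> = (\<Sum>i\<in>I. \<Sum>j\<in>I. M i j * (x i)\<^sup>2 + M i j * (x j)\<^sup>2 + 2 * (M i j * x i * x j))"
      by (intro sum.cong refl) (simp add: power2_eq_square algebra_simps)
    also have "\<dots> = 2 * N x + 2 * q x"
      by (simp add: sum.distrib sq1 sq2 q_def flip: sum_distrib_left)
    finally show ?thesis by simp
  qed
  have q_le_NA: "q x \<le> N (A x)" for x
  proof -
    have "q x \<le> (\<Sum>i\<in>I. (\<Sum>j\<in>I. M i j * x j)\<^sup>2 / d i)"
      using bochner unfolding q_def d_def .
    also have "\<dots> = N (A x)"
      unfolding N_def A_def using dpos
      by (intro sum.cong refl) (simp add: power2_eq_square)
    finally show ?thesis .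
  qed
  define m where "m = Min (M c ` I)"
  define D where "D = (\<Sum>i\<in>I. d i)"
  have mpos: "0 < m" unfolding m_def using fin c star by (subst Min_gr_iff) auto
  have m_le: "m \<le> M c i" if "i \<in> I" for i unfolding m_def using that fin by auto
  have d_le: "d i \<le> D" if "i \<in> I" for i
    unfolding D_def by (rule member_le_sum) (use that fin dpos in \<open>auto intro: less_imp_le\<close>)
  have Dpos: "0 < D" using d_le[OF c] dpos[OF c] by simp
  define \<epsilon> where "\<epsilon> = m / (2 * D)"
  have eps: "0 < \<epsilon>" using mpos Dpos by (simp add: \<epsilon>_def)
  \<comment> \<open>The spectral gap: the positive star bounds the Dirichlet form \<open>N x - q x\<close> from below.\<close>
  have gap: "q x \<le> (1 - \<epsilon>) * N x" if 0: "(\<Sum>i\<in>I. d i * x i) = 0" for x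
  proof -
    have "N x \<le> N x + D * (x c)\<^sup>2" using Dpos by simp
    also have "\<dots> = N x - 2 * x c * (\<Sum>i\<in>I. d i * x i) + (x c)\<^sup>2 * D"
      using 0 by simp
    also have "\<dots> = (\<Sum>i\<in>I. d i * (x i - x c)\<^sup>2)"
      unfolding N_def D_def sum_distrib_left sum_subtractf[symmetric] sum.distrib[symmetric]
      by (intro sum.cong refl) (simp add: power2_eq_square algebra_simps)
    finally have "\<epsilon> * N x \<le> \<epsilon> * (\<Sum>i\<in>I. d i * (x i - x c)\<^sup>2)"
      using eps by simp
    also have "\<dots> \<le> (\<Sum>i\<in>I. M c i * (x c - x i)\<^sup>2) / 2"
      unfolding sum_distrib_left sum_divide_distrib
    proof (intro sum_mono)
      fix i assume i: "i \<in> I"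
      have "\<epsilon> * d i \<le> \<epsilon> * D" using d_le[OF i] eps by simp
      also have "\<dots> = m / 2" using Dpos by (simp add: \<epsilon>_def)
      also have "\<dots> \<le> M c i / 2" using m_le[OF i] by simp
      finally have "\<epsilon> * d i * (x i - x c)\<^sup>2 \<le> M c i / 2 * (x i - x c)\<^sup>2"
        by (rule mult_right_mono) simp
      then show "\<epsilon> * (d i * (x i - x c)\<^sup>2) \<le> M c i * (x c - x i)\<^sup>2 / 2"
        by (simp add: power2_commute mult.assoc)
    qed
    also have "\<dots> \<le> (\<Sum>i\<in>I. \<Sum>j\<in>I. M i j * (x i - x j)\<^sup>2) / 2"
      using member_le_sum[OF c, where f = "\<lambda>i. \<Sum>j\<in>I. M i j * (x i - x j)\<^sup>2"] fin nonneg
      by (simp add: sum_nonneg)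
    also have "\<dots> = N x - q x" by (simp add: q_diff)
    finally show ?thesis by (simp add: algebra_simps)
  qed
  have A_orth: "(\<Sum>i\<in>I. d i * A x i) = (\<Sum>i\<in>I. d i * x i)" for x
  proof -
    have "(\<Sum>i\<in>I. d i * A x i) = (\<Sum>i\<in>I. \<Sum>j\<in>I. M i j * x j)"
      by (intro sum.cong refl Ad)
    also have "\<dots> = (\<Sum>j\<in>I. \<Sum>i\<in>I. M i j * x j)" by (rule sum.swap)
    also have "\<dots> = (\<Sum>j\<in>I. \<Sum>i\<in>I. M j i * x j)"
      by (intro sum.cong refl) (simp add: sym)
    finally show ?thesis by (simp add: d_def sum_distrib_right)
  qed
  have NA: "(\<Sum>i\<in>I. \<Sum>j\<in>I. M i j * A x i * x j) = N (A x)" for x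
  proof -
    have "(\<Sum>i\<in>I. \<Sum>j\<in>I. M i j * A x i * x j) = (\<Sum>i\<in>I. A x i * (\<Sum>j\<in>I. M i j * x j))"
      by (simp add: sum_distrib_left mult_ac)
    also have "\<dots> = (\<Sum>i\<in>I. A x i * (d i * A x i))"
      by (intro sum.cong refl) (simp add: Ad)
    finally show ?thesis by (simp add: N_def power2_eq_square mult_ac)
  qed
  have NA': "(\<Sum>i\<in>I. \<Sum>j\<in>I. M i j * x i * A x j) = N (A x)" for x
  proof -
    have "(\<Sum>i\<in>I. \<Sum>j\<in>I. M i j * x i * A x j) = (\<Sum>j\<in>I. \<Sum>i\<in>I. M i j * x i * A x j)"
      by (rule sum.swap)
    also have "\<dots> = (\<Sum>j\<in>I. \<Sum>i\<in>I. M j i * A x j * x i)"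
      by (intro sum.cong refl) (simp add: sym mult_ac)
    finally show ?thesis by (simp add: NA)
  qed
  have q_step: "q (\<lambda>i. x i + s * A x i) = q x + 2 * s * N (A x) + s\<^sup>2 * q (A x)" for x s
  proof -
    have "q (\<lambda>i. x i + s * A x i) = (\<Sum>i\<in>I. \<Sum>j\<in>I. M i j * x i * x j
       + (s * (M i j * A x i * x j) + s * (M i j * x i * A x j)) + s\<^sup>2 * (M i j * A x i * A x j))"
      unfolding q_def by (intro sum.cong refl) (simp add: power2_eq_square algebra_simps)
    also have "\<dots> = q x + (s * N (A x) + s * N (A x)) + s\<^sup>2 * q (A x)"
      by (simp add: sum.distrib NA NA' flip: q_def sum_distrib_left)
    finally show ?thesis by simp
  qed
  have N_step: "N (\<lambda>i. x i + s * A x i) = N x + 2 * s * q x + s\<^sup>2 * N (A x)" for x s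
  proof -
    have "N (\<lambda>i. x i + s * A x i)
        = (\<Sum>i\<in>I. d i * (x i)\<^sup>2 + 2 * s * (x i * (d i * A x i)) + s\<^sup>2 * (d i * (A x i)\<^sup>2))"
      unfolding N_def by (intro sum.cong refl) (simp add: power2_eq_square algebra_simps)
    also have "\<dots> = N x + 2 * s * (\<Sum>i\<in>I. x i * (d i * A x i)) + s\<^sup>2 * N (A x)"
      by (simp add: sum.distrib N_def flip: sum_distrib_left)
    also have "(\<Sum>i\<in>I. x i * (d i * A x i)) = q x"
      unfolding q_def by (intro sum.cong refl) (simp add: Ad sum_distrib_left mult_ac)
    finally show ?thesis .
  qed
  have neg: "q x \<le> 0" if 0: "(\<Sum>i\<in>I. d i * x i) = 0" for x
  proof (rule ccontr)
    assume "\<not> q x \<le> 0"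
    then have qx: "0 < q x" by simp
    define Y where "Y = {x. (\<Sum>i\<in>I. d i * x i) = 0 \<and> 0 < N x}"
    define \<beta> where "\<beta> = (SUP x\<in>Y. q x / N x)"
    have bdd: "bdd_above ((\<lambda>x. q x / N x) ` Y)"
      by (rule bdd_aboveI[of _ "1 - \<epsilon>"]) (use gap in \<open>auto simp: Y_def divide_le_eq\<close>)
    have "0 < (1 - \<epsilon>) * N x" using gap[OF 0] qx by simp
    then have Nx: "0 < N x" using Nnn[of x] by (cases "N x = 0") auto
    then have xY: "x \<in> Y" using 0 by (simp add: Y_def)
    have "q x / N x \<le> \<beta>" unfolding \<beta>_def by (rule cSUP_upper[OF xY bdd])
    then have bpos: "0 < \<beta>" using qx Nx by (smt (verit) divide_pos_pos)
    have ble: "\<beta> \<le> 1 - \<epsilon>" unfolding \<beta>_def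
      by (rule cSUP_least) (use xY gap in \<open>auto simp: Y_def divide_le_eq\<close>)
    have qb: "q z \<le> \<beta> * N z" if z: "(\<Sum>i\<in>I. d i * z i) = 0" for z
    proof (cases "N z = 0")
      case True
      then show ?thesis using gap[OF z] by simp
    next
      case False
      then have "0 < N z" using Nnn[of z] by simp
      moreover from this z have "q z / N z \<le> \<beta>"
        unfolding \<beta>_def by (intro cSUP_upper bdd) (simp add: Y_def)
      ultimately show ?thesis by (simp add: divide_le_eq)
    qed
    \<comment> \<open>To first order in \<open>s\<close>, passing from \<open>y\<close> to \<open>y + s A y\<close> raises \<open>q - \<beta> N\<close> by \<open>2 s \<beta> (1 - \<beta>) N y\<close> or more, up to terms in \<open>\<eta>\<close>;
      taking \<open>s = \<epsilon>/2\<close> makes this exceed the terms of order \<open>s\<^sup>2\<close> and, for small \<open>\<eta>\<close>, the loss \<open>\<eta> N y\<close>.\<close>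
    define s where "s = \<epsilon> / 2"
    define \<eta> where "\<eta> = min (\<beta>/2) (s * \<beta> * \<epsilon> / 4)"
    have eta: "0 < \<eta>" "\<eta> \<le> \<beta> / 2" "\<eta> \<le> s * \<beta> * \<epsilon> / 4"
      using bpos eps by (auto simp: \<eta>_def s_def)
    obtain y where y: "y \<in> Y" "\<beta> - \<eta> < q y / N y"
      using less_cSUP_iff[THEN iffD1, OF _ bdd, of "\<beta> - \<eta>"] xY eta unfolding \<beta>_def by force
    have Ny: "0 < N y" and y0: "(\<Sum>i\<in>I. d i * y i) = 0" using y by (auto simp: Y_def)
    have qy: "(\<beta> - \<eta>) * N y < q y" using y Ny by (simp add: less_divide_eq)
    have z0: "(\<Sum>i\<in>I. d i * (y i + s * A y i)) = 0"
    proof -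
      have "(\<Sum>i\<in>I. d i * (y i + s * A y i)) = (\<Sum>i\<in>I. d i * y i) + s * (\<Sum>i\<in>I. d i * A y i)"
        by (simp add: sum.distrib sum_distrib_left algebra_simps)
      then show ?thesis using y0 by (simp add: A_orth)
    qed
    have s: "0 < s" "s \<le> 1/2" using eps bpos ble by (auto simp: s_def)
    have "q y + 2 * s * N (A y) + s\<^sup>2 * q (A y) \<le> \<beta> * (N y + 2 * s * q y + s\<^sup>2 * N (A y))"
      using qb[OF z0] by (simp add: q_step N_step)
    moreover have "s\<^sup>2 * (- N (A y)) \<le> s\<^sup>2 * q (A y)"
      by (intro mult_left_mono q_lower) simp
    ultimately have 1: "N (A y) * (2 * s - s\<^sup>2 * (1 + \<beta>)) \<le> \<beta> * N y - q y + 2 * s * \<beta> * q y"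
      by (simp add: algebra_simps)
    have "\<beta> * N y - q y \<le> \<eta> * N y" using qy by (simp add: algebra_simps)
    moreover have "2 * s * \<beta> * q y \<le> 2 * s * \<beta> * (\<beta> * N y)"
      using qb[OF y0] s bpos by (intro mult_left_mono) auto
    ultimately have 2: "N (A y) * (2 * s - s\<^sup>2 * (1 + \<beta>)) \<le> (\<eta> + 2 * s * \<beta>\<^sup>2) * N y"
      using 1 by (simp add: algebra_simps power2_eq_square)
    have "s * (1 + \<beta>) \<le> 1/2 * 2" using s ble eps bpos by (intro mult_mono) auto
    then have c1: "0 \<le> 2 * s - s\<^sup>2 * (1 + \<beta>)"
      using s mult_left_mono[of "s * (1 + \<beta>)" 1 s] by (simp add: power2_eq_square algebra_simps)
    have "(\<beta> - \<eta>) * N y \<le> N (A y)" using qy q_le_NA[of y] by simp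
    from mult_right_mono[OF this c1] 2
    have "((\<beta> - \<eta>) * (2 * s - s\<^sup>2 * (1 + \<beta>))) * N y \<le> (\<eta> + 2 * s * \<beta>\<^sup>2) * N y"
      by (simp add: mult_ac)
    then have 3: "(\<beta> - \<eta>) * (2 * s - s\<^sup>2 * (1 + \<beta>)) \<le> \<eta> + 2 * s * \<beta>\<^sup>2"
      using Ny by simp
    have "\<beta> * (2 * s - s\<^sup>2 * (1 + \<beta>)) - 2 * s * \<beta>\<^sup>2 = s * \<beta> * (2 * (1 - \<beta>) - s * (1 + \<beta>))"
      by (simp add: power2_eq_square algebra_simps)
    also have "\<dots> \<ge> s * \<beta> * (2 * \<epsilon> - s * 2)"
    proof (intro mult_left_mono diff_mono)
      show "1 + \<beta> \<le> 2" using ble eps by simp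
    qed (use s ble bpos in auto)
    also have "s * \<beta> * (2 * \<epsilon> - s * 2) = s * \<beta> * \<epsilon>" by (simp add: s_def)
    finally have 4: "s * \<beta> * \<epsilon> \<le> \<beta> * (2 * s - s\<^sup>2 * (1 + \<beta>)) - 2 * s * \<beta>\<^sup>2" .
    have "\<eta> * (2 * s - s\<^sup>2 * (1 + \<beta>)) \<le> \<eta> * 1"
      using eta s bpos by (intro mult_left_mono) (auto intro: order_trans[of _ "2 * s"])
    then have "s * \<beta> * \<epsilon> \<le> 2 * \<eta>" using 3 4 by (simp add: algebra_simps)
    moreover have "2 * \<eta> \<le> s * \<beta> * \<epsilon> / 2" using eta by simp
    moreover have "0 < s * \<beta> * \<epsilon>" using s bpos eps by simp
    ultimately show False by simp
  qed
  have "0 < D" by (rule Dpos)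
  \<comment> \<open>Subtracting the constant \<open>k\<close> moves \<open>x\<close> into the complement of the constants.\<close>
  define L where "L = (\<Sum>i\<in>I. d i * x i)"
  define k where "k = L / D"
  have "(\<Sum>i\<in>I. d i * (x i - k)) = L - D * k"
    by (simp add: L_def D_def sum_subtractf sum_distrib_right right_diff_distrib)
  then have "q (\<lambda>i. x i - k) \<le> 0" using Dpos by (intro neg) (simp add: k_def)
  also have "q (\<lambda>i. x i - k) = q x - 2 * k * L + k\<^sup>2 * D"
  proof -
    have "q (\<lambda>i. x i - k)
        = (\<Sum>i\<in>I. \<Sum>j\<in>I. M i j * x i * x j - (k * (M i j * x i) + k * (M i j * x j)) + k\<^sup>2 * M i j)"
      unfolding q_def by (intro sum.cong refl) (simp add: power2_eq_square algebra_simps)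
    also have "\<dots> = q x - (k * (\<Sum>i\<in>I. \<Sum>j\<in>I. M i j * x i) + k * (\<Sum>i\<in>I. \<Sum>j\<in>I. M i j * x j)) + k\<^sup>2 * D"
      by (simp add: sum.distrib sum_subtractf q_def D_def d_def flip: sum_distrib_left)
    also have "(\<Sum>i\<in>I. \<Sum>j\<in>I. M i j * x i) = L"
      by (simp add: L_def d_def sum_distrib_right)
    also have "(\<Sum>i\<in>I. \<Sum>j\<in>I. M i j * x j) = L"
      using A_orth[of x] by (simp add: Ad L_def)
    finally show ?thesis by simp
  qed
  finally have "(q x - 2 * k * L + k\<^sup>2 * D) * D \<le> 0"
    using Dpos by (simp add: mult_le_0_iff)
  moreover have "(q x - 2 * k * L + k\<^sup>2 * D) * D = q x * D - L\<^sup>2"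
    using Dpos by (simp add: k_def field_simps power2_eq_square)
  ultimately have "q x * D \<le> L\<^sup>2" by simp
  moreover have "(\<Sum>i\<in>I. \<Sum>j\<in>I. M i j * x j) = L"
    using A_orth[of x] by (simp add: Ad L_def)
  ultimately show ?thesis by (simp add: q_def D_def d_def)
qed

section \<open>Ultra-log-concavity from a local condition\<close>

text \<open>The weight of a set of size \<open>k\<close> in the homogenisation of degree \<open>n\<close>. The factorial is what makes
differentiation with respect to the homogenising variable \<open>\<tau>\<close> lower \<open>n\<close> by one without any factor.\<close>

definition exp_weight :: "real \<Rightarrow> nat \<Rightarrow> nat \<Rightarrow> real" where
  "exp_weight \<tau> n k = (if k \<le> n then \<tau> ^ (n - k) / fact (n - k) else 0)"

text \<open>The polynomial \<open>\<Sum>\<^sub>\<gamma> \<tau>\<^bsup>n - |\<gamma>|\<^esup> / (n - |\<gamma>|)! F(\<alpha> \<union> \<gamma>) x\<^bsup>\<gamma>\<^esup>\<close>, homogeneous of degree \<open>n\<close> in \<open>\<tau>\<close> and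
\<open>(x\<^sub>h)\<close>, evaluated at the point where all \<open>x\<^sub>h\<close> are 1. The derivative with respect to \<open>x\<^sub>h\<close> replaces
\<open>(n, \<alpha>)\<close> by \<open>(n - 1, \<alpha> \<union> {h})\<close>, the derivative with respect to \<open>\<tau>\<close> replaces it by \<open>(n - 1, \<alpha>)\<close>.\<close>

definition exp_homog ::
    "'h set \<Rightarrow> ('h set \<Rightarrow> real) \<Rightarrow> real \<Rightarrow> nat \<Rightarrow> 'h set \<Rightarrow> real" where
  "exp_homog H F \<tau> n \<alpha> = (\<Sum>\<gamma>\<in>Pow (H - \<alpha>). exp_weight \<tau> n (card \<gamma>) * F (\<alpha> \<union> \<gamma>))"

text \<open>The Hessian of the homogenisation of degree \<open>n + 2\<close>, with rows and columns scaled by the coordinates of the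
point of evaluation, so that this point becomes the constant vector 1. The index \<open>None\<close> stands for \<open>\<tau>\<close>.
The diagonal entry of an element of \<open>H\<close> vanishes because no variable occurs twice in a monomial.\<close>

fun exp_hessian ::
    "'h set \<Rightarrow> ('h set \<Rightarrow> real) \<Rightarrow> real \<Rightarrow> nat \<Rightarrow> 'h set \<Rightarrow> 'h option \<Rightarrow> 'h option \<Rightarrow> real" where
  "exp_hessian H F \<tau> n \<alpha> None None = \<tau>\<^sup>2 * exp_homog H F \<tau> n \<alpha>"
| "exp_hessian H F \<tau> n \<alpha> None (Some k) = (if k \<in> \<alpha> then 0 else \<tau> * exp_homog H F \<tau> n (insert k \<alpha>))"
| "exp_hessian H F \<tau> n \<alpha> (Some h) None = (if h \<in> \<alpha> then 0 else \<tau> * exp_homog H F \<tau> n (insert h \<alpha>))"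
| "exp_hessian H F \<tau> n \<alpha> (Some h) (Some k) =
     (if h \<in> \<alpha> \<or> k \<in> \<alpha> \<or> h = k then 0 else exp_homog H F \<tau> n (insert h (insert k \<alpha>)))"

definition directions :: "'h set \<Rightarrow> 'h set \<Rightarrow> 'h option set" where
  "directions H \<alpha> = insert None (Some ` (H - \<alpha>))"

text \<open>The reversed Cauchy-Schwarz inequality against the constant vector. For a symmetric matrix with a positive
sum of entries it says that there is exactly one positive eigenvalue.\<close>

definition lorentzian_form :: "'i set \<Rightarrow> ('i \<Rightarrow> 'i \<Rightarrow> real) \<Rightarrow> bool" where
  "lorentzian_form I M \<longleftrightarrow> (\<forall>x.
     (\<Sum>i\<in>I. \<Sum>j\<in>I. M i j * x i * x j) * (\<Sum>i\<in>I. \<Sum>j\<in>I. M i j) \<le> (\<Sum>i\<in>I. \<Sum>j\<in>I. M i j * x j)\<^sup>2)"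

lemma sum_over_marked_subsets:
  fixes f :: "'h set \<Rightarrow> real"
  assumes "finite A"
  shows "(\<Sum>h\<in>A. \<Sum>\<gamma>\<in>Pow (A - {h}). f (insert h \<gamma>)) = (\<Sum>\<gamma>\<in>Pow A. real (card \<gamma>) * f \<gamma>)"
proof -
  have "(\<Sum>h\<in>A. \<Sum>\<gamma>\<in>Pow (A - {h}). f (insert h \<gamma>))
      = (\<Sum>(h, \<gamma>)\<in>(SIGMA h:A. Pow (A - {h})). f (insert h \<gamma>))"
    using assms by (subst sum.Sigma) auto
  also have "\<dots> = (\<Sum>(\<gamma>, h)\<in>(SIGMA \<gamma>:Pow A. \<gamma>). f \<gamma>)"
    by (rule sum.reindex_bij_witness[of _ "\<lambda>(\<gamma>, h). (h, \<gamma> - {h})" "\<lambda>(h, \<gamma>). (insert h \<gamma>, h)"])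
       (auto simp: insert_absorb)
  also have "\<dots> = (\<Sum>\<gamma>\<in>Pow A. \<Sum>h\<in>\<gamma>. f \<gamma>)"
    using assms by (subst sum.Sigma) (auto intro: finite_subset)
  finally show ?thesis by simp
qed

lemma exp_weight_Suc:
  "real (Suc n) * exp_weight \<tau> (Suc n) k = \<tau> * exp_weight \<tau> n k + real k * exp_weight \<tau> (Suc n) k"
proof (cases "k \<le> n")
  case True
  then have "real (Suc (n - k)) * (\<tau> ^ Suc (n - k) / fact (Suc (n - k))) = \<tau> * (\<tau> ^ (n - k) / fact (n - k))"
    by (simp add: fact_Suc nonzero_divide_eq_eq del: of_nat_Suc)
  moreover have "real (Suc n) = real (Suc (n - k)) + real k" using True by simp
  ultimately have "real (Suc n) * (\<tau> ^ Suc (n - k) / fact (Suc (n - k)))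
      = \<tau> * (\<tau> ^ (n - k) / fact (n - k)) + real k * (\<tau> ^ Suc (n - k) / fact (Suc (n - k)))"
    by (simp only: distrib_right)
  then show ?thesis using True
    by (simp add: exp_weight_def Suc_diff_le del: of_nat_Suc fact_Suc power_Suc)
qed (auto simp: exp_weight_def)

text \<open>Euler's identity for a homogeneous polynomial.\<close>

lemma exp_homog_Suc:
  assumes "finite H"
  shows "real (Suc n) * exp_homog H F \<tau> (Suc n) \<alpha>
       = \<tau> * exp_homog H F \<tau> n \<alpha> + (\<Sum>h\<in>H - \<alpha>. exp_homog H F \<tau> n (insert h \<alpha>))"
proof -
  let ?w = "exp_weight \<tau>"
  have "real (Suc n) * exp_homog H F \<tau> (Suc n) \<alpha>
      = (\<Sum>\<gamma>\<in>Pow (H - \<alpha>). (real (Suc n) * ?w (Suc n) (card \<gamma>)) * F (\<alpha> \<union> \<gamma>))"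
    by (simp add: exp_homog_def sum_distrib_left mult_ac)
  also have "\<dots> = \<tau> * exp_homog H F \<tau> n \<alpha>
       + (\<Sum>\<gamma>\<in>Pow (H - \<alpha>). real (card \<gamma>) * (?w (Suc n) (card \<gamma>) * F (\<alpha> \<union> \<gamma>)))"
    by (simp only: exp_weight_Suc exp_homog_def sum_distrib_left distrib_right sum.distrib mult.assoc)
  also have "(\<Sum>\<gamma>\<in>Pow (H - \<alpha>). real (card \<gamma>) * (?w (Suc n) (card \<gamma>) * F (\<alpha> \<union> \<gamma>)))
      = (\<Sum>h\<in>H - \<alpha>. \<Sum>\<gamma>\<in>Pow (H - \<alpha> - {h}). ?w (Suc n) (card (insert h \<gamma>)) * F (\<alpha> \<union> insert h \<gamma>))"
    using assms by (subst sum_over_marked_subsets) auto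
  also have "\<dots> = (\<Sum>h\<in>H - \<alpha>. exp_homog H F \<tau> n (insert h \<alpha>))"
    unfolding exp_homog_def
  proof (intro sum.cong refl)
    fix h \<gamma> assume "h \<in> H - \<alpha>" "\<gamma> \<in> Pow (H - insert h \<alpha>)"
    moreover from this have "finite \<gamma>" "h \<notin> \<gamma>"
      using assms by (auto intro: finite_subset)
    ultimately show "?w (Suc n) (card (insert h \<gamma>)) * F (\<alpha> \<union> insert h \<gamma>)
        = ?w n (card \<gamma>) * F (insert h \<alpha> \<union> \<gamma>)"
      by (simp add: exp_weight_def)
  qed auto
  finally show ?thesis .
qed

lemma exp_homog_0: "exp_homog H F \<tau> 0 \<alpha> = F \<alpha>" if "finite H"
proof -
  have "exp_homog H F \<tau> 0 \<alpha> = (\<Sum>\<gamma>\<in>Pow (H - \<alpha>). if \<gamma> = {} then F \<alpha> else 0)"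
    unfolding exp_homog_def exp_weight_def using that
    by (intro sum.cong refl) (auto dest!: finite_subset)
  then show ?thesis using that by simp
qed

context
  fixes H :: "'h set" and F :: "'h set \<Rightarrow> real" and \<tau> :: real
  assumes fin: "finite H" and F_pos: "\<And>\<alpha>. \<alpha> \<subseteq> H \<Longrightarrow> 0 < F \<alpha>" and \<tau>: "0 < \<tau>"
begin

lemma exp_homog_pos: "\<alpha> \<subseteq> H \<Longrightarrow> 0 < exp_homog H F \<tau> n \<alpha>"
  unfolding exp_homog_def
proof (rule sum_pos2[of _ "{}"])
  fix \<gamma> assume "\<alpha> \<subseteq> H" "\<gamma> \<in> Pow (H - \<alpha>)"
  then have "0 < F (\<alpha> \<union> \<gamma>)" by (intro F_pos) auto
  then show "0 \<le> exp_weight \<tau> n (card \<gamma>) * F (\<alpha> \<union> \<gamma>)"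
    using \<tau> by (simp add: exp_weight_def)
qed (use fin \<tau> in \<open>auto simp: exp_weight_def F_pos\<close>)

abbreviation (input) "homog \<equiv> exp_homog H F \<tau>"
abbreviation (input) "hess \<equiv> exp_hessian H F \<tau>"

lemma sum_directions:
  "(\<Sum>i\<in>directions H \<alpha>. f i) = f None + (\<Sum>h\<in>H - \<alpha>. f (Some h))" for f :: "'h option \<Rightarrow> real"
  unfolding directions_def using fin
  by (subst sum.insert) (auto simp: sum.reindex)

lemma finite_directions: "finite (directions H \<alpha>)"
  using fin by (simp add: directions_def)

text \<open>The gradient, scaled like the Hessian.\<close>

definition hess_row :: "nat \<Rightarrow> 'h set \<Rightarrow> 'h option \<Rightarrow> real" where
  "hess_row n \<alpha> i = (case i of None \<Rightarrow> \<tau> * homog n \<alpha> | Some h \<Rightarrow> if h \<in> \<alpha> then 0 else homog n (insert h \<alpha>))"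

text \<open>Euler's identity for the partial derivatives.\<close>

lemma hess_row_sum:
  assumes "i \<in> directions H \<alpha>"
  shows "(\<Sum>j\<in>directions H \<alpha>. hess n \<alpha> i j) = real (Suc n) * hess_row (Suc n) \<alpha> i"
proof (cases i)
  case None
  have "(\<Sum>j\<in>directions H \<alpha>. hess n \<alpha> i j) = \<tau> * (\<tau> * homog n \<alpha> + (\<Sum>h\<in>H - \<alpha>. homog n (insert h \<alpha>)))"
    by (simp add: None sum_directions power2_eq_square distrib_left sum_distrib_left mult.assoc)
  then show ?thesis
    unfolding exp_homog_Suc[OF fin, symmetric] by (simp add: None hess_row_def)
next
  case (Some h)
  with assms have h: "h \<in> H" "h \<notin> \<alpha>" by (auto simp: directions_def)
  have "(\<Sum>k\<in>H - \<alpha>. hess n \<alpha> (Some h) (Some k)) = (\<Sum>k\<in>H - insert h \<alpha>. homog n (insert k (insert h \<alpha>)))"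
    using h fin by (intro sum.mono_neutral_cong_right) (auto simp: insert_commute)
  then have "(\<Sum>j\<in>directions H \<alpha>. hess n \<alpha> i j)
      = \<tau> * homog n (insert h \<alpha>) + (\<Sum>k\<in>H - insert h \<alpha>. homog n (insert k (insert h \<alpha>)))"
    using h by (simp add: Some sum_directions)
  then show ?thesis
    unfolding exp_homog_Suc[OF fin, symmetric] using h by (simp add: Some hess_row_def)
qed

text \<open>The Hessians of the partial derivatives, scaled in the direction of the derivative as well. By Euler's
identity they add up to a multiple of the Hessian (\<open>slices_sum\<close>), while the row sums of the slice
\<open>g\<close> form the row \<open>g\<close> of the Hessian (\<open>slice_row_sum\<close>).\<close>

definition hess_slice :: "nat \<Rightarrow> 'h set \<Rightarrow> 'h option \<Rightarrow> 'h option \<Rightarrow> 'h option \<Rightarrow> real" where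
  "hess_slice n \<alpha> g i j = (case g of None \<Rightarrow> \<tau> * hess n \<alpha> i j | Some h \<Rightarrow> hess n (insert h \<alpha>) i j)"

lemma slices_sum:
  assumes "i \<in> directions H \<alpha>" "j \<in> directions H \<alpha>"
  shows "(\<Sum>g\<in>directions H \<alpha>. hess_slice n \<alpha> g i j) = real (Suc n) * hess (Suc n) \<alpha> i j"
proof -
  have *: "(\<Sum>g\<in>directions H \<alpha>. hess_slice n \<alpha> g i j)
      = \<tau> * hess n \<alpha> i j + (\<Sum>g\<in>H - \<alpha>. hess n (insert g \<alpha>) i j)"
    by (simp add: sum_directions hess_slice_def)
  show ?thesis
  proof (cases i; cases j)
    assume ij: "i = None" "j = None"
    have "\<tau> * hess n \<alpha> i j + (\<Sum>g\<in>H - \<alpha>. hess n (insert g \<alpha>) i j)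
        = \<tau>\<^sup>2 * (\<tau> * homog n \<alpha> + (\<Sum>g\<in>H - \<alpha>. homog n (insert g \<alpha>)))"
      by (simp add: ij distrib_left sum_distrib_left mult_ac)
    then show ?thesis unfolding * exp_homog_Suc[OF fin, symmetric] by (simp add: ij)
  next
    fix k assume ij: "i = None" "j = Some k"
    with assms have k: "k \<in> H" "k \<notin> \<alpha>" by (auto simp: directions_def)
    have "(\<Sum>g\<in>H - \<alpha>. hess n (insert g \<alpha>) i j) = (\<Sum>g\<in>H - insert k \<alpha>. \<tau> * homog n (insert g (insert k \<alpha>)))"
      using k fin by (intro sum.mono_neutral_cong_right) (auto simp: insert_commute ij)
    then have "\<tau> * hess n \<alpha> i j + (\<Sum>g\<in>H - \<alpha>. hess n (insert g \<alpha>) i j)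
       = \<tau> * (\<tau> * homog n (insert k \<alpha>) + (\<Sum>g\<in>H - insert k \<alpha>. homog n (insert g (insert k \<alpha>))))"
      using k by (simp add: ij distrib_left sum_distrib_left)
    then show ?thesis unfolding * exp_homog_Suc[OF fin, symmetric] using k by (simp add: ij)
  next
    fix k assume ij: "i = Some k" "j = None"
    with assms have k: "k \<in> H" "k \<notin> \<alpha>" by (auto simp: directions_def)
    have "(\<Sum>g\<in>H - \<alpha>. hess n (insert g \<alpha>) i j) = (\<Sum>g\<in>H - insert k \<alpha>. \<tau> * homog n (insert g (insert k \<alpha>)))"
      using k fin by (intro sum.mono_neutral_cong_right) (auto simp: insert_commute ij)
    then have "\<tau> * hess n \<alpha> i j + (\<Sum>g\<in>H - \<alpha>. hess n (insert g \<alpha>) i j)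
       = \<tau> * (\<tau> * homog n (insert k \<alpha>) + (\<Sum>g\<in>H - insert k \<alpha>. homog n (insert g (insert k \<alpha>))))"
      using k by (simp add: ij distrib_left sum_distrib_left)
    then show ?thesis unfolding * exp_homog_Suc[OF fin, symmetric] using k by (simp add: ij)
  next
    fix h k assume ij: "i = Some h" "j = Some k"
    with assms have hk: "h \<in> H" "h \<notin> \<alpha>" "k \<in> H" "k \<notin> \<alpha>" by (auto simp: directions_def)
    show ?thesis
    proof (cases "h = k")
      case True
      then show ?thesis unfolding * by (simp add: ij)
    next
      case False
      let ?\<beta> = "insert h (insert k \<alpha>)"
      have "(\<Sum>g\<in>H - \<alpha>. hess n (insert g \<alpha>) i j) = (\<Sum>g\<in>H - ?\<beta>. homog n (insert g ?\<beta>))"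
        using hk fin False by (intro sum.mono_neutral_cong_right) (auto simp: insert_commute ij)
      then have "\<tau> * hess n \<alpha> i j + (\<Sum>g\<in>H - \<alpha>. hess n (insert g \<alpha>) i j)
         = \<tau> * homog n ?\<beta> + (\<Sum>g\<in>H - ?\<beta>. homog n (insert g ?\<beta>))"
        using hk False by (simp add: ij)
      then show ?thesis unfolding * exp_homog_Suc[OF fin, symmetric] using hk False by (simp add: ij)
    qed
  qed
qed

lemma slice_row_sum:
  assumes "g \<in> directions H \<alpha>" "i \<in> directions H \<alpha>"
  shows "(\<Sum>j\<in>directions H \<alpha>. hess_slice n \<alpha> g i j) = real (Suc n) * hess (Suc n) \<alpha> g i"
proof (cases g)
  case None
  then show ?thesis using hess_row_sum[OF assms(2), of n] assms(2)
    by (cases i) (auto simp: hess_slice_def hess_row_def power2_eq_square mult_ac directions_def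
                       simp flip: sum_distrib_left)
next
  case (Some h)
  with assms have h: "h \<in> H" "h \<notin> \<alpha>" by (auto simp: directions_def)
  have "hess n (insert h \<alpha>) i (Some h) = 0" by (cases i) auto
  then have "(\<Sum>j\<in>directions H \<alpha>. hess_slice n \<alpha> g i j)
      = (\<Sum>j\<in>directions H (insert h \<alpha>). hess n (insert h \<alpha>) i j)"
    unfolding hess_slice_def Some option.case
    by (intro sum.mono_neutral_right finite_directions) (auto simp: directions_def)
  also have "\<dots> = real (Suc n) * hess (Suc n) \<alpha> g i"
  proof (cases "i = Some h")
    case True
    have "hess n (insert h \<alpha>) i j = 0" for j by (cases j) (auto simp: True)
    then show ?thesis by (simp add: True Some)
  next
    case False
    then have "i \<in> directions H (insert h \<alpha>)"
      using assms by (auto simp: directions_def)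
    from hess_row_sum[OF this, of n] False assms(2) h show ?thesis
      by (cases i) (auto simp: Some hess_row_def insert_commute directions_def)
  qed
  finally show ?thesis .
qed

lemma hess_sym: "hess n \<alpha> i j = hess n \<alpha> j i"
  by (cases i; cases j) (auto simp: insert_commute)

lemma hess_nonneg: "\<alpha> \<subseteq> H \<Longrightarrow> i \<in> directions H \<alpha> \<Longrightarrow> j \<in> directions H \<alpha> \<Longrightarrow> 0 \<le> hess n \<alpha> i j"
  using \<tau> exp_homog_pos[THEN less_imp_le]
  by (cases i; cases j) (auto simp: directions_def)

lemma hess_star: "\<alpha> \<subseteq> H \<Longrightarrow> i \<in> directions H \<alpha> \<Longrightarrow> 0 < hess n \<alpha> None i"
  using \<tau> exp_homog_pos by (cases i) (auto simp: directions_def)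

lemma lorentzian_slice:
  assumes "g \<in> directions H \<alpha>" "lorentzian_form (directions H \<alpha>) (hess n \<alpha>)"
    and "\<And>h. h \<in> H - \<alpha> \<Longrightarrow> lorentzian_form (directions H (insert h \<alpha>)) (hess n (insert h \<alpha>))"
  shows "lorentzian_form (directions H \<alpha>) (hess_slice n \<alpha> g)"
proof (cases g)
  case None
  show ?thesis
    unfolding lorentzian_form_def hess_slice_def None option.case mult.assoc
    unfolding sum_distrib_left[symmetric] power_mult_distrib
  proof (intro allI)
    fix x
    let ?J = "directions H \<alpha>"
    have "(\<Sum>i\<in>?J. \<Sum>j\<in>?J. hess n \<alpha> i j * (x i * x j)) * (\<Sum>i\<in>?J. \<Sum>j\<in>?J. hess n \<alpha> i j)
        \<le> (\<Sum>i\<in>?J. \<Sum>j\<in>?J. hess n \<alpha> i j * x j)\<^sup>2"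
      using assms(2) by (simp add: lorentzian_form_def mult.assoc)
    then have "\<tau>\<^sup>2 * ((\<Sum>i\<in>?J. \<Sum>j\<in>?J. hess n \<alpha> i j * (x i * x j)) * (\<Sum>i\<in>?J. \<Sum>j\<in>?J. hess n \<alpha> i j))
        \<le> \<tau>\<^sup>2 * (\<Sum>i\<in>?J. \<Sum>j\<in>?J. hess n \<alpha> i j * x j)\<^sup>2"
      by (intro mult_left_mono) auto
    then show "\<tau> * (\<Sum>i\<in>?J. \<Sum>j\<in>?J. hess n \<alpha> i j * (x i * x j)) * (\<tau> * (\<Sum>i\<in>?J. \<Sum>j\<in>?J. hess n \<alpha> i j))
        \<le> \<tau>\<^sup>2 * (\<Sum>i\<in>?J. \<Sum>j\<in>?J. hess n \<alpha> i j * x j)\<^sup>2"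
      by (simp add: power2_eq_square mult_ac)
  qed
next
  case (Some h)
  with assms have h: "h \<in> H - \<alpha>" by (auto simp: directions_def)
  let ?J = "directions H \<alpha>" and ?K = "directions H (insert h \<alpha>)"
  have 0: "hess n (insert h \<alpha>) (Some h) j = 0" "hess n (insert h \<alpha>) i (Some h) = 0" for i j
    by (cases j; simp) (cases i; simp)
  have JK: "?K \<subseteq> ?J" "?J - ?K \<subseteq> {Some h}" by (auto simp: directions_def)
  have red: "(\<Sum>i\<in>?J. \<Sum>j\<in>?J. hess n (insert h \<alpha>) i j * y i j) = (\<Sum>i\<in>?K. \<Sum>j\<in>?K. hess n (insert h \<alpha>) i j * y i j)"
    for y
  proof -
    have "(\<Sum>i\<in>?J. \<Sum>j\<in>?J. hess n (insert h \<alpha>) i j * y i j) = (\<Sum>i\<in>?K. \<Sum>j\<in>?J. hess n (insert h \<alpha>) i j * y i j)"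
      using JK by (intro sum.mono_neutral_right finite_directions) (auto simp: 0)
    also have "\<dots> = (\<Sum>i\<in>?K. \<Sum>j\<in>?K. hess n (insert h \<alpha>) i j * y i j)"
      using JK by (intro sum.cong refl sum.mono_neutral_right finite_directions) (auto simp: 0)
    finally show ?thesis .
  qed
  show ?thesis
    using assms(3)[OF h] red[of "\<lambda>i j. 1"] red[of "\<lambda>i j. x i * x j" for x] red[of "\<lambda>i j. x j" for x]
    unfolding lorentzian_form_def hess_slice_def Some option.case mult.assoc by simp
qed

text \<open>By induction the slices are Lorentzian. Adding their inequalities, with the row sums known from Euler's
identity, gives exactly the Bochner inequality that \<open>one_positive_eigenvalue\<close> requires; the variable
\<open>\<tau>\<close> provides the positive star.\<close>

theorem lorentzian_hessian:
  assumes local: "\<And>\<alpha>. \<alpha> \<subseteq> H \<Longrightarrow> lorentzian_form (directions H \<alpha>) (hess 0 \<alpha>)"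
    and "\<alpha> \<subseteq> H"
  shows "lorentzian_form (directions H \<alpha>) (hess n \<alpha>)"
  using \<open>\<alpha> \<subseteq> H\<close>
proof (induction n arbitrary: \<alpha>)
  case 0
  then show ?case by (rule local)
next
  case (Suc n)
  let ?J = "directions H \<alpha>" and ?M = "hess (Suc n) \<alpha>"
  have None: "None \<in> ?J" by (simp add: directions_def)
  have rowpos: "0 < (\<Sum>j\<in>?J. ?M i j)" if "i \<in> ?J" for i
  proof (rule sum_pos2[OF finite_directions None])
    show "0 < ?M i None" using hess_star[OF Suc.prems that] hess_sym by metis
  qed (use hess_nonneg[OF Suc.prems that] in auto)
  have "(\<Sum>i\<in>?J. \<Sum>j\<in>?J. ?M i j * x i * x j)
      \<le> (\<Sum>i\<in>?J. (\<Sum>j\<in>?J. ?M i j * x j)\<^sup>2 / (\<Sum>j\<in>?J. ?M i j))" for x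
  proof -
    have "real (Suc n) * (\<Sum>i\<in>?J. \<Sum>j\<in>?J. ?M i j * x i * x j)
        = (\<Sum>i\<in>?J. \<Sum>j\<in>?J. \<Sum>g\<in>?J. hess_slice n \<alpha> g i j * x i * x j)"
      unfolding sum_distrib_left sum_distrib_right[symmetric] mult.assoc
      by (intro sum.cong refl) (simp add: slices_sum mult.assoc)
    also have "\<dots> = (\<Sum>g\<in>?J. \<Sum>i\<in>?J. \<Sum>j\<in>?J. hess_slice n \<alpha> g i j * x i * x j)"
      unfolding sum.swap[of _ ?J ?J, where g = "\<lambda>j g. hess_slice n \<alpha> g i j * x i * x j" for i]
      by (rule sum.swap)
    also have "\<dots> \<le> (\<Sum>g\<in>?J. real (Suc n) * ((\<Sum>j\<in>?J. ?M g j * x j)\<^sup>2 / (\<Sum>j\<in>?J. ?M g j)))"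
    proof (intro sum_mono)
      fix g assume g: "g \<in> ?J"
      let ?S = "hess_slice n \<alpha> g"
      have "lorentzian_form ?J ?S"
        by (rule lorentzian_slice[OF g]) (use Suc in auto)
      then have 1: "(\<Sum>i\<in>?J. \<Sum>j\<in>?J. ?S i j * x i * x j) * (\<Sum>i\<in>?J. \<Sum>j\<in>?J. ?S i j)
          \<le> (\<Sum>i\<in>?J. \<Sum>j\<in>?J. ?S i j * x j)\<^sup>2"
        by (simp add: lorentzian_form_def)
      have Ssym: "?S i j = ?S j i" for i j
        using hess_sym by (simp add: hess_slice_def split: option.split)
      have 2: "(\<Sum>i\<in>?J. \<Sum>j\<in>?J. ?S i j) = real (Suc n) * (\<Sum>j\<in>?J. ?M g j)"
        unfolding sum_distrib_left by (intro sum.cong refl slice_row_sum g)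
      have "(\<Sum>i\<in>?J. \<Sum>j\<in>?J. ?S i j * x j) = (\<Sum>j\<in>?J. \<Sum>i\<in>?J. ?S j i * x j)"
        by (subst sum.swap, subst Ssym, rule refl)
      also have "\<dots> = real (Suc n) * (\<Sum>j\<in>?J. ?M g j * x j)"
        unfolding sum_distrib_left sum_distrib_right[symmetric]
        by (intro sum.cong refl) (simp add: slice_row_sum g)
      finally have 3: "(\<Sum>i\<in>?J. \<Sum>j\<in>?J. ?S i j * x j) = real (Suc n) * (\<Sum>j\<in>?J. ?M g j * x j)" .
      have "(\<Sum>i\<in>?J. \<Sum>j\<in>?J. ?S i j * x i * x j) * (real (Suc n) * (\<Sum>j\<in>?J. ?M g j))
          \<le> (real (Suc n) * (\<Sum>j\<in>?J. ?M g j * x j))\<^sup>2"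
        using 1 unfolding 2 3 .
      then have "(\<Sum>i\<in>?J. \<Sum>j\<in>?J. ?S i j * x i * x j)
          \<le> (real (Suc n) * (\<Sum>j\<in>?J. ?M g j * x j))\<^sup>2 / (real (Suc n) * (\<Sum>j\<in>?J. ?M g j))"
        using rowpos[OF g] by (subst pos_le_divide_eq) auto
      also have "\<dots> = real (Suc n) * ((\<Sum>j\<in>?J. ?M g j * x j)\<^sup>2 / (\<Sum>j\<in>?J. ?M g j))"
        using rowpos[OF g] by (simp add: power2_eq_square del: of_nat_Suc)
      finally show "(\<Sum>i\<in>?J. \<Sum>j\<in>?J. ?S i j * x i * x j)
          \<le> real (Suc n) * ((\<Sum>j\<in>?J. ?M g j * x j)\<^sup>2 / (\<Sum>j\<in>?J. ?M g j))" .
    qed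
    finally show ?thesis unfolding sum_distrib_left[symmetric] by simp
  qed
  from one_positive_eigenvalue[OF finite_directions hess_sym hess_nonneg[OF Suc.prems] None
         hess_star[OF Suc.prems] this]
  show ?case unfolding lorentzian_form_def by blast
qed

text \<open>In degree 2, \<open>F(\<alpha>)\<close> times the quadratic form is the square of the linear form \<open>lin\<close> plus the form that \<open>loc\<close>
asserts to be nonpositive. So it is nonpositive on the kernel of \<open>lin\<close>, which does not contain the
constant vector.\<close>

lemma lorentzian_local:
  assumes "\<alpha> \<subseteq> H"
    and loc: "\<And>z. (\<Sum>h\<in>H - \<alpha>. \<Sum>k\<in>H - \<alpha> - {h}.
            (F \<alpha> * F (insert h (insert k \<alpha>)) - F (insert h \<alpha>) * F (insert k \<alpha>)) * z h * z k)
          \<le> (\<Sum>h\<in>H - \<alpha>. (F (insert h \<alpha>) * z h)\<^sup>2)"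
  shows "lorentzian_form (directions H \<alpha>) (hess 0 \<alpha>)"
  unfolding lorentzian_form_def
proof (intro allI)
  fix x :: "'h option \<Rightarrow> real"
  let ?J = "directions H \<alpha>" and ?U = "H - \<alpha>"
  define B where "B x y = (\<Sum>i\<in>?J. \<Sum>j\<in>?J. hess 0 \<alpha> i j * x i * y j)" for x y :: "'h option \<Rightarrow> real"
  define lin where "lin x = \<tau> * F \<alpha> * x None + (\<Sum>h\<in>?U. F (insert h \<alpha>) * x (Some h))" for x :: "'h option \<Rightarrow> real"
  have pos: "0 < F \<alpha>" using assms(1) by (rule F_pos)
  have form: "F \<alpha> * B x x \<le> (lin x)\<^sup>2" for x
  proof -
    let ?z = "\<lambda>h. x (Some h)" and ?f = "\<lambda>h. F (insert h \<alpha>)"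
    let ?s = "\<Sum>h\<in>?U. ?f h * ?z h"
    have "(\<Sum>k\<in>?U. hess 0 \<alpha> (Some h) (Some k) * ?z h * ?z k)
        = (\<Sum>k\<in>?U - {h}. F (insert h (insert k \<alpha>)) * ?z h * ?z k)" if "h \<in> ?U" for h
      using that fin by (intro sum.mono_neutral_cong_right) (auto simp: exp_homog_0)
    then have "B x x = \<tau>\<^sup>2 * F \<alpha> * (x None)\<^sup>2 + 2 * \<tau> * x None * ?s
        + (\<Sum>h\<in>?U. \<Sum>k\<in>?U - {h}. F (insert h (insert k \<alpha>)) * ?z h * ?z k)"
      unfolding B_def sum_directions
      by (simp add: exp_homog_0 fin sum.distrib sum_distrib_left mult_ac power2_eq_square)
    then have 1: "F \<alpha> * B x x = (\<tau> * F \<alpha> * x None)\<^sup>2 + 2 * (\<tau> * F \<alpha> * x None) * ?s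
        + (\<Sum>h\<in>?U. \<Sum>k\<in>?U - {h}. F \<alpha> * F (insert h (insert k \<alpha>)) * ?z h * ?z k)"
      by (simp add: sum_distrib_left algebra_simps power2_eq_square)
    have "?s\<^sup>2 = (\<Sum>h\<in>?U. \<Sum>k\<in>?U. ?f h * ?f k * ?z h * ?z k)"
      unfolding power2_eq_square sum_product by (simp add: mult_ac)
    also have "\<dots> = (\<Sum>h\<in>?U. (?f h * ?z h)\<^sup>2 + (\<Sum>k\<in>?U - {h}. ?f h * ?f k * ?z h * ?z k))"
      using fin by (intro sum.cong refl) (subst sum.remove, auto simp: power2_eq_square mult_ac)
    finally have 2: "?s\<^sup>2 = (\<Sum>h\<in>?U. (?f h * ?z h)\<^sup>2)
        + (\<Sum>h\<in>?U. \<Sum>k\<in>?U - {h}. ?f h * ?f k * ?z h * ?z k)"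
      by (simp add: sum.distrib)
    have "(\<Sum>h\<in>?U. \<Sum>k\<in>?U - {h}. F \<alpha> * F (insert h (insert k \<alpha>)) * ?z h * ?z k) \<le> ?s\<^sup>2"
      using loc[of ?z] unfolding 2 by (simp add: left_diff_distrib sum_subtractf)
    moreover have "(lin x)\<^sup>2 = (\<tau> * F \<alpha> * x None)\<^sup>2 + 2 * (\<tau> * F \<alpha> * x None) * ?s + ?s\<^sup>2"
      by (simp add: lin_def power2_sum)
    ultimately show ?thesis unfolding 1 by simp
  qed
  let ?o = "\<lambda>i :: 'h option. 1 :: real"
  have lpos: "0 < lin ?o"
    unfolding lin_def using assms(1) \<tau> pos
    by (intro add_pos_nonneg sum_nonneg) (auto intro: less_imp_le F_pos)
  have add: "B (\<lambda>i. x i - c) (\<lambda>i. x i - c) = B x x - 2 * c * B ?o x + c\<^sup>2 * B ?o ?o" for c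
  proof -
    have "B x ?o = B ?o x"
      unfolding B_def by (subst sum.swap, subst hess_sym) simp
    moreover have "B (\<lambda>i. x i - c) (\<lambda>i. x i - c) = B x x - c * B ?o x - c * B x ?o + c\<^sup>2 * B ?o ?o"
      unfolding B_def sum_distrib_left sum_subtractf[symmetric] sum.distrib[symmetric]
      by (intro sum.cong refl) (simp add: algebra_simps power2_eq_square)
    ultimately show ?thesis by simp
  qed
  define c where "c = lin x / lin ?o"
  have "lin (\<lambda>i. x i - c) = lin x - c * lin ?o"
    unfolding lin_def by (simp add: algebra_simps sum_subtractf sum_distrib_left)
  then have "lin (\<lambda>i. x i - c) = 0" using lpos by (simp add: c_def)
  with form[of "\<lambda>i. x i - c"] pos have "B (\<lambda>i. x i - c) (\<lambda>i. x i - c) \<le> 0"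
    by (simp add: mult_le_0_iff)
  then have 1: "B x x \<le> 2 * c * B ?o x - c\<^sup>2 * B ?o ?o" by (simp add: add)
  have "0 \<le> B ?o ?o" unfolding B_def using hess_nonneg[OF assms(1)]
    by (intro sum_nonneg) auto
  with 1 have "B x x * B ?o ?o \<le> (2 * c * B ?o x - c\<^sup>2 * B ?o ?o) * B ?o ?o"
    by (rule mult_right_mono)
  also have "\<dots> = (B ?o x)\<^sup>2 - (B ?o x - c * B ?o ?o)\<^sup>2"
    by (simp add: power2_eq_square algebra_simps)
  also have "\<dots> \<le> (B ?o x)\<^sup>2" by simp
  finally show "(\<Sum>i\<in>?J. \<Sum>j\<in>?J. hess 0 \<alpha> i j * x i * x j) * (\<Sum>i\<in>?J. \<Sum>j\<in>?J. hess 0 \<alpha> i j)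
      \<le> (\<Sum>i\<in>?J. \<Sum>j\<in>?J. hess 0 \<alpha> i j * x j)\<^sup>2"
    by (simp add: B_def)
qed

text \<open>The reversed Cauchy-Schwarz inequality, applied to the direction \<open>\<tau>\<close>.\<close>

lemma exp_homog_newton:
  assumes "lorentzian_form (directions H {}) (hess n {})"
  shows "real (n + 2) * homog n {} * homog (n + 2) {} \<le> real (n + 1) * (homog (n + 1) {})\<^sup>2"
proof -
  let ?J = "directions H {}" and ?x = "\<lambda>i. if i = None then 1 else 0 :: real"
  have J: "finite ?J" "None \<in> ?J"
    using finite_directions[of "{}"] by (auto simp: directions_def)
  have "(\<Sum>i\<in>?J. \<Sum>j\<in>?J. hess n {} i j * ?x i * ?x j) = (\<Sum>i\<in>?J. if i = None then hess n {} i None else 0)"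
    using J by (intro sum.cong refl) (auto simp: if_distrib cong: if_cong)
  then have 1: "(\<Sum>i\<in>?J. \<Sum>j\<in>?J. hess n {} i j * ?x i * ?x j) = \<tau>\<^sup>2 * homog n {}"
    using J by simp
  have "(\<Sum>i\<in>?J. \<Sum>j\<in>?J. hess n {} i j * ?x j) = (\<Sum>i\<in>?J. hess n {} None i)"
    using J hess_sym by (intro sum.cong refl) (auto simp: if_distrib cong: if_cong)
  then have 2: "(\<Sum>i\<in>?J. \<Sum>j\<in>?J. hess n {} i j * ?x j) = real (n + 1) * \<tau> * homog (n + 1) {}"
    using hess_row_sum[OF J(2), of n] by (simp add: hess_row_def)
  have "(\<Sum>i\<in>?J. \<Sum>j\<in>?J. hess n {} i j) = real (n + 1) * (\<Sum>i\<in>?J. hess_row (n + 1) {} i)"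
    by (simp add: hess_row_sum sum_distrib_left)
  also have "(\<Sum>i\<in>?J. hess_row (n + 1) {} i) = real (n + 2) * homog (n + 2) {}"
    using exp_homog_Suc[OF fin, of "Suc n" F \<tau> "{}"] by (simp add: sum_directions hess_row_def)
  finally have 3: "(\<Sum>i\<in>?J. \<Sum>j\<in>?J. hess n {} i j) = real (n + 1) * (real (n + 2) * homog (n + 2) {})" .
  have "(\<tau>\<^sup>2 * homog n {}) * (real (n + 1) * (real (n + 2) * homog (n + 2) {})) \<le> (real (n + 1) * \<tau> * homog (n + 1) {})\<^sup>2"
    using assms[unfolded lorentzian_form_def, rule_format, of ?x] unfolding 1 2 3 .
  then have "(\<tau>\<^sup>2 * real (n + 1)) * (real (n + 2) * homog n {} * homog (n + 2) {})
      \<le> (\<tau>\<^sup>2 * real (n + 1)) * (real (n + 1) * (homog (n + 1) {})\<^sup>2)"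
    by (simp only: power2_eq_square mult_ac)
  then show ?thesis using \<tau> by (subst (asm) mult_le_cancel_left_pos) auto
qed

end

text \<open>As \<open>\<tau>\<close> tends to 0, the homogenisation of degree \<open>n\<close> tends to the sum of \<open>F\<close> over the sets of size \<open>n\<close>.
The point \<open>\<tau> = 0\<close> itself lies on the boundary of the positive orthant, outside the scope of the spectral
argument.\<close>

theorem ultra_log_concave_level_sums:
  fixes F :: "'h set \<Rightarrow> real"
  assumes fin: "finite H" and F_pos: "\<And>\<alpha>. \<alpha> \<subseteq> H \<Longrightarrow> 0 < F \<alpha>"
    and loc: "\<And>\<alpha> z. \<alpha> \<subseteq> H \<Longrightarrow> (\<Sum>h\<in>H - \<alpha>. \<Sum>k\<in>H - \<alpha> - {h}.
            (F \<alpha> * F (insert h (insert k \<alpha>)) - F (insert h \<alpha>) * F (insert k \<alpha>)) * z h * z k)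
          \<le> (\<Sum>h\<in>H - \<alpha>. (F (insert h \<alpha>) * z h)\<^sup>2)"
  defines "c \<equiv> \<lambda>k. \<Sum>\<gamma> | \<gamma> \<subseteq> H \<and> card \<gamma> = k. F \<gamma>"
  shows "real (k + 2) * c k * c (k + 2) \<le> real (k + 1) * (c (k + 1))\<^sup>2"
proof -
  have newton: "real (k + 2) * exp_homog H F \<tau> k {} * exp_homog H F \<tau> (k + 2) {}
      \<le> real (k + 1) * (exp_homog H F \<tau> (k + 1) {})\<^sup>2" if "0 < \<tau>" for \<tau>
  proof (rule exp_homog_newton[OF fin F_pos that])
    show "lorentzian_form (directions H {}) (exp_hessian H F \<tau> k {})"
      by (rule lorentzian_hessian[OF fin F_pos that])
         (use lorentzian_local[OF fin F_pos that _ loc] in auto)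
  qed auto
  have lim: "((\<lambda>\<tau>. exp_homog H F \<tau> n {}) \<longlongrightarrow> c n) (at_right 0)" for n
  proof -
    have "((\<lambda>\<tau>. exp_weight \<tau> n m) \<longlongrightarrow> (if m = n then 1 else 0)) (at_right 0)" for m
    proof (cases "m < n")
      case True
      have "((\<lambda>\<tau>::real. \<tau> ^ (n - m) / fact (n - m)) \<longlongrightarrow> 0 ^ (n - m) / fact (n - m)) (at_right 0)"
        by (intro tendsto_intros) auto
      then show ?thesis using True by (simp add: exp_weight_def power_0_left)
    qed (auto simp: exp_weight_def)
    then have "((\<lambda>\<tau>. exp_homog H F \<tau> n {}) \<longlongrightarrow>
        (\<Sum>\<gamma>\<in>Pow (H - {}). (if card \<gamma> = n then 1 else 0) * F ({} \<union> \<gamma>))) (at_right 0)"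
      unfolding exp_homog_def by (intro tendsto_intros)
    also have "(\<Sum>\<gamma>\<in>Pow (H - {}). (if card \<gamma> = n then 1 else 0) * F ({} \<union> \<gamma>)) = c n"
      unfolding c_def using fin
      by (intro sum.mono_neutral_cong_right) (auto simp: Pow_def)
    finally show ?thesis .
  qed
  show ?thesis
  proof (rule tendsto_le[OF _ _ _])
    show "((\<lambda>\<tau>. real (k + 1) * (exp_homog H F \<tau> (k + 1) {})\<^sup>2) \<longlongrightarrow> real (k + 1) * (c (k + 1))\<^sup>2) (at_right 0)"
      by (intro tendsto_intros lim)
    show "((\<lambda>\<tau>. real (k + 2) * exp_homog H F \<tau> k {} * exp_homog H F \<tau> (k + 2) {})
        \<longlongrightarrow> real (k + 2) * c k * c (k + 2)) (at_right 0)"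
      by (intro tendsto_intros lim)
    show "\<forall>\<^sub>F \<tau> in at_right 0. real (k + 2) * exp_homog H F \<tau> k {} * exp_homog H F \<tau> (k + 2) {}
        \<le> real (k + 1) * (exp_homog H F \<tau> (k + 1) {})\<^sup>2"
      by (rule eventually_mono[OF eventually_at_right_less newton])
  qed simp
qed

section \<open>Weights on sets of half-edges\<close>

text \<open>Gershgorin's criterion. The part \<open>- \<kappa> v\<close> that is constant on pairs with common value \<open>v\<close> of \<open>vt\<close>
contributes a negative multiple of a square, up to a diagonal correction, and is therefore charged to
each row only once and not once for each entry.\<close>

lemma quadratic_form_row_bound:
  fixes \<nu> :: "'h \<Rightarrow> 'h \<Rightarrow> real" and \<kappa> :: "'v \<Rightarrow> real" and vt :: "'h \<Rightarrow> 'v"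
  assumes fin: "finite U" and sym: "\<And>h k. \<nu> h k = \<nu> k h" and \<kappa>: "\<And>v. 0 \<le> \<kappa> v"
    and row: "\<And>h. h \<in> U \<Longrightarrow>
      \<kappa> (vt h) + (\<Sum>k\<in>U - {h}. \<bar>\<nu> h k + (if vt k = vt h then \<kappa> (vt h) else 0)\<bar>) \<le> 1"
  shows "(\<Sum>h\<in>U. \<Sum>k\<in>U - {h}. \<nu> h k * z h * z k) \<le> (\<Sum>h\<in>U. (z h)\<^sup>2)"
proof -
  define \<mu> where "\<mu> h k = \<nu> h k + (if vt k = vt h then \<kappa> (vt h) else 0)" for h k
  have \<mu>_sym: "\<mu> h k = \<mu> k h" for h k using sym[of h k] by (simp add: \<mu>_def)
  have split: "(\<Sum>h\<in>U. \<Sum>k\<in>U. f h k) = (\<Sum>h\<in>U. f h h) + (\<Sum>h\<in>U. \<Sum>k\<in>U - {h}. f h k)"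
    for f :: "'h \<Rightarrow> 'h \<Rightarrow> real"
    unfolding sum.distrib[symmetric] using fin by (intro sum.cong refl) (simp add: sum.remove)
  have "(\<Sum>h\<in>U. \<Sum>k\<in>U. (if vt k = vt h then \<kappa> (vt h) else 0) * z h * z k)
      = (\<Sum>v\<in>vt ` U. \<kappa> v * (\<Sum>h | h \<in> U \<and> vt h = v. z h)\<^sup>2)"
  proof -
    have "(\<Sum>h\<in>U. \<Sum>k\<in>U. (if vt k = vt h then \<kappa> (vt h) else 0) * z h * z k)
        = (\<Sum>h\<in>U. \<kappa> (vt h) * z h * (\<Sum>k | k \<in> U \<and> vt k = vt h. z k))"
      unfolding sum_distrib_left using fin
      by (intro sum.cong refl sum.mono_neutral_cong_right) auto
    also have "\<dots> = (\<Sum>v\<in>vt ` U. \<Sum>h | h \<in> U \<and> vt h = v. \<kappa> (vt h) * z h * (\<Sum>k | k \<in> U \<and> vt k = vt h. z k))"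
      by (rule sum.image_gen[OF fin])
    also have "\<dots> = (\<Sum>v\<in>vt ` U. \<kappa> v * (\<Sum>h | h \<in> U \<and> vt h = v. z h)\<^sup>2)"
      by (intro sum.cong refl) (simp add: power2_eq_square sum_distrib_left sum_distrib_right mult_ac)
    finally show ?thesis .
  qed
  also have "\<dots> \<ge> 0" by (intro sum_nonneg mult_nonneg_nonneg \<kappa>) auto
  finally have pos: "0 \<le> (\<Sum>h\<in>U. \<kappa> (vt h) * (z h)\<^sup>2)
      + (\<Sum>h\<in>U. \<Sum>k\<in>U - {h}. (if vt k = vt h then \<kappa> (vt h) else 0) * z h * z k)"
    unfolding split by (simp add: power2_eq_square mult.assoc)
  have "(\<Sum>h\<in>U. \<Sum>k\<in>U - {h}. \<mu> h k * z h * z k)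
      \<le> (\<Sum>h\<in>U. \<Sum>k\<in>U - {h}. (\<bar>\<mu> h k\<bar> * (z h)\<^sup>2 + \<bar>\<mu> k h\<bar> * (z k)\<^sup>2) / 2)"
  proof (intro sum_mono)
    fix h k
    have "\<mu> h k * (z h * z k) \<le> \<bar>\<mu> h k\<bar> * \<bar>z h * z k\<bar>"
      by (metis abs_ge_self abs_mult)
    also have "\<bar>\<mu> h k\<bar> * \<bar>z h * z k\<bar> \<le> \<bar>\<mu> h k\<bar> * (((z h)\<^sup>2 + (z k)\<^sup>2) / 2)"
      using sum_squares_bound[of "\<bar>z h\<bar>" "\<bar>z k\<bar>"]
      by (intro mult_left_mono) (auto simp: abs_mult)
    finally show "\<mu> h k * z h * z k \<le> (\<bar>\<mu> h k\<bar> * (z h)\<^sup>2 + \<bar>\<mu> k h\<bar> * (z k)\<^sup>2) / 2"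
      using \<mu>_sym[of h k] by (simp add: algebra_simps)
  qed
  also have "\<dots> = (\<Sum>h\<in>U. \<Sum>k\<in>U - {h}. \<bar>\<mu> h k\<bar> * (z h)\<^sup>2)"
  proof -
    have "(\<Sum>h\<in>U. \<Sum>k\<in>U. \<bar>\<mu> k h\<bar> * (z k)\<^sup>2) = (\<Sum>h\<in>U. \<Sum>k\<in>U. \<bar>\<mu> h k\<bar> * (z h)\<^sup>2)"
      by (rule sum.swap)
    then have "(\<Sum>h\<in>U. \<Sum>k\<in>U - {h}. \<bar>\<mu> k h\<bar> * (z k)\<^sup>2) = (\<Sum>h\<in>U. \<Sum>k\<in>U - {h}. \<bar>\<mu> h k\<bar> * (z h)\<^sup>2)"
      unfolding split by simp
    then show ?thesis by (simp add: sum.distrib flip: sum_divide_distrib)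
  qed
  also have "\<dots> = (\<Sum>h\<in>U. (\<Sum>k\<in>U - {h}. \<bar>\<mu> h k\<bar>) * (z h)\<^sup>2)"
    by (simp add: sum_distrib_right)
  also have "\<dots> \<le> (\<Sum>h\<in>U. (1 - \<kappa> (vt h)) * (z h)\<^sup>2)"
    using row by (intro sum_mono mult_right_mono) (auto simp: \<mu>_def algebra_simps)
  finally have "(\<Sum>h\<in>U. \<Sum>k\<in>U - {h}. \<mu> h k * z h * z k)
      \<le> (\<Sum>h\<in>U. (z h)\<^sup>2) - (\<Sum>h\<in>U. \<kappa> (vt h) * (z h)\<^sup>2)"
    by (simp add: left_diff_distrib sum_subtractf)
  moreover have "(\<Sum>h\<in>U. \<Sum>k\<in>U - {h}. \<mu> h k * z h * z k) = (\<Sum>h\<in>U. \<Sum>k\<in>U - {h}. \<nu> h k * z h * z k)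
      + (\<Sum>h\<in>U. \<Sum>k\<in>U - {h}. (if vt k = vt h then \<kappa> (vt h) else 0) * z h * z k)"
    by (simp add: \<mu>_def distrib_right sum.distrib)
  ultimately show ?thesis using pos by linarith
qed

text \<open>The half-edge \<open>(e, x)\<close> is the half of \<open>e\<close> at the vertex \<open>en e x\<close>; \<open>no_loop\<close> and \<open>no_parallel\<close> say that
the graph is simple. The number \<open>a\<close> will be \<open>l + 1\<close>.\<close>

locale half_edges =
  fixes E :: "'e set" and en :: "'e \<Rightarrow> bool \<Rightarrow> 'v" and a :: real
  assumes fin_E: "finite E"
    and no_loop: "\<And>e x. e \<in> E \<Longrightarrow> en e (\<not> x) \<noteq> en e x"
    and no_parallel: "\<And>e e' x x'. e \<in> E \<Longrightarrow> e' \<in> E \<Longrightarrow> en e x = en e' x' \<Longrightarrow>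
        en e (\<not> x) = en e' (\<not> x') \<Longrightarrow> e = e'"
    and a_ge: "2 \<le> a"
begin

abbreviation vt :: "'e \<times> bool \<Rightarrow> 'v" where "vt h \<equiv> en (fst h) (snd h)"

abbreviation opp :: "'e \<times> bool \<Rightarrow> 'e \<times> bool" where "opp h \<equiv> (fst h, \<not> snd h)"

definition H :: "('e \<times> bool) set" where "H = E \<times> UNIV"

definition star :: "'v \<Rightarrow> ('e \<times> bool) set" where "star v = {h \<in> H. vt h = v}"

text \<open>The coefficient of \<open>a * x\<^sub>h\<close> in the average of the variables \<open>x\<^sub>h\<close> at \<open>v\<close>, the contribution of a chosen vertex.\<close>

definition q :: "'v \<Rightarrow> real" where "q v = 1 / (a * card (star v))"

text \<open>Divided by the product \<open>(a x)\<^sup>2\<close> of the two half-edge terms, the correction \<open>- x\<^sup>2\<close> of an edge with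
unchosen ends is \<open>- b\<close>.\<close>

definition b :: real where "b = 1 / a\<^sup>2"

text \<open>A half-edge of \<open>\<alpha>\<close> that is alone at its vertex (lonely) arises in two ways: the vertex is unchosen, with weight 1, or it
is chosen, with weight \<open>q\<close>.\<close>

definition single :: "('e \<times> bool) set \<Rightarrow> 'e \<times> bool \<Rightarrow> real" where
  "single \<alpha> h = (if \<alpha> \<inter> star (vt h) = {h} then 1 + q (vt h) else 1)"

text \<open>The correction \<open>b\<close> is present only if both halves lie in \<open>\<alpha>\<close> and both ends are unchosen. It is subtracted once
from the product because of the four combinations of states only one carries it.\<close>

definition edge_wt :: "('e \<times> bool) set \<Rightarrow> 'e \<Rightarrow> real" where
  "edge_wt \<alpha> e = single \<alpha> (e, False) * single \<alpha> (e, True)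
     - of_bool ((e, False) \<in> \<alpha>) * of_bool ((e, True) \<in> \<alpha>) * b"

definition F :: "('e \<times> bool) set \<Rightarrow> real" where "F \<alpha> = (\<Prod>e\<in>E. edge_wt \<alpha> e)"

lemma finite_H: "finite H" using fin_E by (simp add: H_def)

lemma finite_star: "finite (star v)" using finite_H by (simp add: star_def)

lemma in_star: "h \<in> H \<Longrightarrow> h \<in> star (vt h)" by (simp add: star_def)

lemma vt_opp: "h \<in> H \<Longrightarrow> en (fst h) (\<not> snd h) \<noteq> vt h" using no_loop by (auto simp: H_def)

lemma opp_neq [simp]: "opp h \<noteq> h" "h \<noteq> opp h" by (cases h; simp)+

lemma q_nonneg: "0 \<le> q v" using a_ge by (simp add: q_def)

lemma card_star_q: "card (star v) * q v \<le> 1 / 2"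
proof (cases "card (star v) = 0")
  case False
  then have "card (star v) * q v = 1 / a" by (simp add: q_def)
  also have "\<dots> \<le> 1 / 2" using a_ge by (intro divide_left_mono) auto
  finally show ?thesis .
qed simp

lemma card_star_pos: "h \<in> H \<Longrightarrow> 1 \<le> card (star (vt h))"
  using card_mono[OF finite_star, of "{h}" "vt h"] in_star[of h] by simp

lemma q_le_half: "h \<in> H \<Longrightarrow> q (vt h) \<le> 1 / 2"
proof -
  assume "h \<in> H"
  then have "1 * q (vt h) \<le> real (card (star (vt h))) * q (vt h)"
    using card_star_pos by (intro mult_right_mono q_nonneg) auto
  also note card_star_q
  finally show ?thesis by simp
qed

lemma b_pos: "0 < b" using a_ge by (simp add: b_def)

lemma b_le: "b \<le> 1 / 4"
proof -
  have "2\<^sup>2 \<le> a\<^sup>2" using a_ge by (intro power_mono) auto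
  then show ?thesis unfolding b_def by (intro divide_left_mono) auto
qed

lemma single_ge: "1 \<le> single \<alpha> h" using q_nonneg by (simp add: single_def)

lemma single_nonneg: "0 \<le> single \<alpha> h" using single_ge[of \<alpha> h] by simp

lemma single_notin: "h \<notin> \<alpha> \<Longrightarrow> single \<alpha> h = 1" by (auto simp: single_def)

lemma edge_wt_half:
  "edge_wt \<alpha> (fst h) = single \<alpha> h * single \<alpha> (opp h) - of_bool (h \<in> \<alpha>) * of_bool (opp h \<in> \<alpha>) * b"
proof (cases h)
  case (Pair e x)
  then show ?thesis by (cases x) (simp_all add: edge_wt_def mult.commute)
qed

lemma edge_wt_ge: "3 / 4 \<le> edge_wt \<alpha> e"
proof -
  have "1 * 1 \<le> single \<alpha> (e, False) * single \<alpha> (e, True)"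
    by (intro mult_mono single_ge single_nonneg) auto
  then show ?thesis using b_le by (auto simp: edge_wt_def of_bool_def)
qed

lemma edge_wt_ge_1: "h \<notin> \<alpha> \<or> opp h \<notin> \<alpha> \<Longrightarrow> 1 \<le> edge_wt \<alpha> (fst h)"
proof -
  assume "h \<notin> \<alpha> \<or> opp h \<notin> \<alpha>"
  moreover have "1 * 1 \<le> single \<alpha> h * single \<alpha> (opp h)"
    by (intro mult_mono single_ge single_nonneg) auto
  ultimately show ?thesis by (auto simp: edge_wt_half)
qed

lemma edge_wt_pos: "0 < edge_wt \<alpha> e" using edge_wt_ge[of \<alpha> e] by simp

lemma edge_wt_nz: "edge_wt \<alpha> e \<noteq> 0" using edge_wt_pos[of \<alpha> e] by simp

lemma F_pos: "0 < F \<alpha>" unfolding F_def by (intro prod_pos ballI edge_wt_pos)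

lemma single_insert_other:
  assumes "vt h \<noteq> vt g"
  shows "single (insert h \<alpha>) g = single \<alpha> g"
proof -
  have "h \<notin> star (vt g)" using assms by (simp add: star_def)
  then have "insert h \<alpha> \<inter> star (vt g) = \<alpha> \<inter> star (vt g)" by blast
  then show ?thesis by (simp add: single_def)
qed

lemma single_insert_crowded:
  assumes "h \<in> H" "h \<notin> \<alpha>" "\<alpha> \<inter> star (vt h) \<noteq> {}" "vt g = vt h"
  shows "single (insert h \<alpha>) g = 1"
proof -
  obtain k where "k \<in> \<alpha>" "k \<in> star (vt h)" using assms(3) by blast
  then have "{h, k} \<subseteq> insert h \<alpha> \<inter> star (vt g)" "h \<noteq> k"
    unfolding assms(4) using in_star[OF assms(1)] assms(2) by auto
  then have "insert h \<alpha> \<inter> star (vt g) \<noteq> {g}"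
    by (metis insert_subset singletonD)
  then show ?thesis by (simp add: single_def)
qed

lemma single_insert_first:
  assumes "h \<in> H" "\<alpha> \<inter> star (vt h) = {}" "vt g = vt h"
  shows "single (insert h \<alpha>) g = (if g = h then 1 + q (vt h) else 1)"
proof -
  have "insert h \<alpha> \<inter> star (vt g) = {h}"
    unfolding assms(3) using in_star[OF assms(1)] assms(2) by blast
  then show ?thesis by (simp add: single_def)
qed

lemma edge_wt_insert_other:
  assumes "vt h \<noteq> en e False" "vt h \<noteq> en e True"
  shows "edge_wt (insert h \<alpha>) e = edge_wt \<alpha> e"
proof -
  have "h \<noteq> (e, False)" "h \<noteq> (e, True)" using assms by auto
  then show ?thesis
    using assms single_insert_other[of h "(e, False)" \<alpha>] single_insert_other[of h "(e, True)" \<alpha>]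
    by (simp add: edge_wt_def)
qed

definition cross :: "('e \<times> bool) set \<Rightarrow> 'e \<times> bool \<Rightarrow> 'e \<times> bool \<Rightarrow> 'e \<Rightarrow> real" where
  "cross \<alpha> h k e = edge_wt \<alpha> e * edge_wt (insert h (insert k \<alpha>)) e
      / (edge_wt (insert h \<alpha>) e * edge_wt (insert k \<alpha>) e)"

text \<open>The entry of the Hessian at 0 of the logarithm of the generating polynomial of \<open>\<gamma> \<mapsto> F(\<alpha> \<union> \<gamma>)\<close>, in
coordinates in which the gradient is the constant vector 1. The diagonal entries of this Hessian are \<open>-1\<close>.\<close>

definition corr :: "('e \<times> bool) set \<Rightarrow> 'e \<times> bool \<Rightarrow> 'e \<times> bool \<Rightarrow> real" where
  "corr \<alpha> h k = F \<alpha> * F (insert h (insert k \<alpha>)) / (F (insert h \<alpha>) * F (insert k \<alpha>)) - 1"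

lemma corr_prod: "corr \<alpha> h k = (\<Prod>e\<in>E. cross \<alpha> h k e) - 1"
  by (simp add: corr_def cross_def F_def prod_dividef prod.distrib)

lemma corr_sym: "corr \<alpha> h k = corr \<alpha> k h"
  by (simp add: corr_def insert_commute mult_ac)

text \<open>The weight of an edge depends only on the half-edges at its two ends, so the edge sees both \<open>h\<close> and
\<open>k\<close> only if both lie at its ends.\<close>

lemma cross_nontrivial:
  assumes "cross \<alpha> h k e \<noteq> 1"
  shows "(vt h = en e False \<or> vt h = en e True) \<and> (vt k = en e False \<or> vt k = en e True)"
proof (rule ccontr)
  assume "\<not> ?thesis"
  then consider "vt h \<noteq> en e False \<and> vt h \<noteq> en e True" | "vt k \<noteq> en e False \<and> vt k \<noteq> en e True" by auto
  then have "cross \<alpha> h k e = 1"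
  proof cases
    case 1
    then show ?thesis by (simp add: cross_def edge_wt_insert_other edge_wt_nz)
  next
    case 2
    then show ?thesis
      by (simp add: cross_def edge_wt_insert_other insert_commute[of h k] edge_wt_nz)
  qed
  with assms show False by simp
qed

text \<open>The determinant of the two pairs of membership and weight of \<open>g\<close> before and after \<open>h\<close> is added to \<open>\<alpha>\<close>. It measures
the effect of \<open>h\<close> on the edge of \<open>g\<close> (\<open>corr_between\<close>) and vanishes unless \<open>h\<close> is \<open>g\<close> or ends the loneliness of \<open>g\<close>
(\<open>sens_abs\<close>).\<close>

definition sens :: "('e \<times> bool) set \<Rightarrow> 'e \<times> bool \<Rightarrow> 'e \<times> bool \<Rightarrow> real" where
  "sens \<alpha> h g = of_bool (g \<in> \<alpha>) * single (insert h \<alpha>) g - of_bool (g \<in> insert h \<alpha>) * single \<alpha> g"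

lemma sens_abs:
  assumes "h \<in> H" "h \<notin> \<alpha>" "vt g = vt h"
  shows "\<bar>sens \<alpha> h g\<bar> = (if g = h then 1 else if \<alpha> \<inter> star (vt h) = {g} then q (vt h) else 0)"
proof (cases "g \<in> \<alpha>")
  case True
  then have gh: "g \<noteq> h" using assms by auto
  show ?thesis
  proof (cases "\<alpha> \<inter> star (vt h) = {}")
    case empty: True
    have "g \<notin> star (vt h)" using empty True by auto
    then have "\<alpha> \<inter> star (vt h) \<noteq> {g}" by auto
    moreover have "insert h \<alpha> \<inter> star (vt h) \<noteq> {g}" using \<open>g \<notin> star (vt h)\<close> by auto
    ultimately show ?thesis using True gh assms by (simp add: sens_def single_def)
  next
    case False
    then have "single (insert h \<alpha>) g = 1" using assms by (intro single_insert_crowded) auto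
    then show ?thesis using True gh assms q_nonneg by (simp add: sens_def single_def)
  qed
next
  case False
  then show ?thesis using assms by (auto simp: sens_def single_notin)
qed

text \<open>Only the edge that joins the two vertices sees both \<open>h\<close> and \<open>k\<close>. Its weight is a bilinear form in the
states of its two halves, so the second difference is \<open>b\<close> times a product of two determinants.\<close>

lemma corr_between:
  assumes "h \<notin> \<alpha>" "k \<notin> \<alpha>" and g: "g \<in> H" "vt h = vt g" "vt k = vt (opp g)"
  shows "corr \<alpha> h k = - (sens \<alpha> h g * sens \<alpha> k (opp g) * b)
           / (edge_wt (insert h \<alpha>) (fst g) * edge_wt (insert k \<alpha>) (fst g))"
proof -
  let ?e = "fst g" and ?hk = "insert h (insert k \<alpha>)"
  have ne: "vt h \<noteq> vt k" using vt_opp[OF g(1)] g(2,3) by simp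
  have e: "?e \<in> E" using g by (auto simp: H_def)
  have "cross \<alpha> h k e = 1" if "e \<in> E - {?e}" for e
  proof (rule ccontr)
    assume "cross \<alpha> h k e \<noteq> 1"
    from cross_nontrivial[OF this] ne obtain x where "en e x = vt h" "en e (\<not> x) = vt k"
      by (metis (full_types))
    then show False using no_parallel[of e ?e x "snd g"] that e g by auto
  qed
  then have "(\<Prod>e\<in>E. cross \<alpha> h k e) = cross \<alpha> h k ?e"
    using fin_E e by (simp add: prod.remove[of E ?e])
  then have 1: "corr \<alpha> h k = cross \<alpha> h k ?e - 1" by (simp add: corr_prod)
  have s1: "single (insert k \<alpha>) g = single \<alpha> g" "single (insert h \<alpha>) (opp g) = single \<alpha> (opp g)"
    using ne g by (auto intro!: single_insert_other)
  have "single (insert k (insert h \<alpha>)) g = single (insert h \<alpha>) g"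
    using ne g by (intro single_insert_other) auto
  then have s2: "single ?hk g = single (insert h \<alpha>) g" by (simp add: insert_commute)
  have s3: "single ?hk (opp g) = single (insert k \<alpha>) (opp g)"
    using ne g by (intro single_insert_other) auto
  have m: "g \<noteq> k" "opp g \<noteq> h" using ne g by auto
  define P0 P1 Q0 Q1 I0 I1 J0 J1 where
    "P0 = single \<alpha> g" "P1 = single (insert h \<alpha>) g"
    "Q0 = single \<alpha> (opp g)" "Q1 = single (insert k \<alpha>) (opp g)"
    "I0 = (of_bool (g \<in> \<alpha>) :: real)" "I1 = (of_bool (g \<in> insert h \<alpha>) :: real)"
    "J0 = (of_bool (opp g \<in> \<alpha>) :: real)" "J1 = (of_bool (opp g \<in> insert k \<alpha>) :: real)"
  note defs = this
  have w: "edge_wt \<alpha> ?e = P0 * Q0 - I0 * J0 * b" "edge_wt (insert h \<alpha>) ?e = P1 * Q0 - I1 * J0 * b"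
    "edge_wt (insert k \<alpha>) ?e = P0 * Q1 - I0 * J1 * b" "edge_wt ?hk ?e = P1 * Q1 - I1 * J1 * b"
    unfolding edge_wt_half s1 s2 s3 defs using m by auto
  have "edge_wt \<alpha> ?e * edge_wt ?hk ?e - edge_wt (insert h \<alpha>) ?e * edge_wt (insert k \<alpha>) ?e
      = - ((I0 * P1 - I1 * P0) * (J0 * Q1 - J1 * Q0) * b)"
    unfolding w by (simp add: algebra_simps)
  moreover have "sens \<alpha> h g = I0 * P1 - I1 * P0" "sens \<alpha> k (opp g) = J0 * Q1 - J1 * Q0"
    by (simp_all add: sens_def defs)
  moreover have "cross \<alpha> h k ?e - 1
      = (edge_wt \<alpha> ?e * edge_wt ?hk ?e - edge_wt (insert h \<alpha>) ?e * edge_wt (insert k \<alpha>) ?e)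
        / (edge_wt (insert h \<alpha>) ?e * edge_wt (insert k \<alpha>) ?e)"
    by (simp add: cross_def diff_divide_distrib edge_wt_nz)
  ultimately show ?thesis unfolding 1 by simp
qed

lemma corr_no_edge:
  assumes "vt h \<noteq> vt k" and "\<And>g. g \<in> star (vt h) \<Longrightarrow> vt (opp g) \<noteq> vt k"
  shows "corr \<alpha> h k = 0"
proof -
  have "cross \<alpha> h k e = 1" if "e \<in> E" for e
  proof (rule ccontr)
    assume "cross \<alpha> h k e \<noteq> 1"
    from cross_nontrivial[OF this] assms(1) obtain x where "en e x = vt h" "en e (\<not> x) = vt k"
      by (metis (full_types))
    then show False using assms(2)[of "(e, x)"] that by (auto simp: star_def H_def)
  qed
  then show ?thesis by (simp add: corr_prod)
qed

lemma corr_between_le: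
  assumes "h \<notin> \<alpha>" "k \<notin> \<alpha>" "g \<in> H" "vt h = vt g" "vt k = vt (opp g)"
    and c: "c \<le> edge_wt (insert h \<alpha>) (fst g)" "0 < c" and d: "d \<le> edge_wt (insert k \<alpha>) (fst g)" "0 < d"
  shows "\<bar>corr \<alpha> h k\<bar> \<le> \<bar>sens \<alpha> h g\<bar> * \<bar>sens \<alpha> k (opp g)\<bar> / (4 * c * d)"
proof -
  let ?S = "\<bar>sens \<alpha> h g\<bar> * \<bar>sens \<alpha> k (opp g)\<bar>"
  let ?D = "edge_wt (insert h \<alpha>) (fst g) * edge_wt (insert k \<alpha>) (fst g)"
  have D: "c * d \<le> ?D" using c d by (intro mult_mono) auto
  have "0 < c * d" using c d by simp
  have "\<bar>corr \<alpha> h k\<bar> = ?S * b / ?D"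
    unfolding corr_between[OF assms(1-5)]
    using edge_wt_pos[of _ "fst g", THEN less_imp_le, THEN abs_of_nonneg] b_pos by (simp add: abs_mult)
  also have "\<dots> \<le> ?S * (1 / 4) / (c * d)"
    using mult_left_mono[OF b_le, of ?S]
    by (intro frac_le) (use D \<open>0 < c * d\<close> b_pos in auto)
  finally show ?thesis by (simp add: mult.assoc)
qed

text \<open>Either \<open>opp g\<close> is outside \<open>\<alpha>\<close>, and then it is the only \<open>k\<close> at the far end that affects the edge;
or it is in \<open>\<alpha>\<close>, and then each \<open>k\<close> affects the edge by at most \<open>q\<close>, which is compensated by the number of
half-edges at that vertex (\<open>card_star_q\<close>).\<close>

lemma corr_row_across_edge:
  assumes "\<alpha> \<subseteq> H" "h \<in> H - \<alpha>" "g \<in> star (vt h)"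
  shows "(\<Sum>k | k \<in> H - \<alpha> \<and> vt k = vt (opp g). \<bar>corr \<alpha> h k\<bar>)
      \<le> (if g = h then 1 / 4 else if \<alpha> \<inter> star (vt h) = {g} then q (vt h) / 3 else 0)"
proof -
  define w where "w = vt (opp g)"
  let ?K = "{k \<in> H - \<alpha>. vt k = w}"
  have K: "finite ?K" using finite_H by auto
  have gH: "g \<in> H" "vt h = vt g" using assms by (auto simp: star_def)
  have sens_k: "\<bar>sens \<alpha> k (opp g)\<bar>
      = (if opp g = k then 1 else if \<alpha> \<inter> star w = {opp g} then q w else 0)" if "k \<in> ?K" for k
    using sens_abs[of k \<alpha> "opp g"] that by (auto simp: w_def)
  have sens_h: "\<bar>sens \<alpha> h g\<bar> = (if g = h then 1 else if \<alpha> \<inter> star (vt h) = {g} then q (vt h) else 0)"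
    using sens_abs[of h \<alpha> g] assms gH by auto
  have bound: "\<bar>corr \<alpha> h k\<bar> \<le> \<bar>sens \<alpha> h g\<bar> * \<bar>sens \<alpha> k (opp g)\<bar> / (4 * c * d)"
    if "k \<in> ?K" "c \<le> edge_wt (insert h \<alpha>) (fst g)" "0 < c"
       "d \<le> edge_wt (insert k \<alpha>) (fst g)" "0 < d" for k c d
    using that assms gH by (intro corr_between_le) (auto simp: w_def)
  have "card ?K \<le> card (star w)" by (intro card_mono finite_star) (auto simp: star_def)
  then have Kq: "card ?K * q w \<le> 1 / 2"
    using card_star_q[of w] mult_right_mono[OF _ q_nonneg, of "card ?K" "card (star w)" w] by simp
  have "vt h \<noteq> w" using vt_opp[OF gH(1)] gH(2) by (simp add: w_def)
  have "(\<Sum>k\<in>?K. \<bar>corr \<alpha> h k\<bar>)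
      \<le> (if g = h then 1 / 4 else if \<alpha> \<inter> star (vt h) = {g} then q (vt h) / 3 else 0)"
  proof (cases "opp g \<in> \<alpha>")
    case False
    then have not_single: "\<alpha> \<inter> star w \<noteq> {opp g}" by blast
    have z: "\<bar>corr \<alpha> h k\<bar> \<le> 0" if k: "k \<in> ?K" "k \<noteq> opp g" for k
      using bound[OF k(1) edge_wt_ge _ edge_wt_ge] sens_k[OF k(1)] k(2) not_single by simp
    have "opp g \<in> ?K" using False gH by (auto simp: w_def H_def)
    then have "(\<Sum>k\<in>?K. \<bar>corr \<alpha> h k\<bar>) = (\<Sum>k\<in>{opp g}. \<bar>corr \<alpha> h k\<bar>)"
      using K z by (intro sum.mono_neutral_right) auto
    also have "\<dots> = \<bar>corr \<alpha> h (opp g)\<bar>" by simp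
    also have "\<dots> \<le> (if g = h then 1 / 4 else if \<alpha> \<inter> star (vt h) = {g} then q (vt h) / 3 else 0)"
    proof (cases "g = h")
      case True
      have "1 \<le> edge_wt (insert h \<alpha>) (fst g)" "1 \<le> edge_wt (insert (opp g) \<alpha>) (fst g)"
        using False True assms by (auto intro!: edge_wt_ge_1)
      from bound[OF \<open>opp g \<in> ?K\<close> this(1) _ this(2)] show ?thesis
        using sens_k[OF \<open>opp g \<in> ?K\<close>] sens_h True by simp
    next
      case gh: False
      have "opp g \<noteq> h" using \<open>vt h \<noteq> w\<close> by (auto simp: w_def)
      then have "1 \<le> edge_wt (insert h \<alpha>) (fst g)"
        using False by (intro edge_wt_ge_1) simp
      from bound[OF \<open>opp g \<in> ?K\<close> this _ edge_wt_ge] show ?thesis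
        using sens_k[OF \<open>opp g \<in> ?K\<close>] sens_h gh by (auto split: if_splits)
    qed
    finally show ?thesis .
  next
    case True
    then have opp_k: "\<bar>sens \<alpha> k (opp g)\<bar> \<le> q w" if "k \<in> ?K" for k
      using sens_k[OF that] that q_nonneg[of w] by auto
    define B where "B = (if g = h then 1 / 3 else if \<alpha> \<inter> star (vt h) = {g} then 4 / 9 * q (vt h) else 0)"
    have "\<bar>corr \<alpha> h k\<bar> \<le> B * q w" if k: "k \<in> ?K" for k
    proof (cases "g = h")
      case gh: True
      have "g \<notin> insert k \<alpha>" using gh assms k \<open>vt h \<noteq> w\<close> by auto
      then have "1 \<le> edge_wt (insert k \<alpha>) (fst g)" by (intro edge_wt_ge_1) auto
      from bound[OF k edge_wt_ge _ this] show ?thesis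
        using opp_k[OF k] sens_h gh by (simp add: B_def)
    next
      case gh: False
      from bound[OF k edge_wt_ge _ edge_wt_ge]
      have "\<bar>corr \<alpha> h k\<bar> \<le> \<bar>sens \<alpha> h g\<bar> * \<bar>sens \<alpha> k (opp g)\<bar> * (4 / 9)" by simp
      also have "\<dots> \<le> \<bar>sens \<alpha> h g\<bar> * q w * (4 / 9)"
        by (intro mult_right_mono mult_left_mono opp_k k) auto
      finally show ?thesis using sens_h gh by (simp add: B_def mult_ac split: if_splits)
    qed
    then have "(\<Sum>k\<in>?K. \<bar>corr \<alpha> h k\<bar>) \<le> B * (card ?K * q w)"
      using sum_bounded_above[of ?K "\<lambda>k. \<bar>corr \<alpha> h k\<bar>" "B * q w"] by (simp add: mult_ac)
    also have "\<dots> \<le> B * (1 / 2)" using Kq q_nonneg by (intro mult_left_mono) (auto simp: B_def)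
    also have "\<dots> \<le> (if g = h then 1 / 4 else if \<alpha> \<inter> star (vt h) = {g} then q (vt h) / 3 else 0)"
      using q_nonneg by (auto simp: B_def)
    finally show ?thesis .
  qed
  then show ?thesis by (simp add: w_def)
qed

text \<open>At most two edges at the vertex of \<open>h\<close> react to \<open>h\<close>: its own, and that of the half-edge whose loneliness \<open>h\<close> ends.\<close>

lemma corr_row_other_vertices:
  assumes "\<alpha> \<subseteq> H" "h \<in> H - \<alpha>"
  shows "(\<Sum>k | k \<in> H - \<alpha> \<and> vt k \<noteq> vt h. \<bar>corr \<alpha> h k\<bar>)
      \<le> 1 / 4 + (if card (\<alpha> \<inter> star (vt h)) = 1 then q (vt h) / 3 else 0)"
proof -
  let ?v = "vt h"
  let ?K = "{k \<in> H - \<alpha>. vt k \<noteq> ?v}"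
  have K: "finite ?K" using finite_H by auto
  have "(\<Sum>k\<in>?K. \<bar>corr \<alpha> h k\<bar>) \<le> (\<Sum>k\<in>?K. \<Sum>g\<in>star ?v. if vt k = vt (opp g) then \<bar>corr \<alpha> h k\<bar> else 0)"
  proof (intro sum_mono)
    fix k assume k: "k \<in> ?K"
    show "\<bar>corr \<alpha> h k\<bar> \<le> (\<Sum>g\<in>star ?v. if vt k = vt (opp g) then \<bar>corr \<alpha> h k\<bar> else 0)"
    proof (cases "\<exists>g\<in>star ?v. vt (opp g) = vt k")
      case True
      then obtain g where g: "g \<in> star ?v" "vt (opp g) = vt k" by auto
      have "(if vt k = vt (opp g) then \<bar>corr \<alpha> h k\<bar> else 0)
          \<le> (\<Sum>g\<in>star ?v. if vt k = vt (opp g) then \<bar>corr \<alpha> h k\<bar> else 0)"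
        by (rule member_le_sum) (use g finite_star in auto)
      then show ?thesis using g by simp
    next
      case False
      then have "corr \<alpha> h k = 0" using k by (intro corr_no_edge) auto
      then show ?thesis by (simp add: sum_nonneg)
    qed
  qed
  also have "\<dots> = (\<Sum>g\<in>star ?v. \<Sum>k\<in>?K. if vt k = vt (opp g) then \<bar>corr \<alpha> h k\<bar> else 0)"
    by (rule sum.swap)
  also have "\<dots> \<le> (\<Sum>g\<in>star ?v. if g = h then 1 / 4 else if \<alpha> \<inter> star ?v = {g} then q ?v / 3 else 0)"
  proof (intro sum_mono)
    fix g assume g: "g \<in> star ?v"
    have "(\<Sum>k\<in>?K. if vt k = vt (opp g) then \<bar>corr \<alpha> h k\<bar> else 0)
        = (\<Sum>k | k \<in> H - \<alpha> \<and> vt k = vt (opp g). \<bar>corr \<alpha> h k\<bar>)"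
      using K g vt_opp[of g] by (intro sum.mono_neutral_cong_right) (auto simp: star_def)
    also note corr_row_across_edge[OF assms g]
    finally show "(\<Sum>k\<in>?K. if vt k = vt (opp g) then \<bar>corr \<alpha> h k\<bar> else 0)
        \<le> (if g = h then 1 / 4 else if \<alpha> \<inter> star ?v = {g} then q ?v / 3 else 0)" .
  qed
  also have "\<dots> \<le> (\<Sum>g\<in>star ?v. (if g = h then 1 / 4 else 0) + (if \<alpha> \<inter> star ?v = {g} then q ?v / 3 else 0))"
    using q_nonneg by (intro sum_mono) auto
  also have "\<dots> = 1 / 4 + (\<Sum>g\<in>star ?v. if \<alpha> \<inter> star ?v = {g} then q ?v / 3 else 0)"
    using finite_star in_star assms by (simp add: sum.distrib)
  also have "(\<Sum>g\<in>star ?v. if \<alpha> \<inter> star ?v = {g} then q ?v / 3 else 0)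
      = (if card (\<alpha> \<inter> star ?v) = 1 then q ?v / 3 else 0)"
  proof (cases "card (\<alpha> \<inter> star ?v) = 1")
    case True
    then obtain g0 where g0: "\<alpha> \<inter> star ?v = {g0}" by (auto simp: card_1_singleton_iff)
    have "g0 \<in> star ?v" using g0 by blast
    then show ?thesis using finite_star g0 by (simp add: sum.delta')
  next
    case False
    then have "\<alpha> \<inter> star ?v \<noteq> {g}" for g by auto
    then show ?thesis using False by simp
  qed
  finally show ?thesis by simp
qed

text \<open>Adding half-edges at the vertex of \<open>g\<close> leaves the other end of the edge of \<open>g\<close> unchanged.\<close>

lemma edge_wt_star:
  assumes "g \<in> H" "vt h = vt g" "vt k = vt g" "\<beta> \<in> {\<alpha>, insert h \<alpha>, insert k \<alpha>, insert h (insert k \<alpha>)}"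
  shows "edge_wt \<beta> (fst g)
    = single \<beta> g * single \<alpha> (opp g) - of_bool (g \<in> \<beta>) * (of_bool (opp g \<in> \<alpha>) * b)"
proof -
  have ne: "vt h \<noteq> vt (opp g)" "vt k \<noteq> vt (opp g)" using vt_opp[OF assms(1)] assms(2,3) by simp_all
  have "single \<beta> (opp g) = single \<alpha> (opp g)"
    using assms(4) by (auto simp del: fst_conv snd_conv simp: single_insert_other[OF ne(1)] single_insert_other[OF ne(2)])
  moreover have "opp g \<in> \<beta> \<longleftrightarrow> opp g \<in> \<alpha>"
    using assms(4) ne by auto
  ultimately show ?thesis by (simp add: edge_wt_half mult.assoc)
qed

lemma prod_cross_star:
  assumes "vt k = vt h"
  shows "(\<Prod>e\<in>E. cross \<alpha> h k e) = (\<Prod>g\<in>star (vt h). cross \<alpha> h k (fst g))"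
proof -
  have inj: "inj_on fst (star (vt h))"
  proof (rule inj_onI)
    fix g g' assume g: "g \<in> star (vt h)" "g' \<in> star (vt h)" "fst g = fst g'"
    have "snd g = snd g'"
    proof (rule ccontr)
      assume "snd g \<noteq> snd g'"
      then have "vt g' = en (fst g) (\<not> snd g)" using g(3) by auto
      then show False using vt_opp[of g] g(1,2) by (simp add: star_def)
    qed
    then show "g = g'" using g(3) by (simp add: prod_eq_iff)
  qed
  have "(\<Prod>e\<in>E. cross \<alpha> h k e) = (\<Prod>e\<in>fst ` star (vt h). cross \<alpha> h k e)"
  proof (rule prod.mono_neutral_right[OF fin_E])
    show "fst ` star (vt h) \<subseteq> E" by (auto simp: star_def H_def)
    show "\<forall>e\<in>E - fst ` star (vt h). cross \<alpha> h k e = 1"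
    proof (rule ballI, rule ccontr)
      fix e assume e: "e \<in> E - fst ` star (vt h)" "cross \<alpha> h k e \<noteq> 1"
      then obtain x where "en e x = vt h" using cross_nontrivial[OF e(2)] by metis
      then have "(e, x) \<in> star (vt h)" using e(1) by (simp add: star_def H_def)
      then show False using e(1) by force
    qed
  qed
  then show ?thesis by (simp add: prod.reindex[OF inj])
qed

lemma opp_wt:
  "1 \<le> single \<alpha> (opp g)" "0 \<le> of_bool (opp g \<in> \<alpha>) * b" "of_bool (opp g \<in> \<alpha>) * b \<le> 1 / 4"
  using b_pos b_le by (simp_all add: single_ge of_bool_def)

context
  fixes \<alpha> h k
  assumes hk: "\<alpha> \<subseteq> H" "h \<in> H - \<alpha>" "k \<in> H - \<alpha>" "h \<noteq> k" "vt k = vt h"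
begin

text \<open>If \<open>\<alpha>\<close> already meets the star of the vertex, only a lonely half-edge reacts to both \<open>h\<close> and \<open>k\<close>: the first of the
two to be added ends its loneliness, the second has no further effect.\<close>

lemma corr_same_vertex_crowded:
  assumes ne: "\<alpha> \<inter> star (vt h) \<noteq> {}"
  shows "\<bar>corr \<alpha> h k\<bar> \<le> (if card (\<alpha> \<inter> star (vt h)) = 1 then 4 / 3 * q (vt h) else 0)"
proof -
  define Y where "Y g = ((1 + q (vt h)) * single \<alpha> (opp g) - of_bool (opp g \<in> \<alpha>) * b)
      / (single \<alpha> (opp g) - of_bool (opp g \<in> \<alpha>) * b)" for g
  have "cross \<alpha> h k (fst g) = (if \<alpha> \<inter> star (vt h) = {g} then Y g else 1)" if g: "g \<in> star (vt h)" for g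
  proof -
    have gH: "g \<in> H" "vt h = vt g" "vt k = vt g" using g hk by (auto simp: star_def)
    note w = edge_wt_star[OF this, of _ \<alpha>]
    define p i where "p = single \<alpha> (opp g)" and "i = of_bool (opp g \<in> \<alpha>) * b"
    have pi: "1 \<le> p" "0 \<le> i" "i \<le> 1 / 4" unfolding p_def i_def by (rule opp_wt)+
    have one: "single (insert h \<alpha>) g = 1" "single (insert k \<alpha>) g = 1"
        "single (insert h (insert k \<alpha>)) g = 1"
    proof -
      have "\<alpha> \<inter> star (vt k) \<noteq> {}" "insert k \<alpha> \<inter> star (vt h) \<noteq> {}" "vt g = vt k" "h \<notin> insert k \<alpha>"
        using ne hk gH by (simp_all add: Int_insert_left)
      note ne' = this
      show "single (insert h \<alpha>) g = 1"
        by (rule single_insert_crowded) (use hk gH ne in simp_all)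
      show "single (insert k \<alpha>) g = 1"
        by (rule single_insert_crowded[OF _ _ ne'(1,3)]) (use hk in simp_all)
      show "single (insert h (insert k \<alpha>)) g = 1"
        by (rule single_insert_crowded[OF _ ne'(4,2)]) (use hk gH in simp_all)
    qed
    have W: "edge_wt (insert h \<alpha>) (fst g) = p - of_bool (g \<in> insert h \<alpha>) * i"
      "edge_wt (insert k \<alpha>) (fst g) = p - of_bool (g \<in> insert k \<alpha>) * i"
      "edge_wt (insert h (insert k \<alpha>)) (fst g) = p - of_bool (g \<in> insert h (insert k \<alpha>)) * i"
      "edge_wt \<alpha> (fst g) = single \<alpha> g * p - of_bool (g \<in> \<alpha>) * i"
      by (simp_all only: w insertI1 insertI2 singletonI one p_def i_def mult_1)
    show ?thesis
    proof (cases "\<alpha> \<inter> star (vt h) = {g}")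
      case True
      then have ga: "g \<in> \<alpha>" by auto
      have "single \<alpha> g = 1 + q (vt h)" using True gH by (simp add: single_def)
      then have "cross \<alpha> h k (fst g) = ((1 + q (vt h)) * p - i) * (p - i) / ((p - i) * (p - i))"
        unfolding cross_def W using ga by simp
      also have "\<dots> = Y g" using pi by (simp add: Y_def p_def i_def)
      finally show ?thesis using True by simp
    next
      case False
      then have "single \<alpha> g = 1" using gH by (simp add: single_def)
      moreover have "p - i \<noteq> 0" "p \<noteq> 0" using pi by auto
      ultimately show ?thesis unfolding cross_def W using False hk by auto
    qed
  qed
  then have "corr \<alpha> h k = (\<Prod>g\<in>star (vt h). if \<alpha> \<inter> star (vt h) = {g} then Y g else 1) - 1"
    unfolding corr_prod prod_cross_star[OF hk(5)] by (simp cong: prod.cong)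
  also have "\<bar>\<dots>\<bar> \<le> (if card (\<alpha> \<inter> star (vt h)) = 1 then 4 / 3 * q (vt h) else 0)"
  proof (cases "card (\<alpha> \<inter> star (vt h)) = 1")
    case True
    then obtain g where g: "\<alpha> \<inter> star (vt h) = {g}" by (auto simp: card_1_singleton_iff)
    then have "g \<in> star (vt h)" by blast
    then have "(\<Prod>g\<in>star (vt h). if \<alpha> \<inter> star (vt h) = {g} then Y g else 1) = Y g"
      using g finite_star by (simp add: prod.delta')
    moreover have "Y g - 1 = q (vt h) * single \<alpha> (opp g) / (single \<alpha> (opp g) - of_bool (opp g \<in> \<alpha>) * b)"
      using opp_wt[where \<alpha> = \<alpha> and g = g] by (simp add: Y_def field_simps)
    moreover have "\<bar>\<dots>\<bar> \<le> 4 / 3 * q (vt h)"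
    proof -
      define p i where "p = single \<alpha> (opp g)" and "i = of_bool (opp g \<in> \<alpha>) * b"
      have pi: "1 \<le> p" "0 \<le> i" "i \<le> 1 / 4" unfolding p_def i_def by (rule opp_wt)+
      have "p / (p - i) \<le> 4 / 3" using pi by (simp add: divide_le_eq)
      then have "q (vt h) * (p / (p - i)) \<le> q (vt h) * (4 / 3)"
        by (intro mult_left_mono q_nonneg)
      then show ?thesis using pi q_nonneg[of "vt h"] unfolding p_def i_def by (simp add: abs_of_nonneg)
    qed
    ultimately show ?thesis using True by simp
  next
    case False
    then have "\<alpha> \<inter> star (vt h) \<noteq> {g}" for g by auto
    then show ?thesis using False by simp
  qed
  finally show ?thesis .
qed

text \<open>If \<open>\<alpha>\<close> misses the star of the vertex, the first half-edge to be added is lonely and the second ends this. The correlation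
is \<open>r h * r k - 1\<close> with factors between \<open>lo\<close> and \<open>hi\<close>, where \<open>hi = 1/(1 + q)\<close> is attained if the opposite half is absent.
The absolute values of the correlations at this vertex can add up to almost 1 or more, which leaves no room for those with other
vertices; but they are nearly equal to the negative constant \<open>hi\<^sup>2 - 1\<close>.\<close>

lemma corr_same_vertex_empty:
  assumes empty: "\<alpha> \<inter> star (vt h) = {}"
  shows "\<bar>corr \<alpha> h k + (1 - 1 / (1 + q (vt h))\<^sup>2)\<bar> \<le> 2 / 3 * q (vt h)"
proof -
  define u where "u = q (vt h)"
  have u: "0 \<le> u" using q_nonneg by (simp add: u_def)
  define r where "r g = (single \<alpha> (opp g) - of_bool (opp g \<in> \<alpha>) * b)
      / ((1 + u) * single \<alpha> (opp g) - of_bool (opp g \<in> \<alpha>) * b)" for g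
  have "cross \<alpha> h k (fst g) = (if g \<in> {h, k} then r g else 1)" if g: "g \<in> star (vt h)" for g
  proof -
    have gH: "g \<in> H" "vt h = vt g" "vt k = vt g" using g hk by (auto simp: star_def)
    note w = edge_wt_star[OF this, of _ \<alpha>]
    define p i where "p = single \<alpha> (opp g)" and "i = of_bool (opp g \<in> \<alpha>) * b"
    have pi: "1 \<le> p" "0 \<le> i" "i \<le> 1 / 4" unfolding p_def i_def by (rule opp_wt)+
    have ga: "g \<notin> \<alpha>" using g empty by auto
    have s: "single \<alpha> g = 1" "single (insert h \<alpha>) g = (if g = h then 1 + u else 1)"
      "single (insert k \<alpha>) g = (if g = k then 1 + u else 1)"
    proof -
      show "single \<alpha> g = 1" by (rule single_notin[OF ga])
      show "single (insert h \<alpha>) g = (if g = h then 1 + u else 1)"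
        unfolding u_def by (rule single_insert_first) (use hk gH empty in simp_all)
      have "single (insert k \<alpha>) g = (if g = k then 1 + q (vt k) else 1)"
        by (rule single_insert_first) (use hk gH empty in simp_all)
      then show "single (insert k \<alpha>) g = (if g = k then 1 + u else 1)"
        unfolding u_def hk(5) .
    qed
    have "k \<in> star (vt h)" using hk in_star[of k] by simp
    then have "insert k \<alpha> \<inter> star (vt h) \<noteq> {}" by blast
    then have s': "single (insert h (insert k \<alpha>)) g = 1"
      by (rule single_insert_crowded[rotated 2]) (use hk gH in simp_all)
    have W: "edge_wt \<alpha> (fst g) = p"
      "edge_wt (insert h \<alpha>) (fst g) = (if g = h then (1 + u) * p - i else p)"
      "edge_wt (insert k \<alpha>) (fst g) = (if g = k then (1 + u) * p - i else p)"
      "edge_wt (insert h (insert k \<alpha>)) (fst g) = (if g \<in> {h, k} then p - i else p)"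
      using ga by (simp_all add: w s s' p_def i_def)
    have "p \<noteq> 0" using pi by auto
    then show ?thesis unfolding cross_def W r_def p_def[symmetric] i_def[symmetric] using hk by auto
  qed
  then have "corr \<alpha> h k = (\<Prod>g\<in>star (vt h). if g \<in> {h, k} then r g else 1) - 1"
    unfolding corr_prod prod_cross_star[OF hk(5)] by (simp cong: prod.cong)
  also have "(\<Prod>g\<in>star (vt h). if g \<in> {h, k} then r g else 1) = (\<Prod>g\<in>{h, k}. r g)"
    using finite_star hk in_star[of h] in_star[of k]
    by (intro prod.mono_neutral_cong_right) auto
  also have "\<dots> = r h * r k" using hk by simp
  finally have 1: "corr \<alpha> h k = r h * r k - 1" .
  define lo hi where "lo = (3/4) / (3/4 + u)" and "hi = 1 / (1 + u)"
  have r: "lo \<le> r g" "r g \<le> hi" for g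
  proof -
    define p i where "p = single \<alpha> (opp g)" and "i = of_bool (opp g \<in> \<alpha>) * b"
    have pi: "1 \<le> p" "0 \<le> i" "i \<le> 1 / 4" unfolding p_def i_def by (rule opp_wt)+
    have "p \<le> (1 + u) * p" using u pi by (simp add: algebra_simps)
    then have pos: "0 < (1 + u) * p - i" using pi by linarith
    have "u * i \<le> u * (p / 4)" using u pi by (intro mult_left_mono) auto
    then have "(3/4) * ((1 + u) * p - i) \<le> (p - i) * (3/4 + u)" by (simp add: field_simps)
    then have "(3/4) * ((1 + u) * p - i) / (3/4 + u) \<le> p - i"
      using u by (intro mult_imp_div_pos_le) auto
    then have "lo * ((1 + u) * p - i) \<le> p - i" by (simp add: lo_def)
    then show "lo \<le> r g" unfolding r_def p_def[symmetric] i_def[symmetric]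
      by (rule mult_imp_le_div_pos[OF pos])
    have "0 \<le> u * i" using u pi by simp
    then have "(p - i) * (1 + u) \<le> (1 + u) * p - i" by (simp add: algebra_simps)
    then have "p - i \<le> hi * ((1 + u) * p - i)" using u by (simp add: hi_def pos_le_divide_eq)
    then show "r g \<le> hi" unfolding r_def p_def[symmetric] i_def[symmetric]
      by (rule mult_imp_div_pos_le[OF pos])
  qed
  have lo: "0 \<le> lo" "lo \<le> hi" using r[of h] u by (auto simp: lo_def)
  have "hi \<le> 1" using u by (simp add: hi_def)
  have "hi - lo = (u / 4) / ((1 + u) * (3/4 + u))"
    using u by (simp add: hi_def lo_def field_simps)
  also have "\<dots> \<le> (u / 4) / (1 * (3/4))"
    using u by (intro divide_left_mono mult_mono) auto
  finally have "hi - lo \<le> u / 3" by simp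
  then have "(hi - lo) * (hi + lo) \<le> u / 3 * 2"
    using lo \<open>hi \<le> 1\<close> u by (intro mult_mono) auto
  then have "hi * hi - lo * lo \<le> 2 / 3 * u" by (simp add: algebra_simps)
  moreover have "lo * lo \<le> r h * r k" "r h * r k \<le> hi * hi"
    using r[of h] r[of k] lo by (auto intro!: mult_mono)
  moreover have "1 / (1 + u)\<^sup>2 = hi * hi" by (simp add: hi_def power2_eq_square)
  ultimately show ?thesis unfolding 1 u_def[symmetric] by simp
qed

end

text \<open>The number \<open>\<kappa>\<close> is the constant that \<open>quadratic_form_row_bound\<close> splits off. The bound 3/4 leaves
room for the 1/4 that the half-edges at other vertices may contribute.\<close>

lemma corr_row_same_vertex:
  assumes "\<alpha> \<subseteq> H" "h \<in> H - \<alpha>"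
  defines "\<kappa> \<equiv> if \<alpha> \<inter> star (vt h) = {} then 1 - 1 / (1 + q (vt h))\<^sup>2 else 0"
  shows "\<kappa> + (\<Sum>k | k \<in> H - \<alpha> - {h} \<and> vt k = vt h. \<bar>corr \<alpha> h k + \<kappa>\<bar>)
      \<le> 3 / 4 - (if card (\<alpha> \<inter> star (vt h)) = 1 then q (vt h) / 3 else 0)"
proof -
  let ?K = "{k \<in> H - \<alpha> - {h}. vt k = vt h}" and ?d = "real (card (star (vt h)))"
  define u where "u = q (vt h)"
  have u: "0 \<le> u" "u \<le> 1 / 2" "?d * u \<le> 1 / 2"
    using q_nonneg q_le_half[of h] card_star_q[of "vt h"] assms(2) by (auto simp: u_def)
  have d1: "1 \<le> ?d" using card_star_pos[of h] assms(2) by simp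
  have "?K \<subseteq> star (vt h) - {h}" by (auto simp: star_def)
  then have "card ?K \<le> card (star (vt h) - {h})" by (intro card_mono) (auto simp: finite_star)
  also have "\<dots> = card (star (vt h)) - 1" using in_star[of h] assms(2) by (simp add: finite_star)
  finally have K: "real (card ?K) \<le> ?d - 1" using d1 by (simp add: of_nat_diff)
  have sum: "(\<Sum>k\<in>?K. \<bar>corr \<alpha> h k + \<kappa>\<bar>) \<le> (?d - 1) * B"
    if "0 \<le> B" "\<And>k. k \<in> ?K \<Longrightarrow> \<bar>corr \<alpha> h k + \<kappa>\<bar> \<le> B" for B
  proof -
    have "(\<Sum>k\<in>?K. \<bar>corr \<alpha> h k + \<kappa>\<bar>) \<le> real (card ?K) * B"
      by (rule sum_bounded_above) (rule that(2))
    also have "\<dots> \<le> (?d - 1) * B" using K that(1) by (rule mult_right_mono)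
    finally show ?thesis .
  qed
  show ?thesis
  proof (cases "\<alpha> \<inter> star (vt h) = {}")
    case True
    have "(\<Sum>k\<in>?K. \<bar>corr \<alpha> h k + \<kappa>\<bar>) \<le> (?d - 1) * (2 / 3 * u)"
      using corr_same_vertex_empty[OF assms(1,2), folded u_def] True u
      by (intro sum) (auto simp: \<kappa>_def u_def)
    also have "\<dots> \<le> 1 / 3 - 2 / 3 * u" using u by (simp add: algebra_simps)
    finally have 1: "(\<Sum>k\<in>?K. \<bar>corr \<alpha> h k + \<kappa>\<bar>) \<le> 1 / 3 - 2 / 3 * u" .
    \<comment> \<open>5/12 is what remains of 3/4 after 1/3; the term \<open>2/3 u\<close> was gained because \<open>h\<close> itself is excluded from its row.\<close>
    have "1 - 1 / (1 + u)\<^sup>2 \<le> 5 / 12 + 2 / 3 * u"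
    proof -
      have "0 \<le> u * u" "0 \<le> u * (u * u)" using u by auto
      moreover have "1 + 2 / 3 * u * ((1 + u) * (1 + u)) - 7 / 12 * ((1 + u) * (1 + u))
          = 5 / 12 - u / 2 + 3 / 4 * (u * u) + 2 / 3 * (u * (u * u))"
        by (simp add: field_simps)
      ultimately have "7 / 12 * ((1 + u) * (1 + u)) \<le> 1 + 2 / 3 * u * ((1 + u) * (1 + u))"
        using u by linarith
      then have "(7 / 12 - 2 / 3 * u) * (1 + u)\<^sup>2 \<le> 1"
        by (simp add: power2_eq_square algebra_simps)
      then have "7 / 12 - 2 / 3 * u \<le> 1 / (1 + u)\<^sup>2"
        using u by (subst pos_le_divide_eq) auto
      then show ?thesis by simp
    qed
    then show ?thesis using 1 True by (simp add: \<kappa>_def flip: u_def)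
  next
    case False
    define c where "c = (if card (\<alpha> \<inter> star (vt h)) = 1 then u else 0)"
    have c: "0 \<le> c" "?d * c \<le> 1 / 2" using u by (auto simp: c_def)
    have "(\<Sum>k\<in>?K. \<bar>corr \<alpha> h k + \<kappa>\<bar>) \<le> (?d - 1) * (4 / 3 * c)"
      using corr_same_vertex_crowded[OF assms(1,2) _ _ _ False, folded u_def] False u
      by (intro sum) (auto simp: \<kappa>_def c_def)
    also have "\<dots> \<le> 3 / 4 - c / 3" using c by (simp add: algebra_simps)
    finally show ?thesis using False by (simp add: \<kappa>_def c_def flip: u_def split: if_splits)
  qed
qed

text \<open>The rows of the correlation matrix are bounded by \<open>corr_row_same_vertex\<close> and \<open>corr_row_other_vertices\<close>, whose
bounds add up to 1 in every case.\<close>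

theorem half_edge_local_condition:
  assumes "\<alpha> \<subseteq> H"
  shows "(\<Sum>h\<in>H - \<alpha>. \<Sum>k\<in>H - \<alpha> - {h}.
            (F \<alpha> * F (insert h (insert k \<alpha>)) - F (insert h \<alpha>) * F (insert k \<alpha>)) * z h * z k)
          \<le> (\<Sum>h\<in>H - \<alpha>. (F (insert h \<alpha>) * z h)\<^sup>2)"
proof -
  let ?U = "H - \<alpha>" and ?y = "\<lambda>h. F (insert h \<alpha>) * z h"
  let ?\<kappa> = "\<lambda>v. if \<alpha> \<inter> star v = {} then 1 - 1 / (1 + q v)\<^sup>2 else 0"
  have U: "finite ?U" using finite_H by simp
  have eq: "(F \<alpha> * F (insert h (insert k \<alpha>)) - F (insert h \<alpha>) * F (insert k \<alpha>)) * z h * z k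
      = corr \<alpha> h k * ?y h * ?y k" for h k
    using F_pos[of "insert h \<alpha>"] F_pos[of "insert k \<alpha>"] by (simp add: corr_def field_simps)
  show ?thesis
    unfolding eq
  proof (rule quadratic_form_row_bound[OF U corr_sym, where vt = "\<lambda>h. vt h" and \<kappa> = ?\<kappa>])
    show "0 \<le> ?\<kappa> v" for v
    proof -
      have "1\<^sup>2 \<le> (1 + q v)\<^sup>2" using q_nonneg by (intro power_mono) auto
      then show ?thesis by (auto simp: divide_le_eq_1)
    qed
    fix h assume h: "h \<in> ?U"
    let ?f = "\<lambda>k. \<bar>corr \<alpha> h k + (if vt k = vt h then ?\<kappa> (vt h) else 0)\<bar>"
    have "(\<Sum>k\<in>?U - {h}. ?f k) = (\<Sum>k | k \<in> ?U - {h} \<and> vt k = vt h. ?f k) + (\<Sum>k | k \<in> ?U - {h} \<and> vt k \<noteq> vt h. ?f k)"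
      using finite_H by (subst sum.union_disjoint[symmetric]) (auto intro!: sum.cong)
    also have "(\<Sum>k | k \<in> ?U - {h} \<and> vt k = vt h. ?f k)
        = (\<Sum>k | k \<in> ?U - {h} \<and> vt k = vt h. \<bar>corr \<alpha> h k + ?\<kappa> (vt h)\<bar>)"
      by (intro sum.cong) auto
    also have "(\<Sum>k | k \<in> ?U - {h} \<and> vt k \<noteq> vt h. ?f k)
        = (\<Sum>k | k \<in> ?U \<and> vt k \<noteq> vt h. \<bar>corr \<alpha> h k\<bar>)"
      by (intro sum.cong) auto
    finally show "?\<kappa> (vt h) + (\<Sum>k\<in>?U - {h}. ?f k) \<le> 1"
      using corr_row_same_vertex[OF assms h] corr_row_other_vertices[OF assms h] by linarith
  qed
qed

end

section \<open>Sums over the subsets of a union of blocks, and the polarisation identity\<close>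

lemma sum_Pow_two:
  fixes g :: "'a set \<Rightarrow> 'a set \<Rightarrow> real"
  assumes "Y \<inter> Z = {}"
  shows "(\<Sum>A\<in>Pow (Y \<union> Z). g (A \<inter> Y) (A \<inter> Z)) = (\<Sum>C\<in>Pow Y. \<Sum>D\<in>Pow Z. g C D)"
proof -
  have "(\<Sum>C\<in>Pow Y. \<Sum>D\<in>Pow Z. g C D) = (\<Sum>(C, D)\<in>Pow Y \<times> Pow Z. g C D)"
    by (rule sum.cartesian_product)
  also have "\<dots> = (\<Sum>A\<in>Pow (Y \<union> Z). g (A \<inter> Y) (A \<inter> Z))"
    using assms
    by (intro sum.reindex_bij_witness[of _ "\<lambda>A. (A \<inter> Y, A \<inter> Z)" "\<lambda>(C, D). C \<union> D"]) 
       (auto intro!: arg_cong2[of _ _ _ _ g])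
  finally show ?thesis by simp
qed

lemma sum_Pow_blocks:
  fixes f :: "'i \<Rightarrow> 'a set \<Rightarrow> real"
  assumes "finite I" "disjoint_family_on B I"
  shows "(\<Sum>A\<in>Pow (\<Union>i\<in>I. B i). \<Prod>i\<in>I. f i (A \<inter> B i)) = (\<Prod>i\<in>I. \<Sum>C\<in>Pow (B i). f i C)"
  using assms
proof (induction I)
  case empty
  then show ?case by simp
next
  case (insert i I)
  let ?U = "\<Union>j\<in>I. B j"
  have disj: "disjoint_family_on B I" "B i \<inter> ?U = {}"
    using insert.prems insert.hyps by (auto simp: disjoint_family_on_def)
  have "(\<Sum>A\<in>Pow (\<Union>j\<in>insert i I. B j). \<Prod>j\<in>insert i I. f j (A \<inter> B j))
      = (\<Sum>A\<in>Pow (B i \<union> ?U). f i (A \<inter> B i) * (\<Prod>j\<in>I. f j (A \<inter> ?U \<inter> B j)))"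
    using insert.hyps by (intro sum.cong) (auto intro!: prod.cong arg_cong[of _ _ "f _"])
  also have "\<dots> = (\<Sum>C\<in>Pow (B i). \<Sum>D\<in>Pow ?U. f i C * (\<Prod>j\<in>I. f j (D \<inter> B j)))"
    by (rule sum_Pow_two[OF disj(2)])
  also have "\<dots> = (\<Sum>C\<in>Pow (B i). f i C) * (\<Sum>D\<in>Pow ?U. \<Prod>j\<in>I. f j (D \<inter> B j))"
    by (simp add: sum_product)
  finally show ?case using insert.IH[OF disj(1)] insert.hyps by simp
qed

lemma power_card_blocks:
  assumes "finite I" "disjoint_family_on B I" "finite A" "A \<subseteq> (\<Union>i\<in>I. B i)"
  shows "(c::real) ^ card A = (\<Prod>i\<in>I. c ^ card (A \<inter> B i))"
proof -
  have "A = (\<Union>i\<in>I. A \<inter> B i)" using assms(4) by auto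
  then have "card A = card (\<Union>i\<in>I. A \<inter> B i)" by simp
  also have "\<dots> = (\<Sum>i\<in>I. card (A \<inter> B i))"
    using assms by (intro card_UN_disjoint) (auto simp: disjoint_family_on_def)
  finally show ?thesis by (simp add: power_sum)
qed

text \<open>The generating function by size, for a condition that can be tested on each block separately, is the
product of the generating functions of the blocks.\<close>

lemma weighted_sum_Pow_blocks:
  fixes f :: "'i \<Rightarrow> 'a set \<Rightarrow> real"
  assumes "finite I" "disjoint_family_on B I" "\<And>i. i \<in> I \<Longrightarrow> finite (B i)"
  shows "(\<Sum>A\<in>Pow (\<Union>i\<in>I. B i). c ^ card A * (\<Prod>i\<in>I. f i (A \<inter> B i)))
       = (\<Prod>i\<in>I. \<Sum>C\<in>Pow (B i). c ^ card C * f i C)"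
proof -
  have "finite (\<Union>i\<in>I. B i)" using assms by auto
  then have "(\<Sum>A\<in>Pow (\<Union>i\<in>I. B i). c ^ card A * (\<Prod>i\<in>I. f i (A \<inter> B i)))
      = (\<Sum>A\<in>Pow (\<Union>i\<in>I. B i). \<Prod>i\<in>I. c ^ card (A \<inter> B i) * f i (A \<inter> B i))"
    using power_card_blocks[OF assms(1,2), of _ c]
    by (intro sum.cong refl) (simp add: prod.distrib finite_subset)
  then show ?thesis
    using sum_Pow_blocks[OF assms(1,2), of "\<lambda>i C. c ^ card C * f i C"] by simp
qed

lemma weighted_sum_Pow_two:
  fixes f g :: "'a set \<Rightarrow> real"
  assumes "Y \<inter> Z = {}" "finite Y" "finite Z"
  shows "(\<Sum>A\<in>Pow (Y \<union> Z). c ^ card A * (f (A \<inter> Y) * g (A \<inter> Z)))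
       = (\<Sum>C\<in>Pow Y. c ^ card C * f C) * (\<Sum>D\<in>Pow Z. c ^ card D * g D)"
proof -
  have "(\<Sum>A\<in>Pow (Y \<union> Z). c ^ card A * (f (A \<inter> Y) * g (A \<inter> Z)))
      = (\<Sum>A\<in>Pow (Y \<union> Z). c ^ card (A \<inter> Y) * f (A \<inter> Y) * (c ^ card (A \<inter> Z) * g (A \<inter> Z)))"
  proof (intro sum.cong refl)
    fix A assume A: "A \<in> Pow (Y \<union> Z)"
    then have "card A = card (A \<inter> Y) + card (A \<inter> Z)"
      using assms by (subst card_Un_disjoint[symmetric]) (auto intro: arg_cong[of _ _ card])
    then show "c ^ card A * (f (A \<inter> Y) * g (A \<inter> Z))
        = c ^ card (A \<inter> Y) * f (A \<inter> Y) * (c ^ card (A \<inter> Z) * g (A \<inter> Z))"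
      by (simp add: power_add)
  qed
  also have "\<dots> = (\<Sum>C\<in>Pow Y. c ^ card C * f C) * (\<Sum>D\<in>Pow Z. c ^ card D * g D)"
    using sum_Pow_two[OF assms(1), of "\<lambda>C D. c ^ card C * f C * (c ^ card D * g D)"]
    by (simp add: sum_product)
  finally show ?thesis .
qed

lemma Pow_Int_doubleton:
  "Pow ({h, k} \<inter> L) = (if h \<in> L then if k \<in> L then {{}, {h}, {k}, {h, k}} else {{}, {h}}
     else if k \<in> L then {{}, {k}} else {{}})"
  by (auto simp: Pow_insert)

text \<open>The factor of an edge in \<open>Z\<close>; the arguments \<open>\<sigma>\<close> and \<open>\<tau>\<close> tell whether its ends are chosen.\<close>

definition pair_wt :: "real \<Rightarrow> real \<Rightarrow> bool \<Rightarrow> bool \<Rightarrow> real" where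
  "pair_wt a x \<sigma> \<tau> = (if \<sigma> \<and> \<tau> then 1 else if \<sigma> \<or> \<tau> then 1 + a * x else (1 + a * x)\<^sup>2 - x\<^sup>2)"

context half_edges
begin

definition lonely :: "('e \<times> bool) set \<Rightarrow> ('e \<times> bool) set" where
  "lonely \<alpha> = {h \<in> H. \<alpha> \<inter> star (vt h) = {h}}"

definition unchosen_penalty :: "('e \<times> bool) set \<Rightarrow> 'v set \<Rightarrow> 'e \<Rightarrow> real" where
  "unchosen_penalty \<alpha> S e = (if (e, False) \<in> \<alpha> \<and> (e, True) \<in> \<alpha> \<and> en e False \<notin> S \<and> en e True \<notin> S then 1 - b else 1)"

lemma lonely_eq: "h \<in> lonely \<alpha> \<Longrightarrow> k \<in> H \<Longrightarrow> k \<in> \<alpha> \<Longrightarrow> vt k = vt h \<Longrightarrow> k = h"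
  using in_star[of k] by (auto simp: lonely_def)

lemma lonely_subset: "lonely \<alpha> \<subseteq> \<alpha>" "lonely \<alpha> \<subseteq> H" by (auto simp: lonely_def)

lemma star_disjoint: "disjoint_family_on star S"
  by (auto simp: disjoint_family_on_def star_def)

lemma edge_wt_lonely:
  assumes "e \<in> E"
  shows "edge_wt \<alpha> e = (\<Sum>C\<in>Pow ({(e, False), (e, True)} \<inter> lonely \<alpha>).
     (\<Prod>h\<in>C. q (vt h)) * (if (e, False) \<in> \<alpha> \<and> (e, True) \<in> \<alpha> \<and> C = {} then 1 - b else 1))"
proof -
  have "single \<alpha> (e, x) = (if (e, x) \<in> lonely \<alpha> then 1 + q (en e x) else 1)" for x
    using assms by (simp add: single_def lonely_def H_def)
  moreover have "(e, x) \<in> \<alpha>" if "(e, x) \<in> lonely \<alpha>" for x using that lonely_subset by auto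
  ultimately show ?thesis
    unfolding edge_wt_def Pow_Int_doubleton
    by (cases "(e, False) \<in> lonely \<alpha>"; cases "(e, True) \<in> lonely \<alpha>") (auto simp: algebra_simps)
qed

text \<open>Lonely half-edges correspond to the vertices at which they lie, so the sum over vertex sets is a sum over
sets of lonely half-edges. This sum factorises over the edges, since the correction of an edge
depends only on its own halves.\<close>

lemma F_eq_sum_vertex_sets:
  assumes "\<alpha> \<subseteq> H"
  shows "F \<alpha> = (\<Sum>S\<in>Pow (vt ` lonely \<alpha>). (\<Prod>v\<in>S. q v) * (\<Prod>e\<in>E. unchosen_penalty \<alpha> S e))"
proof -
  let ?B = "\<lambda>e. {(e, False), (e, True)} \<inter> lonely \<alpha>"
  have inj: "inj_on (\<lambda>h. vt h) (lonely \<alpha>)"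
    by (rule inj_onI) (use lonely_eq lonely_subset in blast)
  have bij: "bij_betw (image (\<lambda>h. vt h)) (Pow (lonely \<alpha>)) (Pow (vt ` lonely \<alpha>))"
    by (intro bij_betw_Pow inj_on_imp_bij_betw inj)
  have U: "(\<Union>e\<in>E. ?B e) = lonely \<alpha>"
    using lonely_subset(2)[of \<alpha>] by (fastforce simp: H_def)
  have disj: "disjoint_family_on ?B E" by (auto simp: disjoint_family_on_def)
  have "(\<Sum>S\<in>Pow (vt ` lonely \<alpha>). (\<Prod>v\<in>S. q v) * (\<Prod>e\<in>E. unchosen_penalty \<alpha> S e))
      = (\<Sum>L\<in>Pow (lonely \<alpha>). (\<Prod>v\<in>vt ` L. q v) * (\<Prod>e\<in>E. unchosen_penalty \<alpha> (vt ` L) e))"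
    by (rule sum.reindex_bij_betw[OF bij, symmetric])
  also have "\<dots> = (\<Sum>L\<in>Pow (\<Union>e\<in>E. ?B e). \<Prod>e\<in>E. (\<Prod>h\<in>L \<inter> ?B e. q (vt h)) *
      (if (e, False) \<in> \<alpha> \<and> (e, True) \<in> \<alpha> \<and> L \<inter> ?B e = {} then 1 - b else 1))"
    unfolding U
  proof (intro sum.cong refl)
    fix L assume L: "L \<in> Pow (lonely \<alpha>)"
    have fin: "finite L" using L lonely_subset finite_H by (meson PowD finite_subset)
    have "(\<Prod>v\<in>vt ` L. q v) = (\<Prod>h\<in>L. q (vt h))"
      using inj L by (subst prod.reindex) (auto intro: inj_on_subset)
    also have "\<dots> = (\<Prod>h\<in>(\<Union>e\<in>E. L \<inter> ?B e). q (vt h))"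
      using L U by (intro prod.cong) auto
    also have "\<dots> = (\<Prod>e\<in>E. \<Prod>h\<in>L \<inter> ?B e. q (vt h))"
      using fin_E fin by (intro prod.UNION_disjoint) auto
    finally have 1: "(\<Prod>v\<in>vt ` L. q v) = (\<Prod>e\<in>E. \<Prod>h\<in>L \<inter> ?B e. q (vt h))" .
    have "unchosen_penalty \<alpha> (vt ` L) e
        = (if (e, False) \<in> \<alpha> \<and> (e, True) \<in> \<alpha> \<and> L \<inter> ?B e = {} then 1 - b else 1)" if "e \<in> E" for e
    proof -
      have "en e x \<in> vt ` L \<longleftrightarrow> (e, x) \<in> L" if "(e, x) \<in> \<alpha>" for x
      proof
        assume "en e x \<in> vt ` L"
        then obtain h where h: "h \<in> L" "vt h = en e x" by auto
        then have "(e, x) = h"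
          using L that \<open>e \<in> E\<close> by (intro lonely_eq[of h \<alpha> "(e, x)"]) (auto simp: H_def)
        then show "(e, x) \<in> L" using h by simp
      qed force
      then show ?thesis using L by (auto simp: unchosen_penalty_def)
    qed
    then show "(\<Prod>v\<in>vt ` L. q v) * (\<Prod>e\<in>E. unchosen_penalty \<alpha> (vt ` L) e)
      = (\<Prod>e\<in>E. (\<Prod>h\<in>L \<inter> ?B e. q (vt h)) *
          (if (e, False) \<in> \<alpha> \<and> (e, True) \<in> \<alpha> \<and> L \<inter> ?B e = {} then 1 - b else 1))"
      unfolding 1 prod.distrib by simp
  qed
  also have "\<dots> = F \<alpha>"
    unfolding F_def
    by (subst sum_Pow_blocks[OF fin_E disj, where f = "\<lambda>e C. (\<Prod>h\<in>C. q (vt h)) *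
          (if (e, False) \<in> \<alpha> \<and> (e, True) \<in> \<alpha> \<and> C = {} then 1 - b else 1)"])
       (intro prod.cong refl edge_wt_lonely[symmetric])
  finally show ?thesis by simp
qed

text \<open>A chosen vertex contributes the average of \<open>x\<close> over its star.\<close>

lemma star_sum:
  assumes "star v \<noteq> {}"
  shows "(\<Sum>C\<in>Pow (star v). (a * x) ^ card C * (if card C = 1 then q v else 0)) = x"
proof -
  have "(\<Sum>C\<in>Pow (star v). (a * x) ^ card C * (if card C = 1 then q v else 0))
      = (\<Sum>C | C \<subseteq> star v \<and> card C = 1. a * x * q v)"
    using finite_star by (intro sum.mono_neutral_cong_right) (auto simp: Pow_def)
  also have "\<dots> = card (star v) * (a * x * q v)"
    using n_subsets[OF finite_star, of v 1] by simp
  also have "\<dots> = x"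
    using assms a_ge finite_star by (simp add: q_def card_eq_0_iff)
  finally show ?thesis .
qed

lemma edge_sum:
  assumes "e \<in> E"
  shows "(\<Sum>C\<in>Pow {h \<in> {(e, False), (e, True)}. vt h \<notin> S}. (a * x) ^ card C *
       (if C = {(e, False), (e, True)} then 1 - b else 1)) = pair_wt a x (en e False \<in> S) (en e True \<in> S)"
proof -
  have "a\<^sup>2 * b = 1" using a_ge by (simp add: b_def)
  then have "1 + a * x + a * x + a * x * (a * x) * (1 - b) = (1 + a * x)\<^sup>2 - x\<^sup>2"
    by (simp add: power2_eq_square algebra_simps)
  moreover have eq: "{h \<in> {(e, False), (e, True)}. vt h \<notin> S} = {(e, False), (e, True)} \<inter> {h. vt h \<notin> S}"
    by auto
  ultimately show ?thesis
    unfolding pair_wt_def eq Pow_Int_doubleton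
    by (cases "en e False \<in> S"; cases "en e True \<in> S")
       (simp_all add: doubleton_eq_iff singleton_insert_inj_eq add.assoc)
qed

text \<open>For a fixed set \<open>S\<close> of chosen vertices, the half-edges are split into the stars of \<open>S\<close>, each of which meets \<open>\<alpha>\<close>
exactly once, and the halves of edges at unchosen vertices. The sum over \<open>\<alpha>\<close> factorises accordingly. Only the vertices of
\<open>vt ` H\<close> occur, because a vertex without half-edges has no variable to carry its \<open>x\<close>.\<close>

theorem polarisation:
  "(\<Sum>S\<in>Pow (vt ` H). x ^ card S * (\<Prod>e\<in>E. pair_wt a x (en e False \<in> S) (en e True \<in> S)))
     = (\<Sum>\<alpha>\<in>Pow H. (a * x) ^ card \<alpha> * F \<alpha>)"
proof -
  let ?c = "a * x"
  let ?T = "\<lambda>\<alpha> S. ?c ^ card \<alpha> * ((\<Prod>v\<in>S. if card (\<alpha> \<inter> star v) = 1 then q v else 0) * (\<Prod>e\<in>E. unchosen_penalty \<alpha> S e))"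
  have "?c ^ card \<alpha> * F \<alpha> = (\<Sum>S\<in>Pow (vt ` H). ?T \<alpha> S)" if "\<alpha> \<in> Pow H" for \<alpha>
  proof -
    have lon: "v \<in> vt ` lonely \<alpha> \<longleftrightarrow> card (\<alpha> \<inter> star v) = 1" for v
    proof
      assume "card (\<alpha> \<inter> star v) = 1"
      then obtain h where h: "\<alpha> \<inter> star v = {h}" by (auto simp: card_1_singleton_iff)
      then have "h \<in> star v" by blast
      then show "v \<in> vt ` lonely \<alpha>" using h by (force simp: lonely_def star_def)
    qed (auto simp: lonely_def)
    have "(\<Sum>S\<in>Pow (vt ` H). ?T \<alpha> S) = (\<Sum>S\<in>Pow (vt ` lonely \<alpha>). ?T \<alpha> S)"
    proof (rule sum.mono_neutral_right)
      show "\<forall>S\<in>Pow (vt ` H) - Pow (vt ` lonely \<alpha>). ?T \<alpha> S = 0"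
      proof
        fix S assume S: "S \<in> Pow (vt ` H) - Pow (vt ` lonely \<alpha>)"
        then obtain v where v: "v \<in> S" "card (\<alpha> \<inter> star v) \<noteq> 1" using lon by blast
        have "finite S" using S finite_H by (auto intro: finite_subset)
        then have "(\<Prod>v\<in>S. if card (\<alpha> \<inter> star v) = 1 then q v else 0) = 0"
          using v by (intro prod_zero) auto
        then show "?T \<alpha> S = 0" by simp
      qed
      show "Pow (vt ` lonely \<alpha>) \<subseteq> Pow (vt ` H)"
        by (intro Pow_mono image_mono lonely_subset)
    qed (use finite_H in auto)
    also have "\<dots> = (\<Sum>S\<in>Pow (vt ` lonely \<alpha>). ?c ^ card \<alpha> * ((\<Prod>v\<in>S. q v) * (\<Prod>e\<in>E. unchosen_penalty \<alpha> S e)))"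
    proof (intro sum.cong refl)
      fix S assume "S \<in> Pow (vt ` lonely \<alpha>)"
      then have "(\<Prod>v\<in>S. if card (\<alpha> \<inter> star v) = 1 then q v else 0) = (\<Prod>v\<in>S. q v)"
        using lon by (intro prod.cong) auto
      then show "?T \<alpha> S = ?c ^ card \<alpha> * ((\<Prod>v\<in>S. q v) * (\<Prod>e\<in>E. unchosen_penalty \<alpha> S e))" by simp
    qed
    finally show ?thesis using that by (simp add: F_eq_sum_vertex_sets sum_distrib_left)
  qed
  then have "(\<Sum>\<alpha>\<in>Pow H. ?c ^ card \<alpha> * F \<alpha>) = (\<Sum>\<alpha>\<in>Pow H. \<Sum>S\<in>Pow (vt ` H). ?T \<alpha> S)"
    by (intro sum.cong refl) auto
  also have "\<dots> = (\<Sum>S\<in>Pow (vt ` H). \<Sum>\<alpha>\<in>Pow H. ?T \<alpha> S)" by (rule sum.swap)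
  also have "\<dots> = (\<Sum>S\<in>Pow (vt ` H). x ^ card S * (\<Prod>e\<in>E. pair_wt a x (en e False \<in> S) (en e True \<in> S)))"
  proof (intro sum.cong refl)
    fix S assume S: "S \<in> Pow (vt ` H)"
    have fS: "finite S" using S finite_H by (auto intro: finite_subset)
    let ?X = "\<Union>v\<in>S. star v"
    let ?B = "\<lambda>e. {h \<in> {(e, False), (e, True)}. vt h \<notin> S}"
    let ?Y = "\<Union>e\<in>E. ?B e"
    let ?g = "\<lambda>A. \<Prod>v\<in>S. if card (A \<inter> star v) = 1 then q v else 0"
    let ?k = "\<lambda>D. \<Prod>e\<in>E. if D \<inter> ?B e = {(e, False), (e, True)} then 1 - b else 1"
    have XY: "?X \<inter> ?Y = {}" "H = ?X \<union> ?Y"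
      by (auto simp: star_def H_def)
    have "(\<Sum>\<alpha>\<in>Pow H. ?T \<alpha> S) = (\<Sum>\<alpha>\<in>Pow (?X \<union> ?Y). ?c ^ card \<alpha> * (?g (\<alpha> \<inter> ?X) * ?k (\<alpha> \<inter> ?Y)))"
      unfolding XY(2)[symmetric]
    proof (intro sum.cong refl)
      fix \<alpha> assume "\<alpha> \<in> Pow H"
      have "(\<Prod>v\<in>S. if card (\<alpha> \<inter> star v) = 1 then q v else 0) = ?g (\<alpha> \<inter> ?X)"
      proof (intro prod.cong refl)
        fix v assume "v \<in> S"
        then have "\<alpha> \<inter> ?X \<inter> star v = \<alpha> \<inter> star v" by auto
        then show "(if card (\<alpha> \<inter> star v) = 1 then q v else 0)
          = (if card (\<alpha> \<inter> ?X \<inter> star v) = 1 then q v else 0)" by simp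
      qed
      moreover have "(\<Prod>e\<in>E. unchosen_penalty \<alpha> S e) = ?k (\<alpha> \<inter> ?Y)"
      proof (intro prod.cong refl)
        fix e assume "e \<in> E"
        then have "\<alpha> \<inter> ?Y \<inter> ?B e = \<alpha> \<inter> ?B e" by auto
        moreover have "\<alpha> \<inter> ?B e = {(e, False), (e, True)} \<longleftrightarrow>
            (e, False) \<in> \<alpha> \<and> (e, True) \<in> \<alpha> \<and> en e False \<notin> S \<and> en e True \<notin> S"
          by (auto simp: set_eq_iff)
        ultimately show "unchosen_penalty \<alpha> S e = (if \<alpha> \<inter> ?Y \<inter> ?B e = {(e, False), (e, True)} then 1 - b else 1)"
          by (simp add: unchosen_penalty_def)
      qed
      ultimately show "?T \<alpha> S = ?c ^ card \<alpha> * (?g (\<alpha> \<inter> ?X) * ?k (\<alpha> \<inter> ?Y))" by simp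
    qed
    also have "\<dots> = (\<Sum>A\<in>Pow ?X. ?c ^ card A * ?g A) * (\<Sum>D\<in>Pow ?Y. ?c ^ card D * ?k D)"
      using XY(1) fS fin_E finite_star by (intro weighted_sum_Pow_two) auto
    also have "(\<Sum>A\<in>Pow ?X. ?c ^ card A * ?g A)
        = (\<Prod>v\<in>S. \<Sum>C\<in>Pow (star v). ?c ^ card C * (if card C = 1 then q v else 0))"
      by (rule weighted_sum_Pow_blocks[OF fS star_disjoint finite_star,
            where f = "\<lambda>v C. if card C = 1 then q v else 0"])
    also have "\<dots> = (\<Prod>v\<in>S. x)"
    proof (intro prod.cong refl star_sum)
      fix v assume "v \<in> S"
      then obtain h where "h \<in> H" "vt h = v" using S by blast
      then show "star v \<noteq> {}" using in_star by blast
    qed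
    also have "(\<Sum>D\<in>Pow ?Y. ?c ^ card D * ?k D) = (\<Prod>e\<in>E. \<Sum>C\<in>Pow (?B e). ?c ^ card C *
         (if C = {(e, False), (e, True)} then 1 - b else 1))"
      by (rule weighted_sum_Pow_blocks[OF fin_E,
            where f = "\<lambda>e C. if C = {(e, False), (e, True)} then 1 - b else 1"])
         (auto simp: disjoint_family_on_def)
    also have "\<dots> = (\<Prod>e\<in>E. pair_wt a x (en e False \<in> S) (en e True \<in> S))"
      by (intro prod.cong refl edge_sum)
    finally show "(\<Sum>\<alpha>\<in>Pow H. ?T \<alpha> S)
        = x ^ card S * (\<Prod>e\<in>E. pair_wt a x (en e False \<in> S) (en e True \<in> S))"
      by simp
  qed
  finally show ?thesis by simp
qed

end

section \<open>Independent sets in F(l,m,t,s) and G4(l,m,t,s)\<close>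

lemma indep_iff_no_edge:
  assumes "\<And>e. e \<in> \<E> \<Longrightarrow> card e = 2"
  shows "indep T \<E> \<longleftrightarrow> (\<forall>e\<in>\<E>. \<not> e \<subseteq> T)"
proof
  assume ind: "indep T \<E>"
  show "\<forall>e\<in>\<E>. \<not> e \<subseteq> T"
  proof (intro ballI notI)
    fix e assume e: "e \<in> \<E>" "e \<subseteq> T"
    then obtain u v where "e = {u, v}" "u \<noteq> v" using assms[of e] by (auto simp: card_2_iff)
    then show False using ind e by (auto simp: indep_def)
  qed
qed (auto simp: indep_def)

text \<open>The independent sets of a clique that avoid \<open>N\<close> are the empty set and the singletons outside \<open>N\<close>.\<close>

lemma sum_cliquewise:
  fixes x :: real
  assumes "finite K"
  shows "(\<Sum>A\<in>Pow K. x ^ card A * of_bool (card A \<le> 1 \<and> A \<inter> N = {})) = 1 + real (card (K - N)) * x"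
proof -
  have "(\<Sum>A\<in>Pow K. x ^ card A * of_bool (card A \<le> 1 \<and> A \<inter> N = {}))
      = (\<Sum>A\<in>insert {} ((\<lambda>v. {v}) ` (K - N)). x ^ card A)"
  proof (rule sum.mono_neutral_cong_right)
    show "\<forall>A\<in>Pow K - insert {} ((\<lambda>v. {v}) ` (K - N)). x ^ card A * of_bool (card A \<le> 1 \<and> A \<inter> N = {}) = 0"
    proof
      fix A assume A: "A \<in> Pow K - insert {} ((\<lambda>v. {v}) ` (K - N))"
      then have "finite A" using assms by (auto intro: finite_subset)
      have "\<not> (card A \<le> 1 \<and> A \<inter> N = {})"
      proof
        assume *: "card A \<le> 1 \<and> A \<inter> N = {}"
        with \<open>finite A\<close> A have "card A = 1" by (cases "card A = 0") (auto simp: card_eq_0_iff le_Suc_eq)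
        then obtain v where "A = {v}" by (auto simp: card_1_singleton_iff)
        then show False using A * by auto
      qed
      then show "x ^ card A * of_bool (card A \<le> 1 \<and> A \<inter> N = {}) = 0" by simp
    qed
  qed (use assms in auto)
  also have "\<dots> = 1 + (\<Sum>v\<in>K - N. x ^ card {v})"
    using assms by (subst sum.insert) (auto simp: sum.reindex)
  finally show ?thesis by simp
qed

lemma nsets_2_not_subset: "finite K \<Longrightarrow> (\<forall>e\<in>[K]\<^bsup>2\<^esup>. \<not> e \<subseteq> C) \<longleftrightarrow> card (C \<inter> K) \<le> 1"
proof -
  assume K: "finite K"
  have "(\<exists>e\<in>[K]\<^bsup>2\<^esup>. e \<subseteq> C) \<longleftrightarrow> 2 \<le> card (C \<inter> K)"
  proof
    assume "\<exists>e\<in>[K]\<^bsup>2\<^esup>. e \<subseteq> C"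
    then obtain e where e: "e \<subseteq> K" "card e = 2" "e \<subseteq> C" by (auto simp: nsets_def)
    then have "card e \<le> card (C \<inter> K)" using K by (intro card_mono) auto
    then show "2 \<le> card (C \<inter> K)" using e by simp
  next
    assume "2 \<le> card (C \<inter> K)"
    then obtain e where "e \<subseteq> C \<inter> K" "card e = 2" by (meson obtain_subset_with_card_n)
    then show "\<exists>e\<in>[K]\<^bsup>2\<^esup>. e \<subseteq> C" using K by (auto simp: nsets_def intro: finite_subset)
  qed
  then show ?thesis by auto
qed

lemma join_edges_not_subset: "(\<forall>e\<in>join_edges v A. \<not> e \<subseteq> C) \<longleftrightarrow> (v \<in> C \<longrightarrow> C \<inter> A = {})"
proof -
  have "(\<forall>e\<in>join_edges v A. P e) \<longleftrightarrow> (\<forall>w\<in>A. P {v, w})" for P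
    by (auto simp: join_edges_def)
  then show ?thesis by (auto simp: disjoint_iff)
qed

text \<open>The centre is left out: as an endpoint it is shared by several copies and is accounted for separately.\<close>

definition F_inner :: "nat \<Rightarrow> nat \<Rightarrow> nat \<Rightarrow> nat \<Rightarrow> fvert set" where
  "F_inner l m t s = {X} \<union> Km ` {..<m} \<union> Kl ` {..<l} \<union> Kms ` {..<m - s} \<union> Klt ` {..<l - t}"

lemma finite_F_inner: "finite (F_inner l m t s)" by (simp add: F_inner_def)

lemma F_edge:
  assumes "valid_attachment l m t s a" "e \<in> edges (F_graph l m t s a)"
  shows "card e = 2 \<and> e \<subseteq> insert Center (F_inner l m t s)"
proof -
  define V where "V = insert Center (F_inner l m t s)"
  have ns: "card e = 2 \<and> e \<subseteq> V" if "e \<in> [K]\<^bsup>2\<^esup>" "K \<subseteq> V" for K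
    using that by (auto simp: nsets_def)
  have jn: "card e = 2 \<and> e \<subseteq> V" if j: "e \<in> join_edges v A" "v \<notin> A" "insert v A \<subseteq> V" for v A
  proof -
    obtain w where "e = {v, w}" "w \<in> A" using j(1) by (auto simp: join_edges_def)
    moreover have "v \<noteq> w" using j(2) \<open>w \<in> A\<close> by metis
    ultimately show ?thesis using j(3) by auto
  qed
  have cx: "card {Center, X} = 2 \<and> {Center, X} \<subseteq> V" by (simp add: V_def F_inner_def)
  have sub: "Km ` {..<m} \<subseteq> V" "Kl ` {..<l} \<subseteq> V" "Kms ` {..<m - s} \<subseteq> V" "Klt ` {..<l - t} \<subseteq> V"
    "Center \<in> V" "X \<in> V"
    by (auto simp: V_def F_inner_def)
  have att: "center_Km a \<subseteq> {..<m}" "center_Kl a \<subseteq> {..<l}" "center_Klt a \<subseteq> {..<l - t}" "X_Kl a \<subseteq> {..<l}"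
    using assms(1) by (auto simp: valid_attachment_def nsets_def)
  have sub': "Km ` center_Km a \<subseteq> V" "Kl ` center_Kl a \<subseteq> V" "Klt ` center_Klt a \<subseteq> V" "Kl ` X_Kl a \<subseteq> V"
    using order_trans[OF image_mono[OF att(1)] sub(1)] order_trans[OF image_mono[OF att(2)] sub(2)]
      order_trans[OF image_mono[OF att(3)] sub(4)] order_trans[OF image_mono[OF att(4)] sub(2)]
    by simp_all
  note cases = assms(2)[unfolded F_graph_def snd_conv Un_iff singleton_iff]
  show ?thesis
    unfolding V_def[symmetric]
    by (rule disjE[OF cases]; (elim disjE)?; (rule ns, assumption, rule sub)?;
        (rule jn, assumption, force, (rule insert_subsetI sub sub')+)?; simp add: cx[simplified])
qed

lemma indep_F_iff:
  assumes a: "valid_attachment l m t s a" and C: "C \<subseteq> F_inner l m t s"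
  shows "indep (C \<union> {v. v = Center \<and> \<sigma>}) (edges (F_graph l m t s a)) \<longleftrightarrow>
     card (C \<inter> Km ` {..<m}) \<le> 1 \<and> card (C \<inter> Kl ` {..<l}) \<le> 1 \<and>
     card (C \<inter> Kms ` {..<m - s}) \<le> 1 \<and> card (C \<inter> Klt ` {..<l - t}) \<le> 1 \<and>
     \<not> (\<sigma> \<and> X \<in> C) \<and>
     (\<sigma> \<longrightarrow> C \<inter> Km ` center_Km a = {}) \<and> (\<sigma> \<longrightarrow> C \<inter> Kl ` center_Kl a = {}) \<and>
     (\<sigma> \<longrightarrow> C \<inter> Kms ` {..<m - s} = {}) \<and> (\<sigma> \<longrightarrow> C \<inter> Klt ` center_Klt a = {}) \<and>
     (X \<in> C \<longrightarrow> C \<inter> Km ` {..<m} = {}) \<and> (X \<in> C \<longrightarrow> C \<inter> Kl ` X_Kl a = {})"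
proof -
  let ?T = "C \<union> {v. v = Center \<and> \<sigma>}"
  have "Center \<notin> C" using C by (auto simp: F_inner_def)
  have K: "(C \<union> {v. v = Center \<and> \<sigma>}) \<inter> Km ` A = C \<inter> Km ` A"
    "(C \<union> {v. v = Center \<and> \<sigma>}) \<inter> Kl ` A = C \<inter> Kl ` A"
    "(C \<union> {v. v = Center \<and> \<sigma>}) \<inter> Kms ` A = C \<inter> Kms ` A"
    "(C \<union> {v. v = Center \<and> \<sigma>}) \<inter> Klt ` A = C \<inter> Klt ` A" for A by auto
  have "indep ?T (edges (F_graph l m t s a)) \<longleftrightarrow> (\<forall>e\<in>edges (F_graph l m t s a). \<not> e \<subseteq> ?T)"
    by (rule indep_iff_no_edge) (use F_edge[OF a] in blast)
  also have "\<dots> =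
    ((\<forall>e\<in>[Km ` {..<m}]\<^bsup>2\<^esup>. \<not> e \<subseteq> ?T) \<and> (\<forall>e\<in>[Kl ` {..<l}]\<^bsup>2\<^esup>. \<not> e \<subseteq> ?T) \<and>
     (\<forall>e\<in>[Kms ` {..<m - s}]\<^bsup>2\<^esup>. \<not> e \<subseteq> ?T) \<and> (\<forall>e\<in>[Klt ` {..<l - t}]\<^bsup>2\<^esup>. \<not> e \<subseteq> ?T) \<and>
     \<not> {Center, X} \<subseteq> ?T \<and>
     (\<forall>e\<in>join_edges Center (Km ` center_Km a). \<not> e \<subseteq> ?T) \<and>
     (\<forall>e\<in>join_edges Center (Kl ` center_Kl a). \<not> e \<subseteq> ?T) \<and>
     (\<forall>e\<in>join_edges Center (Kms ` {..<m - s}). \<not> e \<subseteq> ?T) \<and>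
     (\<forall>e\<in>join_edges Center (Klt ` center_Klt a). \<not> e \<subseteq> ?T) \<and>
     (\<forall>e\<in>join_edges X (Km ` {..<m}). \<not> e \<subseteq> ?T) \<and>
     (\<forall>e\<in>join_edges X (Kl ` X_Kl a). \<not> e \<subseteq> ?T))" (is "_ = ?all")
    unfolding F_graph_def snd_conv ball_Un by simp
  finally have 1: "indep ?T (edges (F_graph l m t s a)) \<longleftrightarrow> ?all" .
  have "{Center, X} \<subseteq> ?T \<longleftrightarrow> \<sigma> \<and> X \<in> C" "Center \<in> ?T \<longleftrightarrow> \<sigma>" "X \<in> ?T \<longleftrightarrow> X \<in> C"
    using \<open>Center \<notin> C\<close> by auto
  then show ?thesis
    unfolding 1 join_edges_not_subset by (simp only: nsets_2_not_subset finite_imageI finite_lessThan K)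
qed

text \<open>The generating function of the independent sets with prescribed states \<open>\<sigma>\<close> of the centre and
\<open>\<xi>\<close> of \<open>X\<close>; the centre is not counted in the size.\<close>

definition F_gf :: "nat \<Rightarrow> nat \<Rightarrow> nat \<Rightarrow> nat \<Rightarrow> attachment \<Rightarrow> real \<Rightarrow> bool \<Rightarrow> bool \<Rightarrow> real" where
  "F_gf l m t s a x \<sigma> \<xi> = (\<Sum>C\<in>Pow (F_inner l m t s). x ^ card C *
     of_bool (indep (C \<union> {v. v = Center \<and> \<sigma>}) (edges (F_graph l m t s a)) \<and> (X \<in> C \<longleftrightarrow> \<xi>)))"

definition common_factor :: "nat \<Rightarrow> nat \<Rightarrow> nat \<Rightarrow> nat \<Rightarrow> real \<Rightarrow> real" where
  "common_factor l m t s x = (1 + real m * x) * (1 + real (m - s) * x) * (1 + real (l - t) * x)"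

text \<open>The four cliques contribute independently, each one the linear factor of \<open>sum_cliquewise\<close>. The parameters are
such that each single choice, of the centre or of \<open>X\<close>, leaves cliques of the sizes \<open>m\<close>, \<open>m - s\<close> and \<open>l - t\<close>: with the
centre chosen, they come from \<open>K\<^sub>l\<^sub>-\<^sub>t\<close>, \<open>K\<^sub>m\<close> and \<open>K\<^sub>l\<close>; with \<open>X\<close> chosen, from \<open>K\<^sub>l\<close>, \<open>K\<^sub>m\<^sub>-\<^sub>s\<close> and \<open>K\<^sub>l\<^sub>-\<^sub>t\<close>.\<close>

lemma F_gf_eq:
  assumes "valid_attachment l m t s a" "m \<le> l" "s \<le> m" "t + m \<le> l"
  shows "F_gf l m t s a x \<sigma> \<xi> = (if \<sigma> \<and> \<xi> then 0
     else if \<sigma> then common_factor l m t s x else if \<xi> then x * common_factor l m t s x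
     else common_factor l m t s x * (1 + real l * x))"
proof -
  \<comment> \<open>The blocks are \<open>X\<close> and the four cliques; \<open>N i\<close> are the vertices of block \<open>i\<close> that are blocked by the centre or by \<open>X\<close>.\<close>
  define B where "B i = ([{X}, Km ` {..<m}, Kl ` {..<l}, Kms ` {..<m - s}, Klt ` {..<l - t}] ! i)" for i
  define N where "N i = ([{}, (if \<sigma> then Km ` center_Km a else {}) \<union> (if \<xi> then Km ` {..<m} else {}),
      (if \<sigma> then Kl ` center_Kl a else {}) \<union> (if \<xi> then Kl ` X_Kl a else {}),
      (if \<sigma> then Kms ` {..<m - s} else {}),
      (if \<sigma> then Klt ` center_Klt a else {})] ! i)" for i
  define f :: "nat \<Rightarrow> fvert set \<Rightarrow> real" where
    "f i A = (if i = 0 then of_bool ((X \<in> A) = \<xi>) else of_bool (card A \<le> 1 \<and> A \<inter> N i = {}))" for i A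
  define I where "I = {0, 1, 2, 3, 4 :: nat}"
  have B: "B 0 = {X}" "B 1 = Km ` {..<m}" "B 2 = Kl ` {..<l}" "B 3 = Kms ` {..<m - s}" "B 4 = Klt ` {..<l - t}"
    by (simp_all add: B_def numeral_eq_Suc)
  have N: "N 1 = (if \<sigma> then Km ` center_Km a else {}) \<union> (if \<xi> then Km ` {..<m} else {})"
      "N 2 = (if \<sigma> then Kl ` center_Kl a else {}) \<union> (if \<xi> then Kl ` X_Kl a else {})"
      "N 3 = (if \<sigma> then Kms ` {..<m - s} else {})"
      "N 4 = (if \<sigma> then Klt ` center_Klt a else {})"
    by (simp_all add: N_def numeral_eq_Suc)
  have prod5: "(\<Prod>i\<in>I. g i) = g 0 * g 1 * g 2 * g 3 * g 4" for g :: "nat \<Rightarrow> real"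
    by (simp add: I_def mult.assoc)
  have U: "(\<Union>i\<in>I. B i) = F_inner l m t s"
    by (simp add: I_def F_inner_def B[simplified] Un_assoc)
  have "B i \<inter> B j = {}" if "i \<in> I" "j \<in> I" "i \<noteq> j" for i j
    using that unfolding I_def by (elim insertE emptyE; simp only: B) auto
  then have disj: "disjoint_family_on B I" by (simp add: disjoint_family_on_def)
  have att: "center_Km a \<subseteq> {..<m}" "center_Kl a \<subseteq> {..<l}" "center_Klt a \<subseteq> {..<l - t}" "X_Kl a \<subseteq> {..<l}"
      "card (center_Km a) = s" "card (center_Kl a) = t" "card (center_Klt a) = l - t - m" "card (X_Kl a) = l - m"
    using assms(1) by (auto simp: valid_attachment_def nsets_def)
  have ind: "of_bool (indep (C \<union> {v. v = Center \<and> \<sigma>}) (edges (F_graph l m t s a)) \<and> (X \<in> C \<longleftrightarrow> \<xi>))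
      = of_bool (\<not> (\<sigma> \<and> \<xi>)) * (\<Prod>i\<in>I. f i (C \<inter> B i))" if "C \<subseteq> F_inner l m t s" for C
  proof -
    have "Km ` center_Km a \<subseteq> Km ` {..<m}" "Kl ` center_Kl a \<subseteq> Kl ` {..<l}"
      "Klt ` center_Klt a \<subseteq> Klt ` {..<l - t}" "Kl ` X_Kl a \<subseteq> Kl ` {..<l}"
      using att by auto
    note sub = this
    have abs: "C \<inter> A \<inter> A' = C \<inter> A'" if "A' \<subseteq> A" for A A' :: "fvert set" using that by blast
    have Int: "C \<inter> Km ` {..<m} \<inter> Km ` center_Km a = C \<inter> Km ` center_Km a"
      "C \<inter> Kl ` {..<l} \<inter> Kl ` center_Kl a = C \<inter> Kl ` center_Kl a"
      "C \<inter> Klt ` {..<l - t} \<inter> Klt ` center_Klt a = C \<inter> Klt ` center_Klt a"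
      "C \<inter> Kl ` {..<l} \<inter> Kl ` X_Kl a = C \<inter> Kl ` X_Kl a"
      by (rule abs[OF sub(1)] abs[OF sub(2)] abs[OF sub(3)] abs[OF sub(4)])+
    have "(\<Prod>i\<in>I. f i (C \<inter> B i)) = of_bool ((X \<in> C) = \<xi> \<and>
      card (C \<inter> Km ` {..<m}) \<le> 1 \<and> C \<inter> Km ` {..<m} \<inter> N 1 = {} \<and>
      card (C \<inter> Kl ` {..<l}) \<le> 1 \<and> C \<inter> Kl ` {..<l} \<inter> N 2 = {} \<and>
      card (C \<inter> Kms ` {..<m - s}) \<le> 1 \<and> C \<inter> Kms ` {..<m - s} \<inter> N 3 = {} \<and>
      card (C \<inter> Klt ` {..<l - t}) \<le> 1 \<and> C \<inter> Klt ` {..<l - t} \<inter> N 4 = {})"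
      unfolding prod5 B f_def by (simp add: of_bool_conj mult.assoc)
    then show ?thesis
      unfolding indep_F_iff[OF assms(1) that] N
      by (cases \<sigma>; cases \<xi>; cases "X \<in> C") (simp_all add: Int Int_Un_distrib conj_ac)
  qed
  have "F_gf l m t s a x \<sigma> \<xi> = (\<Sum>C\<in>Pow (\<Union>i\<in>I. B i). of_bool (\<not> (\<sigma> \<and> \<xi>)) *
      (x ^ card C * (\<Prod>i\<in>I. f i (C \<inter> B i))))"
    unfolding F_gf_def U by (intro sum.cong refl) (simp only: Pow_iff ind mult_ac)
  also have "\<dots> = of_bool (\<not> (\<sigma> \<and> \<xi>)) * (\<Prod>i\<in>I. \<Sum>A\<in>Pow (B i). x ^ card A * f i A)"
    unfolding sum_distrib_left[symmetric]
    by (subst weighted_sum_Pow_blocks[OF _ disj]) (auto simp: I_def B[simplified])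
  also have "(\<Prod>i\<in>I. \<Sum>A\<in>Pow (B i). x ^ card A * f i A)
      = (if \<xi> then x else 1) * (1 + card (B 1 - N 1) * x) * (1 + card (B 2 - N 2) * x)
        * (1 + card (B 3 - N 3) * x) * (1 + card (B 4 - N 4) * x)"
  proof -
    have "(\<Sum>A\<in>Pow (B i). x ^ card A * f i A) = 1 + card (B i - N i) * x" if "i \<in> {1, 2, 3, 4}" for i
    proof -
      have "finite (B i)" using that by (auto simp: B[simplified])
      then show ?thesis unfolding f_def using that sum_cliquewise[of "B i" x "N i"] by auto
    qed
    moreover have "(\<Sum>A\<in>Pow (B 0). x ^ card A * f 0 A) = (if \<xi> then x else 1)"
      by (simp add: B f_def Pow_insert)
    ultimately show ?thesis unfolding prod5 by simp
  qed
  finally have 1: "F_gf l m t s a x \<sigma> \<xi> = of_bool (\<not> (\<sigma> \<and> \<xi>)) * ((if \<xi> then x else 1)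
      * (1 + card (B 1 - N 1) * x) * (1 + card (B 2 - N 2) * x)
      * (1 + card (B 3 - N 3) * x) * (1 + card (B 4 - N 4) * x))" .
  have cards: "card (Km ` {..<m} - Km ` center_Km a) = m - s" "card (Kl ` {..<l} - Kl ` center_Kl a) = l - t"
      "card (Klt ` {..<l - t} - Klt ` center_Klt a) = m" "card (Kl ` {..<l} - Kl ` X_Kl a) = m"
      "card (Km ` {..<m}) = m" "card (Kl ` {..<l}) = l" "card (Kms ` {..<m - s}) = m - s" "card (Klt ` {..<l - t}) = l - t"
  proof -
    have inj: "inj Km" "inj Kl" "inj Kms" "inj Klt" by (auto simp: inj_def)
    have c: "card (g ` A - g ` A') = card A - card A'" if "inj g" "A' \<subseteq> A" "finite A" for g :: "nat \<Rightarrow> fvert" and A A'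
      using that by (simp add: image_set_diff[symmetric] card_image inj_on_subset[OF that(1)] card_Diff_subset finite_subset)
    show "card (Km ` {..<m} - Km ` center_Km a) = m - s" "card (Kl ` {..<l} - Kl ` center_Kl a) = l - t"
      "card (Klt ` {..<l - t} - Klt ` center_Klt a) = m" "card (Kl ` {..<l} - Kl ` X_Kl a) = m"
      using assms by (simp_all add: c inj att)
    show "card (Km ` {..<m}) = m" "card (Kl ` {..<l}) = l" "card (Kms ` {..<m - s}) = m - s" "card (Klt ` {..<l - t}) = l - t"
      using inj by (simp_all add: card_image inj_on_subset)
  qed
  show ?thesis
    unfolding 1 common_factor_def
    unfolding B N
    by (cases \<sigma>; cases \<xi>) (simp_all add: cards mult_ac)
qed

definition G4_inner :: "nat \<Rightarrow> nat \<Rightarrow> nat \<Rightarrow> nat \<Rightarrow> (bool \<times> fvert) set" where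
  "G4_inner l m t s = UNIV \<times> F_inner l m t s"

definition endpoints_in :: "bool \<Rightarrow> bool \<Rightarrow> (bool \<times> fvert) set" where
  "endpoints_in \<sigma> \<tau> = {h. h = (False, Center) \<and> \<sigma> \<or> h = (True, Center) \<and> \<tau>}"

lemma G4_edge:
  assumes "valid_attachment l m t s a" "valid_attachment l m t s b" "e \<in> edges (G4_graph l m t s a b)"
  shows "card e = 2" "e \<subseteq> {(False, Center), (True, Center)} \<union> G4_inner l m t s"
proof -
  have c: "card (Pair y ` e') = card e'" for y :: bool and e' :: "fvert set"
    by (simp add: card_image inj_on_def)
  have "X \<in> F_inner l m t s" by (simp add: F_inner_def)
  have sub: "Pair y ` e' \<subseteq> {(False, Center), (True, Center)} \<union> G4_inner l m t s"
    if "e' \<subseteq> insert Center (F_inner l m t s)" for y e'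
    using that by (cases y) (auto simp: G4_inner_def)
  from assms(3) consider e' where "e = Pair False ` e'" "e' \<in> edges (F_graph l m t s a)"
    | e' where "e = Pair True ` e'" "e' \<in> edges (F_graph l m t s b)"
    | "e = {(False, X), (True, X)}"
    by (auto simp: G4_graph_def)
  then have "card e = 2 \<and> e \<subseteq> {(False, Center), (True, Center)} \<union> G4_inner l m t s"
  proof cases
    case 1
    then show ?thesis using F_edge[OF assms(1)] c sub by metis
  next
    case 2
    then show ?thesis using F_edge[OF assms(2)] c sub by metis
  next
    case 3
    then show ?thesis using \<open>X \<in> F_inner l m t s\<close> by (simp add: G4_inner_def)
  qed
  then show "card e = 2" "e \<subseteq> {(False, Center), (True, Center)} \<union> G4_inner l m t s" by simp_all
qed

lemma indep_G4_iff:
  assumes "valid_attachment l m t s a" "valid_attachment l m t s b"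
  shows "indep (endpoints_in \<sigma> \<tau> \<union> (Pair False ` C \<union> Pair True ` D)) (edges (G4_graph l m t s a b)) \<longleftrightarrow>
    indep (C \<union> {v. v = Center \<and> \<sigma>}) (edges (F_graph l m t s a)) \<and>
    indep (D \<union> {v. v = Center \<and> \<tau>}) (edges (F_graph l m t s b)) \<and> \<not> (X \<in> C \<and> X \<in> D)"
proof -
  let ?T = "endpoints_in \<sigma> \<tau> \<union> (Pair False ` C \<union> Pair True ` D)"
  have sub: "Pair False ` e \<subseteq> ?T \<longleftrightarrow> e \<subseteq> C \<union> {v. v = Center \<and> \<sigma>}"
    "Pair True ` e \<subseteq> ?T \<longleftrightarrow> e \<subseteq> D \<union> {v. v = Center \<and> \<tau>}" for e
    by (auto simp: endpoints_in_def)
  have x: "{(False, X), (True, X)} \<subseteq> ?T \<longleftrightarrow> X \<in> C \<and> X \<in> D"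
    by (auto simp: endpoints_in_def)
  have "indep ?T (edges (G4_graph l m t s a b)) \<longleftrightarrow> (\<forall>e\<in>edges (G4_graph l m t s a b). \<not> e \<subseteq> ?T)"
    using G4_edge(1)[OF assms] by (rule indep_iff_no_edge)
  also have "\<dots> \<longleftrightarrow> (\<forall>e\<in>edges (F_graph l m t s a). \<not> Pair False ` e \<subseteq> ?T)
      \<and> (\<forall>e\<in>edges (F_graph l m t s b). \<not> Pair True ` e \<subseteq> ?T) \<and> \<not> {(False, X), (True, X)} \<subseteq> ?T"
    unfolding G4_graph_def snd_conv ball_Un ball_simps(9) by (simp add: conj_assoc)
  finally show ?thesis
    unfolding sub x using F_edge[OF assms(1)] F_edge[OF assms(2)]
    by (simp add: indep_iff_no_edge)
qed

definition G4_gf :: "nat \<Rightarrow> nat \<Rightarrow> nat \<Rightarrow> nat \<Rightarrow> attachment \<Rightarrow> attachment \<Rightarrow> real \<Rightarrow> bool \<Rightarrow> bool \<Rightarrow> real" where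
  "G4_gf l m t s a b x \<sigma> \<tau> = (\<Sum>C\<in>Pow (G4_inner l m t s). x ^ card C *
     of_bool (indep (endpoints_in \<sigma> \<tau> \<union> C) (edges (G4_graph l m t s a b))))"

lemma sum_Pow_image:
  assumes "inj_on f A"
  shows "(\<Sum>C\<in>Pow (f ` A). g C) = (\<Sum>C\<in>Pow A. g (f ` C))"
  by (rule sum.reindex_bij_betw[symmetric]) (intro bij_betw_Pow inj_on_imp_bij_betw assms)

text \<open>The two copies of F are joined only by the edge between their vertices \<open>X\<close>, which rules out the fourth
combination of states.\<close>

lemma G4_gf_split:
  assumes "valid_attachment l m t s a" "valid_attachment l m t s b"
  shows "G4_gf l m t s a b x \<sigma> \<tau> = F_gf l m t s a x \<sigma> False * F_gf l m t s b x \<tau> False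
     + F_gf l m t s a x \<sigma> True * F_gf l m t s b x \<tau> False
     + F_gf l m t s a x \<sigma> False * F_gf l m t s b x \<tau> True"
proof -
  let ?D = "F_inner l m t s"
  define f where "f C \<xi> = x ^ card C *
     of_bool (indep (C \<union> {v. v = Center \<and> \<sigma>}) (edges (F_graph l m t s a)) \<and> (X \<in> C \<longleftrightarrow> \<xi>))" for C \<xi>
  define g where "g C \<xi> = x ^ card C *
     of_bool (indep (C \<union> {v. v = Center \<and> \<tau>}) (edges (F_graph l m t s b)) \<and> (X \<in> C \<longleftrightarrow> \<xi>))" for C \<xi>
  let ?h = "\<lambda>A B. x ^ card (A \<union> B) * of_bool (indep (endpoints_in \<sigma> \<tau> \<union> (A \<union> B)) (edges (G4_graph l m t s a b)))"
  have split: "G4_inner l m t s = Pair False ` ?D \<union> Pair True ` ?D"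
    unfolding G4_inner_def UNIV_bool by auto
  have "G4_gf l m t s a b x \<sigma> \<tau> = (\<Sum>C\<in>Pow (Pair False ` ?D \<union> Pair True ` ?D).
      ?h (C \<inter> Pair False ` ?D) (C \<inter> Pair True ` ?D))"
    unfolding G4_gf_def split
    by (intro sum.cong refl) (auto simp: Int_Un_distrib[symmetric] Int_absorb2)
  also have "\<dots> = (\<Sum>A\<in>Pow (Pair False ` ?D). \<Sum>B\<in>Pow (Pair True ` ?D). ?h A B)"
    by (rule sum_Pow_two) auto
  also have "\<dots> = (\<Sum>C\<in>Pow ?D. \<Sum>D\<in>Pow ?D. ?h (Pair False ` C) (Pair True ` D))"
    by (simp add: sum_Pow_image inj_on_def)
  also have "\<dots> = (\<Sum>C\<in>Pow ?D. \<Sum>D\<in>Pow ?D. f C False * g D False + f C True * g D False + f C False * g D True)"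
  proof (intro sum.cong refl)
    fix C D assume "C \<in> Pow ?D" "D \<in> Pow ?D"
    then have fin: "finite C" "finite D" using finite_F_inner by (auto intro: finite_subset)
    have "card (Pair False ` C \<union> Pair True ` D) = card (Pair False ` C) + card (Pair True ` D)"
      using fin by (intro card_Un_disjoint) auto
    also have "\<dots> = card C + card D" by (simp add: card_image inj_on_def)
    finally have "card (Pair False ` C \<union> Pair True ` D) = card C + card D" .
    then show "?h (Pair False ` C) (Pair True ` D) = f C False * g D False + f C True * g D False + f C False * g D True"
      unfolding indep_G4_iff[OF assms] f_def g_def
      by (cases "X \<in> C"; cases "X \<in> D") (simp_all add: power_add of_bool_conj)
  qed
  also have "\<dots> = (\<Sum>C\<in>Pow ?D. f C False) * (\<Sum>D\<in>Pow ?D. g D False)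
      + (\<Sum>C\<in>Pow ?D. f C True) * (\<Sum>D\<in>Pow ?D. g D False) + (\<Sum>C\<in>Pow ?D. f C False) * (\<Sum>D\<in>Pow ?D. g D True)"
    unfolding sum_product sum.distrib ..
  finally show ?thesis by (simp add: F_gf_def f_def g_def)
qed

text \<open>With no endpoint chosen the factor is \<open>(1 + l x)\<^sup>2 + 2 x (1 + l x) = (1 + (l + 1) x)\<^sup>2 - x\<^sup>2\<close>.\<close>

lemma G4_gf_eq:
  assumes "valid_attachment l m t s a" "valid_attachment l m t s b" "m \<le> l" "s \<le> m" "t + m \<le> l"
  shows "G4_gf l m t s a b x \<sigma> \<tau> = (common_factor l m t s x)\<^sup>2 * pair_wt (real l + 1) x \<sigma> \<tau>"
  unfolding G4_gf_split[OF assms(1,2)] F_gf_eq[OF assms(1,3-5)] F_gf_eq[OF assms(2,3-5)] 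
  by (cases \<sigma>; cases \<tau>) (simp_all add: pair_wt_def power2_eq_square algebra_simps)

section \<open>Independent sets after replacing edges\<close>

lemma indep_poly_log_concaveI:
  assumes fin: "finite (verts G)"
    and lc: "strongly_log_concave (\<Sum>T\<in>indep_sets G. monom 1 (card T))"
  shows "log_concave (indep_poly G)"
proof -
  have finI: "finite (indep_sets G)"
    using fin by (auto simp: indep_sets_def intro: finite_subset[of _ "Pow (verts G)"])
  have zero: "indep_count G k = 0" if "indep_num G < k" for k
  proof -
    have "{S \<in> indep_sets G. card S = k} = {}"
      using that finI Max_ge[of "card ` indep_sets G"] unfolding indep_num_def by fastforce
    then show ?thesis unfolding indep_count_def by (simp only: card.empty)
  qed
  have co: "coeff (indep_poly G) k = int (indep_count G k)" for k
    using zero[of k] by (simp add: indep_poly_def coeff_sum)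
  have "coeff (\<Sum>T\<in>indep_sets G. monom (1 :: real) (card T)) k = real (indep_count G k)" for k
  proof -
    have "coeff (\<Sum>T\<in>indep_sets G. monom (1 :: real) (card T)) k
        = (\<Sum>T\<in>indep_sets G. if card T = k then 1 else 0)"
      by (simp add: coeff_sum)
    also have "\<dots> = (\<Sum>T | T \<in> indep_sets G \<and> card T = k. 1)"
      using finI by (intro sum.mono_neutral_cong_right) auto
    finally show ?thesis by (simp add: indep_count_def)
  qed
  then have *: "real (indep_count G i) * real (indep_count G (Suc j))
      \<le> real (indep_count G (Suc i)) * real (indep_count G j)" if "i \<le> j" for i j
    using lc that by (simp add: strongly_log_concave_def)
  have "int (indep_count G (k - 1)) * int (indep_count G (k + 1)) \<le> (int (indep_count G k))\<^sup>2" if "1 \<le> k" for k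
  proof -
    have "real (indep_count G (k - 1) * indep_count G (k + 1)) \<le> real (indep_count G k * indep_count G k)"
      using *[of "k - 1" k] that by simp
    then have "int (indep_count G (k - 1) * indep_count G (k + 1)) \<le> int (indep_count G k * indep_count G k)"
      by (simp only: of_nat_le_iff)
    then show ?thesis by (simp add: power2_eq_square)
  qed
  then show ?thesis by (simp add: log_concave_def co)
qed

lemma place_simps:
  "place (False, Center) (True, Center) orient e (False, Center) = Inl (fst (orient e))"
  "place (False, Center) (True, Center) orient e (True, Center) = Inl (snd (orient e))"
  "h \<in> G4_inner l m t s \<Longrightarrow> place (False, Center) (True, Center) orient e h = Inr (e, h)"
  by (auto simp: place_def G4_inner_def F_inner_def)

lemma inj_place: "fst (orient e) \<noteq> snd (orient e) \<Longrightarrow> inj (place p q orient e)"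
  by (auto simp: inj_def place_def split: if_splits)

lemma G4_verts: "verts (G4_graph l m t s a b) = {(False, Center), (True, Center)} \<union> G4_inner l m t s"
  unfolding G4_graph_def G4_inner_def UNIV_bool by (auto simp: F_graph_def F_inner_def)

lemma sum_Pow_card:
  fixes x :: real
  assumes "finite A"
  shows "(\<Sum>C\<in>Pow A. x ^ card C) = (1 + x) ^ card A"
proof -
  have "disjoint_family_on (\<lambda>i. {i}) A" by (auto simp: disjoint_family_on_def)
  from weighted_sum_Pow_blocks[OF assms this, of x "\<lambda>_ _. 1"] show ?thesis
    by (simp add: Pow_insert add.commute)
qed

locale G4_replacement =
  fixes G :: "'a graph" and orient :: "'a set \<Rightarrow> 'a \<times> 'a" and l m t s :: nat and a b :: "'a set \<Rightarrow> attachment"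
  assumes simple: "simple_graph G" and orient: "orientation G orient"
    and att: "\<And>e. e \<in> edges G \<Longrightarrow> valid_attachment l m t s (a e) \<and> valid_attachment l m t s (b e)"
    and params: "m \<le> l" "s \<le> m" "t + m \<le> l"
begin

abbreviation "HG \<equiv> E_G4 l m t s a b orient G"
abbreviation "pl \<equiv> place (False, Center) (True, Center) orient"
abbreviation "D \<equiv> G4_inner l m t s"
abbreviation "u e \<equiv> fst (orient e)"
abbreviation "w e \<equiv> snd (orient e)"

lemma edge_ends:
  assumes "e \<in> edges G"
  shows "e = {u e, w e}" "u e \<noteq> w e" "u e \<in> verts G" "w e \<in> verts G"
proof -
  have e: "e = {u e, w e}" using orient assms by (auto simp: orientation_def)
  have "card e = 2" "e \<subseteq> verts G" using simple assms by (auto simp: simple_graph_def nsets_def)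
  then have c: "card {u e, w e} = 2" "{u e, w e} \<subseteq> verts G" unfolding e[symmetric] .
  show "e = {u e, w e}" by (rule e)
  show "u e \<noteq> w e" using c(1) by auto
  show "u e \<in> verts G" "w e \<in> verts G" using c(2) by simp_all
qed

lemma finite_verts: "finite (verts G)" using simple by (simp add: simple_graph_def)

lemma finite_edges: "finite (edges G)"
proof (rule finite_subset)
  show "edges G \<subseteq> Pow (verts G)" using simple by (auto simp: simple_graph_def nsets_def)
qed (simp add: finite_verts)

lemma finite_D: "finite D" by (simp add: G4_inner_def finite_F_inner)

lemma HG_verts: "verts HG = Inl ` verts G \<union> Inr ` (edges G \<times> D)"
proof -
  have "pl e ` verts (G4_graph l m t s (a e) (b e)) = {Inl (u e), Inl (w e)} \<union> Inr ` ({e} \<times> D)" for e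
  proof -
    have "pl e ` D = (\<lambda>h. Inr (e, h)) ` D"
      by (rule image_cong) (simp_all add: place_simps(3))
    then show ?thesis unfolding G4_verts image_Un by (auto simp: place_simps(1,2))
  qed
  then have "verts HG = Inl ` verts G \<union> (\<Union>e\<in>edges G. {Inl (u e), Inl (w e)} \<union> Inr ` ({e} \<times> D))"
    by (simp add: E_G4_def replace_edges_def)
  then show ?thesis using edge_ends(3,4) by auto
qed

text \<open>The trace of a vertex set of the new graph on the copy of G4 at \<open>e\<close> consists of the endpoints whose images are in \<open>S\<close>
and of the inner vertices recorded in \<open>U\<close>; every edge of the new graph lies in one copy.\<close>

lemma indep_HG_iff:
  assumes "U \<subseteq> edges G \<times> D"
  shows "indep (Inl ` S \<union> Inr ` U) (edges HG) \<longleftrightarrow>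
    (\<forall>e\<in>edges G. indep (endpoints_in (u e \<in> S) (w e \<in> S) \<union> snd ` (U \<inter> {e} \<times> D)) (edges (G4_graph l m t s (a e) (b e))))"
proof -
  let ?T = "Inl ` S \<union> Inr ` U"
  have edges: "edges HG = (\<Union>e\<in>edges G. image (pl e) ` edges (G4_graph l m t s (a e) (b e)))"
    by (simp add: E_G4_def replace_edges_def)
  have G4: "card e' = 2" "e' \<subseteq> {(False, Center), (True, Center)} \<union> D"
    if "e \<in> edges G" "e' \<in> edges (G4_graph l m t s (a e) (b e))" for e e'
    using G4_edge[OF _ _ that(2)] att[OF that(1)] by blast+
  have "card e'' = 2" if e'': "e'' \<in> edges HG" for e''
  proof -
    obtain e e' where e: "e \<in> edges G" "e' \<in> edges (G4_graph l m t s (a e) (b e))" "e'' = pl e ` e'"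
      using e'' unfolding edges by blast
    have "inj (pl e)" using edge_ends(2)[OF e(1)] by (rule inj_place)
    then show ?thesis using G4(1)[OF e(1,2)] e(3) by (simp add: card_image inj_on_subset)
  qed
  then have "indep ?T (edges HG) \<longleftrightarrow>
      (\<forall>e\<in>edges G. \<forall>e'\<in>edges (G4_graph l m t s (a e) (b e)). \<not> pl e ` e' \<subseteq> ?T)"
    by (subst indep_iff_no_edge) (auto simp: edges)
  also have "\<dots> \<longleftrightarrow> (\<forall>e\<in>edges G. \<forall>e'\<in>edges (G4_graph l m t s (a e) (b e)).
      \<not> e' \<subseteq> endpoints_in (u e \<in> S) (w e \<in> S) \<union> snd ` (U \<inter> {e} \<times> D))"
  proof (intro ball_cong refl)
    fix e e' assume e: "e \<in> edges G" "e' \<in> edges (G4_graph l m t s (a e) (b e))"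
    have "pl e h \<in> ?T \<longleftrightarrow> h \<in> endpoints_in (u e \<in> S) (w e \<in> S) \<union> snd ` (U \<inter> {e} \<times> D)" if "h \<in> e'" for h
    proof -
      have nc: "(y, Center) \<notin> D" for y by (auto simp: G4_inner_def F_inner_def)
      have "h = (False, Center) \<or> h = (True, Center) \<or> h \<in> D" using G4(2)[OF e] that by auto
      then show ?thesis
      proof (elim disjE)
        assume "h \<in> D"
        moreover from this have "h \<noteq> (False, Center)" "h \<noteq> (True, Center)" using nc by auto
        ultimately show ?thesis by (force simp: place_simps(3) endpoints_in_def)
      qed (use nc in \<open>force simp: place_simps(1,2) endpoints_in_def\<close>)+
    qed
    then have "(\<forall>h\<in>e'. pl e h \<in> ?T) \<longleftrightarrow> (\<forall>h\<in>e'. h \<in> endpoints_in (u e \<in> S) (w e \<in> S) \<union> snd ` (U \<inter> {e} \<times> D))"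
      by (intro ball_cong refl)
    then show "(\<not> pl e ` e' \<subseteq> ?T) = (\<not> e' \<subseteq> endpoints_in (u e \<in> S) (w e \<in> S) \<union> snd ` (U \<inter> {e} \<times> D))"
      unfolding subset_eq ball_simps(9) by simp
  qed
  also have "\<dots> \<longleftrightarrow> (\<forall>e\<in>edges G. indep (endpoints_in (u e \<in> S) (w e \<in> S) \<union> snd ` (U \<inter> {e} \<times> D))
      (edges (G4_graph l m t s (a e) (b e))))"
    using G4(1) by (intro ball_cong refl) (simp add: indep_iff_no_edge)
  finally show ?thesis .
qed

text \<open>Once the chosen vertices \<open>S\<close> of \<open>G\<close> are fixed, the copies of G4 are independent of each other. The ends of an edge
of \<open>G\<close> may be chosen together, since the edge itself is removed.\<close>

lemma indep_gf_HG:
  "(\<Sum>T\<in>indep_sets HG. x ^ card T)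
     = (\<Sum>S\<in>Pow (verts G). x ^ card S * (\<Prod>e\<in>edges G. G4_gf l m t s (a e) (b e) x (u e \<in> S) (w e \<in> S)))"
proof -
  let ?X = "Inl ` verts G :: ('a + 'a set \<times> bool \<times> fvert) set" and ?Y = "Inr ` (edges G \<times> D)"
  let ?ind = "\<lambda>T. of_bool (indep T (edges HG)) :: real"
  let ?f = "\<lambda>S e C. of_bool (indep (endpoints_in (u e \<in> S) (w e \<in> S) \<union> snd ` C) (edges (G4_graph l m t s (a e) (b e)))) :: real"
  have fin: "finite (?X \<union> ?Y)" using finite_verts finite_edges finite_D by simp
  have disj: "disjoint_family_on (\<lambda>e. {e} \<times> D) (edges G)" by (auto simp: disjoint_family_on_def)
  have U: "edges G \<times> D = (\<Union>e\<in>edges G. {e} \<times> D)" by auto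
  have "(\<Sum>T\<in>indep_sets HG. x ^ card T) = (\<Sum>T\<in>Pow (?X \<union> ?Y). x ^ card T * ?ind T)"
    using fin unfolding indep_sets_def HG_verts
    by (intro sum.mono_neutral_cong_left) auto
  also have "\<dots> = (\<Sum>T\<in>Pow (?X \<union> ?Y). (\<lambda>A B. x ^ card (A \<union> B) * ?ind (A \<union> B)) (T \<inter> ?X) (T \<inter> ?Y))"
    by (intro sum.cong refl) (auto simp: Int_Un_distrib[symmetric] Int_absorb2)
  also have "\<dots> = (\<Sum>A\<in>Pow ?X. \<Sum>B\<in>Pow ?Y. x ^ card (A \<union> B) * ?ind (A \<union> B))"
    by (rule sum_Pow_two) auto
  also have "\<dots> = (\<Sum>S\<in>Pow (verts G). \<Sum>U\<in>Pow (edges G \<times> D).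
      x ^ card (Inl ` S \<union> Inr ` U) * ?ind (Inl ` S \<union> Inr ` U))"
    by (simp add: sum_Pow_image inj_on_def)
  also have "\<dots> = (\<Sum>S\<in>Pow (verts G). x ^ card S * (\<Prod>e\<in>edges G. G4_gf l m t s (a e) (b e) x (u e \<in> S) (w e \<in> S)))"
  proof (intro sum.cong refl)
    fix S assume S: "S \<in> Pow (verts G)"
    have "(\<Sum>U\<in>Pow (edges G \<times> D). x ^ card (Inl ` S \<union> Inr ` U) * ?ind (Inl ` S \<union> Inr ` U))
        = (\<Sum>U\<in>Pow (edges G \<times> D). x ^ card S * (x ^ card U * (\<Prod>e\<in>edges G. ?f S e (U \<inter> {e} \<times> D))))"
    proof (intro sum.cong refl)
      fix U assume U: "U \<in> Pow (edges G \<times> D)"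
      have "finite S" "finite U" using S U finite_verts finite_edges finite_D by (auto intro: finite_subset)
      then have "card (Inl ` S \<union> Inr ` U :: ('a + 'a set \<times> bool \<times> fvert) set) = card (Inl ` S :: ('a + 'a set \<times> bool \<times> fvert) set) + card (Inr ` U :: ('a + 'a set \<times> bool \<times> fvert) set)"
        by (intro card_Un_disjoint) auto
      also have "\<dots> = card S + card U" by (simp add: card_image)
      finally have c: "card (Inl ` S \<union> Inr ` U :: ('a + 'a set \<times> bool \<times> fvert) set) = card S + card U" .
      have "?ind (Inl ` S \<union> Inr ` U) = (\<Prod>e\<in>edges G. ?f S e (U \<inter> {e} \<times> D))"
        using U finite_edges by (subst indep_HG_iff) (auto simp: prod_zero_iff)
      then show "x ^ card (Inl ` S \<union> Inr ` U :: ('a + 'a set \<times> bool \<times> fvert) set) * ?ind (Inl ` S \<union> Inr ` U)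
        = x ^ card S * (x ^ card U * (\<Prod>e\<in>edges G. ?f S e (U \<inter> {e} \<times> D)))"
        unfolding c by (simp add: power_add)
    qed
    also have "\<dots> = x ^ card S * (\<Prod>e\<in>edges G. \<Sum>C\<in>Pow ({e} \<times> D). x ^ card C * ?f S e C)"
      unfolding sum_distrib_left[symmetric] U
      by (subst weighted_sum_Pow_blocks[OF finite_edges disj, where f = "?f S"]) (simp_all add: finite_D)
    also have "(\<Prod>e\<in>edges G. \<Sum>C\<in>Pow ({e} \<times> D). x ^ card C * ?f S e C)
        = (\<Prod>e\<in>edges G. G4_gf l m t s (a e) (b e) x (u e \<in> S) (w e \<in> S))"
    proof (intro prod.cong refl)
      fix e :: "'a set"
      have e: "{e} \<times> D = Pair e ` D" by auto
      show "(\<Sum>C\<in>Pow ({e} \<times> D). x ^ card C * ?f S e C) = G4_gf l m t s (a e) (b e) x (u e \<in> S) (w e \<in> S)"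
        unfolding e G4_gf_def by (subst sum_Pow_image) (simp_all add: inj_on_def card_image image_image)
    qed
    finally show "(\<Sum>U\<in>Pow (edges G \<times> D). x ^ card (Inl ` S \<union> Inr ` U :: ('a + 'a set \<times> bool \<times> fvert) set) * ?ind (Inl ` S \<union> Inr ` U))
        = x ^ card S * (\<Prod>e\<in>edges G. G4_gf l m t s (a e) (b e) x (u e \<in> S) (w e \<in> S))" .
  qed
  finally show ?thesis .
qed

definition en :: "'a set \<Rightarrow> bool \<Rightarrow> 'a" where "en e y = (if y then w e else u e)"

text \<open>The hypothesis \<open>l \<ge> 1\<close> is the condition \<open>a \<ge> 2\<close> of the half-edge weights, for \<open>a = l + 1\<close>.\<close>

theorem log_concave_HG:
  assumes l: "1 \<le> l"
  shows "log_concave (indep_poly HG)"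
proof -
  interpret half_edges "edges G" en "real l + 1"
  proof
    show "finite (edges G)" by (rule finite_edges)
    show "en e (\<not> y) \<noteq> en e y" if "e \<in> edges G" for e y
      using edge_ends(2)[OF that] by (auto simp: en_def)
    show "e = e'" if "e \<in> edges G" "e' \<in> edges G" "en e y = en e' y'" "en e (\<not> y) = en e' (\<not> y')" for e e' y y'
    proof -
      have "{en e y, en e (\<not> y)} = e" if "e \<in> edges G" for e y
        using edge_ends(1)[OF that] by (cases y) (auto simp: en_def)
      then show ?thesis using that by metis
    qed
    show "2 \<le> real l + 1" using l by simp
  qed
  let ?a = "real l + 1"
  let ?V' = "vt ` H" and ?n = "card (edges G)"
  let ?i = "card (verts G - vt ` H)"
  define c where "c k = (\<Sum>\<alpha> | \<alpha> \<subseteq> H \<and> card \<alpha> = k. F \<alpha>)" for k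
  define Q where "Q = (\<Sum>\<alpha>\<in>Pow H. monom (?a ^ card \<alpha> * F \<alpha>) (card \<alpha>))"
  have V': "?V' \<subseteq> verts G" using edge_ends(3,4) by (auto simp: H_def en_def)
  have coQ: "coeff Q k = ?a ^ k * c k" for k
  proof -
    have "coeff Q k = (\<Sum>\<alpha>\<in>Pow H. if card \<alpha> = k then ?a ^ card \<alpha> * F \<alpha> else 0)"
      by (simp add: Q_def coeff_sum)
    also have "\<dots> = (\<Sum>\<alpha> | \<alpha> \<subseteq> H \<and> card \<alpha> = k. ?a ^ k * F \<alpha>)"
      using finite_H by (intro sum.mono_neutral_cong_right) auto
    finally show ?thesis by (simp add: c_def sum_distrib_left)
  qed
  have fin: "finite {\<alpha>. \<alpha> \<subseteq> H \<and> card \<alpha> = k}" for k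
    using finite_H by (auto intro: finite_subset[of _ "Pow H"])
  have "strongly_log_concave Q"
  proof (rule strongly_log_concaveI[of "card H"])
    fix k assume "k \<le> card H"
    then obtain \<alpha> where "\<alpha> \<subseteq> H" "card \<alpha> = k" by (meson obtain_subset_with_card_n)
    then have "0 < c k" unfolding c_def using F_pos fin
      by (intro sum_pos) auto
    then show "0 < coeff Q k" by (simp add: coQ)
  next
    fix k assume k: "card H < k"
    have "card \<alpha> \<noteq> k" if "\<alpha> \<subseteq> H" for \<alpha> using card_mono[OF finite_H that] k by simp
    then have "{\<alpha>. \<alpha> \<subseteq> H \<and> card \<alpha> = k} = {}" by blast
    then show "coeff Q k = 0" unfolding coQ c_def by (simp only: sum.empty mult_zero_right)
  next
    fix k
    have "real (k + 2) * c k * c (k + 2) \<le> real (k + 1) * (c (k + 1))\<^sup>2"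
      unfolding c_def by (rule ultra_log_concave_level_sums[OF finite_H F_pos half_edge_local_condition])
    also have "\<dots> \<le> real (k + 2) * (c (k + 1))\<^sup>2" by (intro mult_right_mono) auto
    finally have "c k * c (k + 2) \<le> (c (k + 1))\<^sup>2" by (simp add: mult.assoc)
    then have le: "?a ^ (2 * k + 2) * (c k * c (k + 2)) \<le> ?a ^ (2 * k + 2) * (c (k + 1))\<^sup>2"
      by (intro mult_left_mono) auto
    have "2 * k + 2 = k + (k + 2)" "2 * k + 2 = (k + 1) * 2" by simp_all
    then have p: "?a ^ (2 * k + 2) = ?a ^ k * ?a ^ (k + 2)" "?a ^ (2 * k + 2) = (?a ^ (k + 1))\<^sup>2"
      by (metis power_add, metis power_mult)
    have "coeff Q k * coeff Q (Suc (Suc k)) = (?a ^ k * ?a ^ (k + 2)) * (c k * c (k + 2))"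
      by (simp add: coQ mult_ac)
    also have "\<dots> \<le> (?a ^ (k + 1))\<^sup>2 * (c (k + 1))\<^sup>2"
      using le unfolding p(1)[symmetric] p(2)[symmetric] .
    also have "\<dots> = (coeff Q (Suc k))\<^sup>2" by (simp add: coQ power_mult_distrib)
    finally show "coeff Q k * coeff Q (Suc (Suc k)) \<le> (coeff Q (Suc k))\<^sup>2" .
  qed
  then have lc: "strongly_log_concave ([:1, real m:] ^ (2 * ?n) * ([:1, real (m - s):] ^ (2 * ?n) *
      ([:1, real (l - t):] ^ (2 * ?n) * ([:1, 1:] ^ ?i * Q))))" (is "strongly_log_concave ?R")
    by (intro strongly_log_concave_linear_power) auto
  \<comment> \<open>The isolated vertices of \<open>G\<close> are those outside \<open>?V'\<close>; they contribute the power of \<open>1 + x\<close>.\<close>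
  have "(\<Sum>T\<in>indep_sets HG. monom 1 (card T)) = ?R"
  proof (rule poly_eq_poly_eq_iff[THEN iffD1], rule ext)
    fix x :: real
    let ?g = "\<lambda>S. \<Prod>e\<in>edges G. pair_wt ?a x (en e False \<in> S) (en e True \<in> S)"
    have "poly (\<Sum>T\<in>indep_sets HG. monom 1 (card T)) x = (\<Sum>T\<in>indep_sets HG. x ^ card T)"
      by (simp add: poly_sum poly_monom)
    also have "\<dots> = (\<Sum>S\<in>Pow (verts G). x ^ card S * (\<Prod>e\<in>edges G. (common_factor l m t s x)\<^sup>2
        * pair_wt ?a x (en e False \<in> S) (en e True \<in> S)))"
      unfolding indep_gf_HG using att params
      by (intro sum.cong refl arg_cong2[of _ _ _ _ "(*)"] prod.cong) (auto simp: G4_gf_eq en_def)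
    also have "\<dots> = common_factor l m t s x ^ (2 * ?n) * (\<Sum>S\<in>Pow (verts G). x ^ card S * ?g S)"
      by (simp add: prod.distrib sum_distrib_left mult_ac flip: power_mult)
    also have "(\<Sum>S\<in>Pow (verts G). x ^ card S * ?g S)
        = (\<Sum>S\<in>Pow ((verts G - ?V') \<union> ?V'). x ^ card S * (1 * ?g (S \<inter> ?V')))"
    proof (intro sum.cong)
      show "Pow (verts G) = Pow ((verts G - ?V') \<union> ?V')" using V' by (simp add: Un_absorb2)
      fix S
      have "en e y \<in> ?V'" if "e \<in> edges G" for e y
        using that by (force simp: H_def)
      then show "x ^ card S * ?g S = x ^ card S * (1 * ?g (S \<inter> ?V'))" by simp
    qed
    also have "\<dots> = (\<Sum>C\<in>Pow (verts G - ?V'). x ^ card C * 1) * (\<Sum>S\<in>Pow ?V'. x ^ card S * ?g S)"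
      using finite_verts finite_H by (intro weighted_sum_Pow_two[where f = "\<lambda>_. 1"]) auto
    also have "(\<Sum>C\<in>Pow (verts G - ?V'). x ^ card C * 1) = (1 + x) ^ ?i"
      using finite_verts by (simp add: sum_Pow_card)
    also have "(\<Sum>S\<in>Pow ?V'. x ^ card S * ?g S) = poly Q x"
      unfolding polarisation by (simp add: Q_def poly_sum poly_monom power_mult_distrib mult_ac)
    finally show "poly (\<Sum>T\<in>indep_sets HG. monom 1 (card T)) x = poly ?R x"
      by (simp add: common_factor_def power_mult_distrib mult_ac)
  qed
  then show ?thesis
    using lc finite_verts finite_edges finite_D by (intro indep_poly_log_concaveI) (simp_all add: HG_verts)
qed

end

theorem theorem3p3:
  fixes l m t s :: nat
  assumes "l \<ge> m" and "m \<ge> s" and "l \<ge> t + m"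
  shows "(m = 1 \<or> m = s + 1 \<or> l = t + 1 \<longrightarrow>
           (\<forall>G :: 'a graph. simple_graph G \<longrightarrow>
              (\<forall>H \<in> E_G4_graphs l m t s G. log_concave (indep_poly H)))) \<and>
         (l \<ge> 1 \<and> t = 0 \<longrightarrow>
           (\<forall>G :: 'a graph. simple_graph G \<longrightarrow>
              (\<forall>H \<in> E_G4_graphs l m t s G. log_concave (indep_poly H))))"
proof -
  have "log_concave (indep_poly H)"
    if H_in: "1 \<le> l" "simple_graph G" "H \<in> E_G4_graphs l m t s G" for G :: "'a graph" and H
  proof -
    obtain a b orient where H: "H = E_G4 l m t s a b orient G" "orientation G orient"
      "\<forall>e\<in>edges G. valid_attachment l m t s (a e) \<and> valid_attachment l m t s (b e)"
      using H_in(3) by (auto simp: E_G4_graphs_def)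
    interpret G4_replacement G orient l m t s a b
      using H_in H assms by unfold_locales auto
    show ?thesis unfolding H(1) by (rule log_concave_HG[OF H_in(1)])
  qed
  moreover have "1 \<le> l" if "m = 1 \<or> m = s + 1 \<or> l = t + 1" using that assms by auto
  ultimately show ?thesis by blast
qed

end
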